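(* Assume the Ultrapower Axiom. Suppose $U$ and $W$ are uniform countably complete ultrafilters on ordinals. Then the following are equivalent: (1) $U\mathrel{I}W$; (2) $t_W(U)=s_W(U)$; (3) $t_U(W)=j_U(W)$; (4) $j_U(W)\le_S^{M_U} t_U(W)$.
   Context: For a countably complete ultrafilter $U$, $j_U:V\to M_U$ is its ultrapower and $[\mathrm{id}]_U$ the class of the identity. An ultrafilter $U$ on an ordinal $\lambda$ is uniform if $\lambda\setminus\beta\in U$ for all $\beta<\lambda$; $\mathrm{Un}$ denotes the class of countably complete uniform ultrafilters on ordinals. The internal relation: $U\mathrel{I}W$ iff $j_U\restriction x\in M_W$ for all $x\in M_W$. An internal ultrapower embedding of an inner model $M$ is $j^M_Z:M\to M^M_Z$ for some $Z\in M$ countably complete in $M$; a comparison of $(j_U,j_W)$ is a pair of internal ultrapower embeddings $i_0:M_U\to N$, $i_1:M_W\to N$ with $i_0\circ j_U=i_1\circ j_W$. The Ultrapower Axiom (UA) says every such pair admits a comparison. The seed order on $\mathrm{Un}$: $U<_S W$ (resp. $U\le_S W$) iff there is a comparison $(i_0,i_1)$ of $(j_U,j_W)$ with $i_0([\mathrm{id}]_U)<i_1([\mathrm{id}]_W)$ (resp. $\le$); under UA this is a wellorder of $\mathrm{Un}$, and $\le_S^{M}$ denotes the order computed in $M$. If $U$ is countably complete and $W'\in M_U$ is, in $M_U$, a countably complete uniform ultrafilter on an ordinal $\delta'$, the $U$-limit of $W'$ is $U^-(W')=\{X\subseteq\delta : j_U(X)\cap\delta'\in W'\}$ where $\delta$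 is least with $\delta'\le j_U(\delta)$. For $U,W\in\mathrm{Un}$, $t_U(W)$ is the $\le_S^{M_U}$-least $W'\in\mathrm{Un}^{M_U}$ with $U^-(W')=W$. For $U$ uniform on $\lambda$ and $W$ countably complete, $s_W(U)=\{X\in P(\lambda_* )\cap M_W : j_W^{-1}[X]\in U\}$ where $\lambda_*=\sup j_W[\lambda]$.
   Formalization: λ_* = sup j_W[λ] is read as the strict supremum (least ordinal above all j_W(ξ), ξ<λ); this agrees with sup for limit λ, while for λ = α+1 (U principal) the ordinary sup makes s_W(U) empty, so (2) fails though (1) holds. *)

theory Defs
  imports Main
begin

section \<open>Models of first-order ZFC\<close>

text \<open>
  The universe \<open>V\<close> is an arbitrary model of first-order ZFC: a type \<open>'v\<close> together with the map
  \<open>elts\<close> that sends a set to the HOL set of its elements. Separation and replacement are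
  the first-order schemes (with parameters, supplied by the assignment \<open>e\<close>), and the model need
  not be well-founded from outside. Hence validity of a statement in all types of class \<open>zfc\<close>
  is validity in all models of ZFC. Proper classes are HOL sets of type \<open>'v set\<close>.
\<close>

datatype fm = Mem nat nat | Eq nat nat | Neg fm | Conj fm fm | All nat fm

primrec sat :: "('v \<Rightarrow> 'v set) \<Rightarrow> fm \<Rightarrow> (nat \<Rightarrow> 'v) \<Rightarrow> bool" where
  "sat el (Mem i k) e \<longleftrightarrow> e i \<in> el (e k)"
| "sat el (Eq i k) e \<longleftrightarrow> e i = e k"
| "sat el (Neg p) e \<longleftrightarrow> \<not> sat el p e"
| "sat el (Conj p q) e \<longleftrightarrow> sat el p e \<and> sat el q e"
| "sat el (All i p) e \<longleftrightarrow> (\<forall>x. sat el p (e(i := x)))"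

class zfc =
  fixes elts :: "'a \<Rightarrow> 'a set"
  assumes extensionality: "elts x = elts y \<Longrightarrow> x = y"
    and foundation: "elts x \<noteq> {} \<Longrightarrow> \<exists>y\<in>elts x. elts y \<inter> elts x = {}"
    and pairing: "\<exists>z. elts z = {x, y}"
    and union: "\<exists>z. elts z = (\<Union>y\<in>elts x. elts y)"
    and powerset: "\<exists>z. elts z = {y. elts y \<subseteq> elts x}"
    and infinity: "\<exists>z. (\<exists>x\<in>elts z. elts x = {}) \<and>
        (\<forall>x\<in>elts z. \<exists>y\<in>elts z. elts y = insert x (elts x))"
    and separation: "\<exists>z. elts z = {x \<in> elts a. sat elts p (e(0 := x))}"
    and replacement: "\<forall>x\<in>elts a. \<exists>!y. sat elts p (e(0 := x, 1 := y)) \<Longrightarrow>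
        \<exists>z. elts z = {y. \<exists>x\<in>elts a. sat elts p (e(0 := x, 1 := y))}"
    and choice: "\<forall>x\<in>elts a. elts x \<noteq> {} \<Longrightarrow>
        \<forall>x\<in>elts a. \<forall>y\<in>elts a. x \<noteq> y \<longrightarrow> elts x \<inter> elts y = {} \<Longrightarrow>
        \<exists>c. \<forall>x\<in>elts a. \<exists>!y. y \<in> elts c \<inter> elts x"

text \<open>\<open>vset A\<close> is meaningful only if some set has exactly the elements \<open>A\<close>.\<close>

definition vset :: "'v::zfc set \<Rightarrow> 'v" where
  "vset A = (THE s. elts s = A)"

definition opair :: "'v::zfc \<Rightarrow> 'v \<Rightarrow> 'v" where
  "opair x y = vset {vset {x}, vset {x, y}}"

definition function_on :: "'v::zfc \<Rightarrow> 'v \<Rightarrow> bool" where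
  "function_on X f \<longleftrightarrow>
    (\<forall>p\<in>elts f. \<exists>x\<in>elts X. \<exists>y. p = opair x y) \<and>
    (\<forall>x\<in>elts X. \<exists>!y. opair x y \<in> elts f)"

definition app :: "'v::zfc \<Rightarrow> 'v \<Rightarrow> 'v" where
  "app f x = (THE y. opair x y \<in> elts f)"

definition lam :: "'v::zfc \<Rightarrow> ('v \<Rightarrow> 'v) \<Rightarrow> 'v" where
  "lam X F = vset {opair x (F x) | x. x \<in> elts X}"

definition transitive :: "'v::zfc \<Rightarrow> bool" where
  "transitive x \<longleftrightarrow> (\<forall>y\<in>elts x. elts y \<subseteq> elts x)"

definition Ord :: "'v::zfc \<Rightarrow> bool" where
  "Ord x \<longleftrightarrow> transitive x \<and> (\<forall>y\<in>elts x. transitive y)"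

definition is_inductive :: "'v::zfc \<Rightarrow> bool" where
  "is_inductive z \<longleftrightarrow>
    vset {} \<in> elts z \<and> (\<forall>x\<in>elts z. vset (insert x (elts x)) \<in> elts z)"

definition omega :: "'v::zfc" where
  "omega = vset {n. \<forall>z. is_inductive z \<longrightarrow> n \<in> elts z}"


section \<open>Ultrafilters and ultrapowers in an inner model\<close>

text \<open>
  The notions below are computed in a transitive class \<open>M\<close>; taking \<open>M = UNIV\<close> gives them in \<open>V\<close>.
  Pairs, functions, ordinals and \<open>\<omega>\<close> are absolute and are not relativized.

  An ultrafilter determines the set it lives on, namely its union.
\<close>

definition space :: "'v::zfc \<Rightarrow> 'v" where
  "space Z = vset (\<Union>A\<in>elts Z. elts A)"

definition ultrafilter_on :: "'v::zfc set \<Rightarrow> 'v \<Rightarrow> 'v \<Rightarrow> bool" where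
  "ultrafilter_on M X Z \<longleftrightarrow>
    X \<in> M \<and> Z \<in> M \<and>
    (\<forall>A\<in>elts Z. elts A \<subseteq> elts X) \<and>
    X \<in> elts Z \<and> vset {} \<notin> elts Z \<and>
    (\<forall>A\<in>elts Z. \<forall>B\<in>M. elts A \<subseteq> elts B \<and> elts B \<subseteq> elts X \<longrightarrow> B \<in> elts Z) \<and>
    (\<forall>A\<in>elts Z. \<forall>B\<in>elts Z. vset (elts A \<inter> elts B) \<in> elts Z) \<and>
    (\<forall>A\<in>M. elts A \<subseteq> elts X \<longrightarrow> A \<in> elts Z \<or> vset (elts X - elts A) \<in> elts Z)"

definition countably_complete :: "'v::zfc set \<Rightarrow> 'v \<Rightarrow> bool" where
  "countably_complete M Z \<longleftrightarrow>
    (\<forall>s\<in>M. function_on omega s \<and> (\<forall>n\<in>elts omega. app s n \<in> elts Z) \<longrightarrow>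
      vset (\<Inter>n\<in>elts omega. elts (app s n)) \<in> elts Z)"

definition cc_ultrafilter :: "'v::zfc set \<Rightarrow> 'v \<Rightarrow> bool" where
  "cc_ultrafilter M Z \<longleftrightarrow> (\<exists>X. ultrafilter_on M X Z) \<and> countably_complete M Z"

definition Unif :: "'v::zfc set \<Rightarrow> 'v set" where
  "Unif M = {U. cc_ultrafilter M U \<and> Ord (space U) \<and>
    (\<forall>\<beta>\<in>elts (space U). vset (elts (space U) - elts \<beta>) \<in> elts U)}"

definition ult_mem :: "'v::zfc \<Rightarrow> 'v \<Rightarrow> 'v \<Rightarrow> bool" where
  "ult_mem Z f g \<longleftrightarrow> vset {x \<in> elts (space Z). app f x \<in> elts (app g x)} \<in> elts Z"

definition funs :: "'v::zfc set \<Rightarrow> 'v \<Rightarrow> 'v \<Rightarrow> 'v" where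
  "funs M X A = vset {f \<in> M. function_on X f \<and> (\<forall>x\<in>elts X. app f x \<in> elts A)}"

text \<open>
  The value at \<open>f\<close> of the transitive collapse of the ultrapower of \<open>M\<close> by \<open>Z\<close>, that is \<open>[f]\<close>. Since
  \<open>V\<close> may be ill-founded from outside, an external map satisfying the collapse recursion
  need not be unique, so the collapse is evaluated through set approximations \<open>t\<close> that
  belong to \<open>M\<close>. For transitive \<open>A\<close> the functions into \<open>A\<close> form, up to equality
  \<open>Z\<close>-almost everywhere, an initial segment of the ultrapower. Functions that agree \<open>Z\<close>-almost
  everywhere receive the same value, so no quotient is taken beforehand.
\<close>

definition ult_class :: "'v::zfc set \<Rightarrow> 'v \<Rightarrow> 'v \<Rightarrow> 'v" where
  "ult_class M Z f = (THE y. \<exists>A\<in>M. \<exists>t\<in>M.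
    transitive A \<and>
    f \<in> elts (funs M (space Z) A) \<and>
    function_on (funs M (space Z) A) t \<and>
    (\<forall>g \<in> elts (funs M (space Z) A).
      elts (app t g) = {app t h | h. h \<in> elts (funs M (space Z) A) \<and> ult_mem Z h g}) \<and>
    y = app t f)"

definition Ult :: "'v::zfc set \<Rightarrow> 'v \<Rightarrow> 'v set" where
  "Ult M Z = {ult_class M Z f | f. f \<in> M \<and> function_on (space Z) f}"

definition ult_emb :: "'v::zfc set \<Rightarrow> 'v \<Rightarrow> 'v \<Rightarrow> 'v" where
  "ult_emb M Z x = ult_class M Z (lam (space Z) (\<lambda>_. x))"

definition ult_id :: "'v::zfc set \<Rightarrow> 'v \<Rightarrow> 'v" where
  "ult_id M Z = ult_class M Z (lam (space Z) (\<lambda>x. x))"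


section \<open>Comparisons, the Ultrapower Axiom and the seed order\<close>

text \<open>
  The comparison of \<open>(j_U, j_W)\<close> whose internal ultrapower embeddings are those of
  \<open>Z0 \<in> M_U\<close> and \<open>Z1 \<in> M_W\<close>.
\<close>

definition comparison :: "'v::zfc set \<Rightarrow> 'v \<Rightarrow> 'v \<Rightarrow> 'v \<Rightarrow> 'v \<Rightarrow> bool" where
  "comparison M U W Z0 Z1 \<longleftrightarrow>
    cc_ultrafilter (Ult M U) Z0 \<and> cc_ultrafilter (Ult M W) Z1 \<and>
    Ult (Ult M U) Z0 = Ult (Ult M W) Z1 \<and>
    (\<forall>x\<in>M. ult_emb (Ult M U) Z0 (ult_emb M U x) = ult_emb (Ult M W) Z1 (ult_emb M W x))"

definition ultrapower_axiom :: "'v::zfc set \<Rightarrow> bool" where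
  "ultrapower_axiom M \<longleftrightarrow>
    (\<forall>U W. cc_ultrafilter M U \<and> cc_ultrafilter M W \<longrightarrow> (\<exists>Z0 Z1. comparison M U W Z0 Z1))"

definition seed_le :: "'v::zfc set \<Rightarrow> 'v \<Rightarrow> 'v \<Rightarrow> bool" where
  "seed_le M U W \<longleftrightarrow> (\<exists>Z0 Z1. comparison M U W Z0 Z1 \<and>
    (ult_emb (Ult M U) Z0 (ult_id M U) \<in> elts (ult_emb (Ult M W) Z1 (ult_id M W)) \<or>
     ult_emb (Ult M U) Z0 (ult_id M U) = ult_emb (Ult M W) Z1 (ult_id M W)))"


section \<open>The internal relation, limits and translations\<close>

definition internal :: "'v::zfc \<Rightarrow> 'v \<Rightarrow> bool" where
  "internal U W \<longleftrightarrow> (\<forall>x \<in> Ult UNIV W. lam x (ult_emb UNIV U) \<in> Ult UNIV W)"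

definition limit_index :: "'v::zfc \<Rightarrow> 'v \<Rightarrow> 'v" where
  "limit_index U \<delta>' = (THE \<delta>. Ord \<delta> \<and> elts \<delta>' \<subseteq> elts (ult_emb UNIV U \<delta>) \<and>
    (\<forall>\<gamma>\<in>elts \<delta>. \<not> elts \<delta>' \<subseteq> elts (ult_emb UNIV U \<gamma>)))"

definition ult_limit :: "'v::zfc \<Rightarrow> 'v \<Rightarrow> 'v" where
  "ult_limit U W' = vset {X. elts X \<subseteq> elts (limit_index U (space W')) \<and>
    vset (elts (ult_emb UNIV U X) \<inter> elts (space W')) \<in> elts W'}"

definition t_trans :: "'v::zfc \<Rightarrow> 'v \<Rightarrow> 'v" where
  "t_trans U W = (THE W'. W' \<in> Unif (Ult UNIV U) \<and> ult_limit U W' = W \<and>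
    (\<forall>W''\<in>Unif (Ult UNIV U). ult_limit U W'' = W \<longrightarrow> seed_le (Ult UNIV U) W' W''))"

text \<open>
  The ordinal \<open>sup j_W[\<lambda>]\<close> is the strict supremum, the least ordinal above all \<open>j_W(\<xi>)\<close> with
  \<open>\<xi> < \<lambda>\<close>. For limit \<open>\<lambda>\<close> this is the ordinary supremum. For \<open>\<lambda> = \<alpha> + 1\<close> (principal ultrafilters)
  it is \<open>j_W(\<alpha>) + 1\<close>; with the ordinary supremum \<open>s_W(U)\<close> would be empty.
\<close>

definition sup_image :: "'v::zfc \<Rightarrow> 'v \<Rightarrow> 'v" where
  "sup_image W l = vset (\<Union>\<xi>\<in>elts l. insert (ult_emb UNIV W \<xi>) (elts (ult_emb UNIV W \<xi>)))"

definition s_trans :: "'v::zfc \<Rightarrow> 'v \<Rightarrow> 'v" where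
  "s_trans W U = vset {X \<in> Ult UNIV W. elts X \<subseteq> elts (sup_image W (space U)) \<and>
    vset {\<xi>. ult_emb UNIV W \<xi> \<in> elts X} \<in> elts U}"

end

(* An ultrafilter of M_U whose U-limit is W induces an embedding k of M_W into its ultrapower,
   sending [f]_W to [j_U(f)]. If W'' is another such ultrafilter that lies strictly below W' in the
   seed order of M_U, then W'' is a limit of ultrafilters in the sense of the Ketonen order; pulling
   back along k shows that W lies below itself in the Ketonen order, provided that k is amenable to
   M_W. The Ketonen order is irreflexive by a diagonal recursion on the underlying ordinal. So
   t_U(W) is the only ultrafilter of M_U with U-limit W and an amenable k. The ultrafilter derived
   from a comparison has this property, and so do j_U(W) and, with U and W exchanged, s_W(U) as soon
   as s_W(U) belongs to M_W. All four conditions therefore say that s_W(U) is in M_W: it is then the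
   ultrafilter of M_W whose ultrapower embedding is the restriction of j_U.

   Every model involved is an iterated ultrapower of V. To treat V and its ultrapowers alike, all
   constructions are carried out in an arbitrary transitive class that satisfies ZFC, with formulas
   entering only through a calculus of definable predicates; Los's theorem applied to the Ultrapower
   Axiom, as a single sentence, transfers it from V to M_U. *)
theory Submission
  imports Defs
begin

section \<open>Definability over transitive models\<close>

text \<open>The universe need not be well founded from outside, and a HOL set of its elements need
  not be a class of the model. Induction, recursion and choice are therefore carried out inside a
  model, on predicates shown to be definable. A definition must moreover be one formula for all
  models at once, since Los's theorem compares the same formula in a model and in its ultrapower.

  The map k is an embedding of proper classes, but its amenability is needed only in part. A witness
  of the Ketonen order attaches to an ordinal \<eta> a family of subsets of \<eta>. Pulling it back
  only asks that, for subsets x of [id]_W in M_W, membership of k(x) in a given set be decided by a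
  set of M_W. Since the families need not be ultrafilters, pullbacks and composites of witnesses are
  witnesses without further verification.

  Of the seed order only two facts enter: antisymmetry, and the dichotomy that A is at most B or B
  is strictly below A in the Ketonen order. The least ultrafilter with a given limit is found by
  exhibiting it, not by a wellordering argument.\<close>

lemma elts_eq_iff: "elts x = elts y \<longleftrightarrow> x = y"
  using extensionality by blast

definition small :: "'v::zfc set \<Rightarrow> bool" where
  "small A \<longleftrightarrow> (\<exists>z. elts z = A)"

lemma vset_eqI: "elts z = A \<Longrightarrow> vset A = z"
  unfolding vset_def by (rule the_equality) (simp_all add: elts_eq_iff[symmetric])

lemma vset_elts[simp]: "vset (elts x) = x"
  by (rule vset_eqI) simp

lemma elts_vset[simp]: "small A \<Longrightarrow> elts (vset A) = A"
  unfolding small_def by (elim exE) (simp add: vset_eqI)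

lemma small_elts[simp]: "small (elts x)"
  unfolding small_def by blast

section \<open>Formulas relativized to a class, and renaming of their variables\<close>

primrec satM :: "'v::zfc set \<Rightarrow> fm \<Rightarrow> (nat \<Rightarrow> 'v) \<Rightarrow> bool" where
  "satM M (Mem i k) e \<longleftrightarrow> e i \<in> elts (e k)"
| "satM M (Eq i k) e \<longleftrightarrow> e i = e k"
| "satM M (Neg p) e \<longleftrightarrow> \<not> satM M p e"
| "satM M (Conj p q) e \<longleftrightarrow> satM M p e \<and> satM M q e"
| "satM M (All i p) e \<longleftrightarrow> (\<forall>x\<in>M. satM M p (e(i := x)))"

lemma satM_UNIV: "satM UNIV p e = sat elts p e"
  by (induction p arbitrary: e) auto

primrec vars :: "fm \<Rightarrow> nat set" where
  "vars (Mem i k) = {i, k}"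
| "vars (Eq i k) = {i, k}"
| "vars (Neg p) = vars p"
| "vars (Conj p q) = vars p \<union> vars q"
| "vars (All i p) = insert i (vars p)"

lemma finite_vars: "finite (vars p)"
  by (induction p) auto

primrec rename :: "(nat \<Rightarrow> nat) \<Rightarrow> fm \<Rightarrow> fm" where
  "rename r (Mem i k) = Mem (r i) (r k)"
| "rename r (Eq i k) = Eq (r i) (r k)"
| "rename r (Neg p) = Neg (rename r p)"
| "rename r (Conj p q) = Conj (rename r p) (rename r q)"
| "rename r (All i p) = All (r i) (rename r p)"

lemma vars_rename: "vars (rename r p) = r ` vars p"
  by (induction p) auto

text \<open>Bound variables are renamed as well. Injectivity keeps two of them, or a bound and a
  free one, from being merged, so that the update at \<open>i\<close> matches the update at
  \<open>r i\<close>.\<close>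

lemma satM_rename:
  assumes "inj_on r (vars p)" "\<forall>i\<in>vars p. e' i = e (r i)"
  shows "satM M (rename r p) e = satM M p e'"
  using assms
proof (induction p arbitrary: e e')
  case (All i p)
  have "satM M (rename r p) (e(r i := x)) = satM M p (e'(i := x))" for x
    using All.prems by (intro All.IH) (auto simp: inj_on_def)
  then show ?case by simp
next
  case (Conj p q)
  then show ?case by (simp add: inj_on_Un) blast
qed auto

lemma rename_id: "rename (\<lambda>i. i) p = p"
  by (induction p) auto

lemma satM_cong: "\<forall>i\<in>vars p. e' i = e i \<Longrightarrow> satM M p e = satM M p e'"
  using satM_rename[of "\<lambda>i. i" p e' e M] by (simp add: rename_id)

text \<open>Extensionality and foundation are not listed: transitive classes inherit them.\<close>

definition inner :: "'v::zfc set \<Rightarrow> bool" where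
  "inner M \<longleftrightarrow> (\<forall>x\<in>M. elts x \<subseteq> M)
    \<and> (\<forall>x\<in>M. \<forall>y\<in>M. \<exists>z\<in>M. elts z = {x, y})
    \<and> (\<forall>x\<in>M. \<exists>z\<in>M. elts z = (\<Union>y\<in>elts x. elts y))
    \<and> (\<forall>x\<in>M. \<exists>z\<in>M. elts z = {y\<in>M. elts y \<subseteq> elts x})
    \<and> (\<exists>z\<in>M. (\<exists>x\<in>elts z. elts x = {}) \<and> (\<forall>x\<in>elts z. \<exists>y\<in>elts z. elts y = insert x (elts x)))
    \<and> (\<forall>p e. \<forall>a\<in>M. (\<forall>i. e i \<in> M) \<longrightarrow> (\<exists>z\<in>M. elts z = {x \<in> elts a. satM M p (e(0 := x))}))
    \<and> (\<forall>p e. \<forall>a\<in>M. (\<forall>i. e i \<in> M) \<longrightarrow> (\<forall>x\<in>elts a. \<exists>!y. y \<in> M \<and> satM M p (e(0 := x, 1 := y))) \<longrightarrow>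
         (\<exists>z\<in>M. elts z = {y\<in>M. \<exists>x\<in>elts a. satM M p (e(0 := x, 1 := y))}))
    \<and> (\<forall>a\<in>M. (\<forall>x\<in>elts a. elts x \<noteq> {}) \<longrightarrow>
         (\<forall>x\<in>elts a. \<forall>y\<in>elts a. x \<noteq> y \<longrightarrow> elts x \<inter> elts y = {}) \<longrightarrow>
         (\<exists>c\<in>M. \<forall>x\<in>elts a. \<exists>!y. y \<in> elts c \<inter> elts x))"

lemma inner_UNIV: "inner (UNIV :: 'v::zfc set)"
  unfolding inner_def
proof (intro conjI, goal_cases)
  case 4
  then show ?case by (simp add: powerset)
next
  case 5
  show ?case by (simp add: infinity del: Set.bex_simps)
next
  case 6
  then show ?case unfolding satM_UNIV by (simp add: separation)
next
  case 7
  show ?case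
  proof (intro allI ballI impI)
    fix p e and a :: 'v
    assume *: "\<forall>x\<in>elts a. \<exists>!y. y \<in> UNIV \<and> satM UNIV p (e(0 := x, 1 := y))"
    have "\<exists>z. elts z = {y. \<exists>x\<in>elts a. sat elts p (e(0 := x, 1 := y))}"
      by (rule replacement) (use * in \<open>simp add: satM_UNIV\<close>)
    then show "\<exists>z\<in>UNIV. elts z = {y \<in> UNIV. \<exists>x\<in>elts a. satM UNIV p (e(0 := x, 1 := y))}"
      by (simp add: satM_UNIV)
  qed
next
  case 8
  show ?case
  proof (intro ballI impI)
    fix a :: 'v
    assume "\<forall>x\<in>elts a. elts x \<noteq> {}" "\<forall>x\<in>elts a. \<forall>y\<in>elts a. x \<noteq> y \<longrightarrow> elts x \<inter> elts y = {}"
    from choice[OF this] show "\<exists>c\<in>UNIV. \<forall>x\<in>elts a. \<exists>!y. y \<in> elts c \<inter> elts x" by blast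
  qed
qed (simp_all add: pairing union)

text \<open>Environments are read as de Bruijn stacks: a quantifier pushes its value with
  \<open>econs\<close>, and its body refers to that value as \<open>ehd\<close> and to the outer
  variables through \<open>etl\<close>.\<close>

abbreviation (input) ehd :: "(nat \<Rightarrow> 'v) \<Rightarrow> 'v" where "ehd e \<equiv> e 0"
definition etl :: "(nat \<Rightarrow> 'v) \<Rightarrow> nat \<Rightarrow> 'v" where "etl e = (\<lambda>n. e (Suc n))"
definition econs :: "'v \<Rightarrow> (nat \<Rightarrow> 'v) \<Rightarrow> nat \<Rightarrow> 'v" where "econs x e = (\<lambda>n. case n of 0 \<Rightarrow> x | Suc k \<Rightarrow> e k)"

lemma econs_simps[simp]: "econs x e 0 = x" "etl (econs x e) = e" "econs x e (Suc n) = e n"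
  by (auto simp: econs_def etl_def)

lemma econs_in: "x \<in> M \<Longrightarrow> \<forall>i. e i \<in> M \<Longrightarrow> \<forall>i. econs x e i \<in> M"
  by (auto simp: econs_def split: nat.split)

lemma etl_in: "\<forall>i. e i \<in> M \<Longrightarrow> \<forall>i. etl e i \<in> M"
  by (auto simp: etl_def)

definition mrg :: "(nat \<Rightarrow> 'v) \<Rightarrow> (nat \<Rightarrow> 'v) \<Rightarrow> nat \<Rightarrow> 'v" where
  "mrg c e n = (if even n then e (n div 2) else c (n div 2))"

lemma mrg_simps[simp]: "mrg c e (2 * n) = e n" "mrg c e (Suc (2 * n)) = c n" "mrg c e 0 = e 0"
  "mrg c e (Suc 0) = c 0"
  by (auto simp: mrg_def)

definition valid :: "'v::zfc set set \<Rightarrow> 'v set \<Rightarrow> 'v set \<Rightarrow> (nat \<Rightarrow> 'v) \<Rightarrow> bool" where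
  "valid C K M e \<longleftrightarrow> M \<in> C \<and> inner M \<and> K \<subseteq> M \<and> (\<forall>i. e i \<in> M)"

text \<open>\<open>D C K \<Phi>\<close>: one formula with parameters from \<open>K\<close> defines \<open>\<Phi> M\<close> in each inner model \<open>M \<in> C\<close>
  that contains \<open>K\<close>. Even variables hold the environment, odd variables the parameters.\<close>

definition D :: "'v::zfc set set \<Rightarrow> 'v set \<Rightarrow> ('v set \<Rightarrow> (nat \<Rightarrow> 'v) \<Rightarrow> bool) \<Rightarrow> bool" where
  "D C K \<Phi> \<longleftrightarrow> (\<exists>p c. (\<forall>j. Suc (2 * j) \<in> vars p \<longrightarrow> c j \<in> K) \<and>
     (\<forall>M e. valid C K M e \<longrightarrow> (\<Phi> M e \<longleftrightarrow> satM M p (mrg c e))))"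

text \<open>Closure of \<open>M\<close> under the term is part of the notion: substituting a term
  into a predicate is expressed by quantifying over its value in \<open>M\<close>.\<close>

definition DF :: "'v::zfc set set \<Rightarrow> 'v set \<Rightarrow> ('v set \<Rightarrow> (nat \<Rightarrow> 'v) \<Rightarrow> 'v) \<Rightarrow> bool" where
  "DF C K t \<longleftrightarrow> (\<forall>M e. valid C K M e \<longrightarrow> t M e \<in> M) \<and> D C K (\<lambda>M e. ehd e = t M (etl e))"

lemma valid_econs: "valid C K M e \<Longrightarrow> x \<in> M \<Longrightarrow> valid C K M (econs x e)"
  unfolding valid_def using econs_in by metis

lemma valid_etl: "valid C K M e \<Longrightarrow> valid C K M (etl e)"
  unfolding valid_def using etl_in by metis

lemma D_cong:
  assumes "\<And>M e. valid C K M e \<Longrightarrow> \<Phi> M e = \<Psi> M e" "D C K \<Psi>"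
  shows "D C K \<Phi>"
  using assms unfolding D_def by metis

lemma D_not: "D C K \<Phi> \<Longrightarrow> D C K (\<lambda>M e. \<not> \<Phi> M e)"
  unfolding D_def by (elim exE, rule_tac x="Neg p" in exI) auto

lemma D_conj:
  assumes "D C K \<Phi>" "D C K \<Psi>"
  shows "D C K (\<lambda>M e. \<Phi> M e \<and> \<Psi> M e)"
proof -
  obtain p c where p: "\<forall>j. Suc (2 * j) \<in> vars p \<longrightarrow> c j \<in> K"
    "\<forall>M e. valid C K M e \<longrightarrow> (\<Phi> M e \<longleftrightarrow> satM M p (mrg c e))" using assms(1) unfolding D_def by metis
  obtain q d where q: "\<forall>j. Suc (2 * j) \<in> vars q \<longrightarrow> d j \<in> K"
    "\<forall>M e. valid C K M e \<longrightarrow> (\<Psi> M e \<longleftrightarrow> satM M q (mrg d e))" using assms(2) unfolding D_def by metis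
  \<comment> \<open>Environment variables stay in place. The parameters of the first formula move to
    the even parameter slots and those of the second to the odd ones, so that the single list
    \<open>mrg d c\<close> serves both.\<close>
  define r where "r n = (if even n then n else Suc (2 * (2 * (n div 2))))" for n :: nat
  define s where "s n = (if even n then n else Suc (2 * (Suc (2 * (n div 2)))))" for n :: nat
  have inj: "inj r" "inj s"
    by (auto simp: inj_def r_def s_def elim!: oddE split: if_splits)
  have r: "satM M (rename r p) (mrg (mrg d c) e) = satM M p (mrg c e)" for M e
  proof (rule satM_rename)
    show "\<forall>i\<in>vars p. mrg c e i = mrg (mrg d c) e (r i)"
      by (auto simp: r_def mrg_def elim!: oddE)
  qed (use inj in \<open>auto intro: inj_on_subset\<close>)
  have s: "satM M (rename s q) (mrg (mrg d c) e) = satM M q (mrg d e)" for M e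
  proof (rule satM_rename)
    show "\<forall>i\<in>vars q. mrg d e i = mrg (mrg d c) e (s i)"
      by (auto simp: s_def mrg_def elim!: oddE)
  qed (use inj in \<open>auto intro: inj_on_subset\<close>)
  have rs: "mrg d c j \<in> K" if j: "Suc (2 * j) \<in> vars (Conj (rename r p) (rename s q))" for j
  proof -
    consider i where "i \<in> vars p" "Suc (2 * j) = r i" | i where "i \<in> vars q" "Suc (2 * j) = s i"
      using j by (auto simp: vars_rename)
    then show ?thesis
    proof cases
      case 1
      then have "odd i" unfolding r_def by (auto split: if_splits)
      then obtain k where k: "i = Suc (2 * k)" by (auto elim: oddE)
      then have "j = 2 * k" using 1 by (auto simp: r_def)
      then show ?thesis using 1 p(1) k by auto
    next
      case 2
      then have "odd i" unfolding s_def by (auto split: if_splits)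
      then obtain k where k: "i = Suc (2 * k)" by (auto elim: oddE)
      then have "j = Suc (2 * k)" using 2 by (auto simp: s_def)
      then show ?thesis using 2 q(1) k by auto
    qed
  qed
  show ?thesis unfolding D_def
    by (rule exI[of _ "Conj (rename r p) (rename s q)"], rule exI[of _ "mrg d c"])
       (use p q r s rs in auto)
qed

lemma D_ren:
  assumes r: "inj r" and D: "D C K \<Phi>"
  shows "D C K (\<lambda>M e. \<Phi> M (\<lambda>i. e (r i)))"
proof -
  obtain p c where p: "\<forall>j. Suc (2 * j) \<in> vars p \<longrightarrow> c j \<in> K"
    "\<forall>M e. valid C K M e \<longrightarrow> (\<Phi> M e \<longleftrightarrow> satM M p (mrg c e))" using D unfolding D_def by metis
  define s where "s n = (if even n then 2 * r (n div 2) else n)" for n :: nat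
  have inj: "inj s"
  proof (rule injI)
    fix x y assume *: "s x = s y"
    have "even x \<longleftrightarrow> even (s x)" for x by (simp add: s_def)
    with * have "even x \<longleftrightarrow> even y" by metis
    with * r show "x = y" by (auto simp: s_def inj_def elim!: oddE evenE split: if_splits)
  qed
  have s: "satM M (rename s p) (mrg c e) = satM M p (mrg c (\<lambda>i. e (r i)))" for M e
  proof (rule satM_rename)
    show "\<forall>i\<in>vars p. mrg c (\<lambda>i. e (r i)) i = mrg c e (s i)"
      by (auto simp: s_def mrg_def elim!: oddE)
  qed (use inj in \<open>auto intro: inj_on_subset\<close>)
  have "c j \<in> K" if "Suc (2 * j) \<in> vars (rename s p)" for j
  proof -
    obtain i where i: "i \<in> vars p" "Suc (2 * j) = s i" using \<open>Suc (2 * j) \<in> _\<close> by (auto simp: vars_rename)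
    then have "i = Suc (2 * j)" unfolding s_def by (auto split: if_splits) (presburger)
    then show ?thesis using i p by auto
  qed
  moreover have "\<Phi> M (\<lambda>i. e (r i)) = satM M (rename s p) (mrg c e)" if "valid C K M e" for M e
    using p(2) s that by (auto simp: valid_def)
  ultimately show ?thesis unfolding D_def by blast
qed

lemma D_ex:
  assumes "D C K (\<lambda>M e. Q M (etl e) (ehd e))"
  shows "D C K (\<lambda>M e. \<exists>x\<in>M. Q M e x)"
proof -
  obtain p c where p: "\<forall>j. Suc (2 * j) \<in> vars p \<longrightarrow> c j \<in> K"
    "\<forall>M e. valid C K M e \<longrightarrow> (Q M (etl e) (ehd e) \<longleftrightarrow> satM M p (mrg c e))"
    using assms unfolding D_def by metis
  obtain n where n: "\<forall>i\<in>vars p. i < n" using finite_vars[of p] finite_nat_set_iff_bounded by blast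
  \<comment> \<open>The bound value sits in variable 0, which becomes the fresh variable
    \<open>2 * n\<close>. The other even variables drop by 2, that is, by one position of the
    environment.\<close>
  define r where "r i = (if i = 0 then 2 * n else if even i then i - 2 else i)" for i :: nat
  have inj: "inj_on r (vars p)"
    unfolding inj_on_def r_def using n by (auto elim!: evenE split: if_splits)
  have r: "satM M (rename r p) ((mrg c e)(2 * n := x)) = satM M p (mrg c (econs x e))" for M e x
  proof (rule satM_rename[OF inj], rule)
    fix i assume i: "i \<in> vars p"
    then have iN: "i < n" using n by auto
    show "mrg c (econs x e) i = ((mrg c e)(2 * n := x)) (r i)"
    proof (cases "even i")
      case True
      then obtain k where "i = 2 * k" by (auto elim: evenE)
      moreover have "mrg c (econs x e) (2 * Suc m) = e m" for m
        by (simp only: mrg_simps econs_simps)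
      ultimately show ?thesis using iN by (cases k) (auto simp: r_def)
    next
      case False
      then show ?thesis by (auto simp: r_def mrg_def)
    qed
  qed
  have "(\<exists>x\<in>M. Q M e x) = satM M (Neg (All (2 * n) (Neg (rename r p)))) (mrg c e)" if "valid C K M e" for M e
    using p(2) valid_econs[OF that] r by simp (metis econs_simps(1,2))
  moreover have "c j \<in> K" if j: "Suc (2 * j) \<in> vars (Neg (All (2 * n) (Neg (rename r p))))" for j
  proof -
    have "Suc (2 * j) \<noteq> 2 * n" by presburger
    then obtain i where i: "i \<in> vars p" "Suc (2 * j) = r i" using j by (auto simp: vars_rename)
    have "odd (r i)" using i(2) by (metis even_Suc dvd_triv_left)
    then have "odd i" by (auto simp: r_def split: if_splits)
    then have "i = Suc (2 * j)" using i(2) unfolding r_def by (auto split: if_splits)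
    then show ?thesis using i p by auto
  qed
  ultimately show ?thesis unfolding D_def by blast
qed

text \<open>The schemes in \<open>inner\<close> ask that the whole assignment lie in
  \<open>M\<close>, whereas \<open>D\<close> only controls the parameters that occur in the formula.
  The remaining ones are replaced by a fixed element.\<close>

lemma mrg_const_in:
  assumes "\<forall>j. Suc (2 * j) \<in> vars p \<longrightarrow> c j \<in> M" "a \<in> M" "\<forall>i. e i \<in> M"
  obtains d where "\<forall>i. mrg d e i \<in> M" "\<And>e'. satM N p (mrg d e') = satM N p (mrg c e')"
proof
  let ?d = "\<lambda>j. if c j \<in> M then c j else a"
  show "\<forall>i. mrg ?d e i \<in> M" using assms(2,3) by (auto simp: mrg_def)
  show "satM N p (mrg ?d e') = satM N p (mrg c e')" for e'
    by (rule satM_cong) (use assms(1) in \<open>auto simp: mrg_def elim!: oddE\<close>)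
qed

lemma mrg_upd: "mrg c (econs x e) = (mrg c (econs y e))(0 := x)"
proof
  fix n show "mrg c (econs x e) n = ((mrg c (econs y e))(0 := x)) n"
    by (cases "n = 0"; cases "n div 2") (auto simp: mrg_def econs_def)
qed

lemma inner_separation:
  "inner M \<Longrightarrow> a \<in> M \<Longrightarrow> \<forall>i. e i \<in> M \<Longrightarrow> \<exists>z\<in>M. elts z = {x \<in> elts a. satM M p (e(0 := x))}"
  unfolding inner_def by (elim conjE) simp

lemma inner_replacement:
  "inner M \<Longrightarrow> a \<in> M \<Longrightarrow> \<forall>i. e i \<in> M \<Longrightarrow> \<forall>x\<in>elts a. \<exists>!y. y \<in> M \<and> satM M p (e(0 := x, 1 := y)) \<Longrightarrow>
    \<exists>z\<in>M. elts z = {y\<in>M. \<exists>x\<in>elts a. satM M p (e(0 := x, 1 := y))}"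
  unfolding inner_def by (elim conjE) simp

lemma innerD: "inner M \<Longrightarrow> y \<in> M \<Longrightarrow> x \<in> elts y \<Longrightarrow> x \<in> M"
  unfolding inner_def by (elim conjE) blast

lemma separation_inner:
  assumes "D C K (\<lambda>M e. Q M (etl e) (ehd e))" "valid C K M e" "a \<in> M"
  shows "\<exists>z\<in>M. elts z = {x\<in>elts a. Q M e x}"
proof -
  obtain p c where p: "\<forall>j. Suc (2 * j) \<in> vars p \<longrightarrow> c j \<in> K"
    "\<forall>M e. valid C K M e \<longrightarrow> (Q M (etl e) (ehd e) \<longleftrightarrow> satM M p (mrg c e))"
    using assms(1) unfolding D_def by metis
  have M: "inner M" "K \<subseteq> M" "\<forall>i. e i \<in> M" using assms(2) by (auto simp: valid_def)
  obtain d where d: "\<forall>i. mrg d (econs a e) i \<in> M" "\<And>e'. satM M p (mrg d e') = satM M p (mrg c e')"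
    by (rule mrg_const_in[of p c M a "econs a e"]) (use p M assms(3) in \<open>auto simp: econs_in\<close>)
  obtain z where z: "z \<in> M" "elts z = {x \<in> elts a. satM M p ((mrg d (econs a e))(0 := x))}"
    using inner_separation[OF M(1) assms(3) d(1)] by blast
  have "x \<in> M" if "x \<in> elts a" for x using that M(1) assms(3) innerD by blast
  then have "satM M p ((mrg d (econs a e))(0 := x)) \<longleftrightarrow> Q M e x" if "x \<in> elts a" for x
    using p(2)[rule_format, OF valid_econs[OF assms(2)], of x] d(2) that by (simp add: mrg_upd[of d x e a, symmetric])
  then show ?thesis using z by auto
qed

lemma replacement_inner:
  assumes "D C K (\<lambda>M e. R M (etl (etl e)) (etl e 0) (ehd e))" "valid C K M e" "a \<in> M"
    and ex1: "\<forall>x\<in>elts a. \<exists>!y. y \<in> M \<and> R M e x y"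
  shows "\<exists>z\<in>M. elts z = {y\<in>M. \<exists>x\<in>elts a. R M e x y}"
proof -
  obtain p c where p: "\<forall>j. Suc (2 * j) \<in> vars p \<longrightarrow> c j \<in> K"
    "\<forall>M e. valid C K M e \<longrightarrow> (R M (etl (etl e)) (etl e 0) (ehd e) \<longleftrightarrow> satM M p (mrg c e))"
    using assms(1) unfolding D_def by metis
  have M: "inner M" "K \<subseteq> M" "\<forall>i. e i \<in> M" using assms(2) by (auto simp: valid_def)
  let ?e = "econs a (econs a e)"
  have eM: "\<forall>i. ?e i \<in> M" using econs_in M assms(3) by metis
  obtain d where d: "\<forall>i. mrg d ?e i \<in> M" "\<And>e'. satM M p (mrg d e') = satM M p (mrg c e')"
    by (rule mrg_const_in[of p c M a ?e]) (use p M assms(3) eM in auto)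
  \<comment> \<open>The replacement scheme keeps the argument in variable 0 and the value in
    variable 1. The interleaved coding has the value in variable 0, a parameter in 1 and the
    argument in 2. The cycle \<open>r\<close> passes from the second layout to the first, and
    \<open>s\<close> is its inverse.\<close>
  define r where "r i = (if i = 0 then 1 else if i = 1 then 2 else if i = 2 then 0 else i)" for i :: nat
  define s where "s i = (if i = 1 then 0 else if i = 2 then 1 else if i = 0 then 2 else i)" for i :: nat
  have inj: "inj r" by (auto simp: inj_def r_def split: if_splits)
  have sr: "s (r i) = i" for i by (auto simp: s_def r_def)
  define E where "E i = mrg d ?e (s i)" for i
  have EM: "\<forall>i. E i \<in> M" using d E_def by auto
  have Er: "mrg d (econs y (econs x e)) i = (E(0 := x, 1 := y)) (r i)" for x y i
  proof -
    have *: "mrg d (econs y (econs x e)) j = mrg d ?e j" if "j \<noteq> 0" "j \<noteq> 2" for j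
    proof (cases "even j")
      case True
      then obtain k where "j = 2 * k" by (elim evenE)
      with that obtain m where "j = 2 * Suc (Suc m)" by (cases k; cases "k - 1") auto
      then show ?thesis by (simp only: mrg_simps econs_simps)
    qed (auto simp: mrg_def)
    have "mrg d (econs y (econs x e)) (2 * 1) = x" by (simp only: mrg_simps) simp
    then show ?thesis
      using *[of i] by (cases "i = 0"; cases "i = 1"; cases "i = 2") (auto simp: r_def E_def s_def)
  qed
  have sat: "satM M (rename r p) (E(0 := x, 1 := y)) \<longleftrightarrow> R M e x y" if "x \<in> M" "y \<in> M" for x y
  proof -
    have "satM M (rename r p) (E(0 := x, 1 := y)) = satM M p (mrg d (econs y (econs x e)))"
      by (rule satM_rename) (use inj Er in \<open>auto intro: inj_on_subset\<close>)
    moreover have "valid C K M (econs y (econs x e))" using valid_econs assms(2) that by metis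
    ultimately show ?thesis using p(2)[rule_format, of M "econs y (econs x e)"] d(2) by simp
  qed
  have xM: "x \<in> M" if "x \<in> elts a" for x using that M(1) assms(3) innerD by blast
  have "\<forall>x\<in>elts a. \<exists>!y. y \<in> M \<and> satM M (rename r p) (E(0 := x, 1 := y))"
  proof
    fix x assume x: "x \<in> elts a"
    have "(y \<in> M \<and> satM M (rename r p) (E(0 := x, 1 := y))) = (y \<in> M \<and> R M e x y)" for y
      using sat[OF xM[OF x]] by blast
    then show "\<exists>!y. y \<in> M \<and> satM M (rename r p) (E(0 := x, 1 := y))" using ex1 x by (simp only:)
  qed
  then have "\<exists>z\<in>M. elts z = {y\<in>M. \<exists>x\<in>elts a. satM M (rename r p) (E(0 := x, 1 := y))}"
    by (rule inner_replacement[OF M(1) assms(3) EM])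
  moreover have "{y\<in>M. \<exists>x\<in>elts a. satM M (rename r p) (E(0 := x, 1 := y))} = {y\<in>M. \<exists>x\<in>elts a. R M e x y}"
    by (intro Collect_cong conj_cong bex_cong refl) (rule sat, erule xM, assumption)
  ultimately show ?thesis by (simp only:)
qed

subsection \<open>Closure rules\<close>

lemma D_true: "P \<Longrightarrow> D C K (\<lambda>M e. P)"
proof -
  have "D C K (\<lambda>M e. e 0 = e 0)"
    unfolding D_def by (rule exI[of _ "Eq 0 0"]) simp
  then show "P \<Longrightarrow> D C K (\<lambda>M e. P)" by simp
qed

lemma D_disj: "D C K \<Phi> \<Longrightarrow> D C K \<Psi> \<Longrightarrow> D C K (\<lambda>M e. \<Phi> M e \<or> \<Psi> M e)"
  by (rule D_cong[of _ _ _ "\<lambda>M e. \<not> (\<not> \<Phi> M e \<and> \<not> \<Psi> M e)"], blast) (intro D_not D_conj)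

lemma D_imp: "D C K \<Phi> \<Longrightarrow> D C K \<Psi> \<Longrightarrow> D C K (\<lambda>M e. \<Phi> M e \<longrightarrow> \<Psi> M e)"
  by (rule D_cong[of _ _ _ "\<lambda>M e. \<not> (\<Phi> M e \<and> \<not> \<Psi> M e)"], blast) (intro D_not D_conj)

lemma D_iff: "D C K \<Phi> \<Longrightarrow> D C K \<Psi> \<Longrightarrow> D C K (\<lambda>M e. \<Phi> M e \<longleftrightarrow> \<Psi> M e)"
  by (rule D_cong[of _ _ _ "\<lambda>M e. (\<Phi> M e \<longrightarrow> \<Psi> M e) \<and> (\<Psi> M e \<longrightarrow> \<Phi> M e)"], blast) (intro D_imp D_conj)

lemma D_all:
  assumes "D C K (\<lambda>M e. Q M (etl e) (ehd e))"
  shows "D C K (\<lambda>M e. \<forall>x\<in>M. Q M e x)"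
  by (rule D_cong[of _ _ _ "\<lambda>M e. \<not> (\<exists>x\<in>M. \<not> Q M e x)"], blast) (intro D_not D_ex assms)

lemma D_eq_var: "D C K (\<lambda>M e. e i = e j)"
proof -
  have *: "Suc (2 * a) \<noteq> 2 * b" for a b :: nat by presburger
  show ?thesis
    unfolding D_def by (rule exI[of _ "Eq (2 * i) (2 * j)"], rule exI[of _ undefined]) (simp add: *)
qed

lemma D_mem_var: "D C K (\<lambda>M e. e i \<in> elts (e j))"
proof -
  have *: "Suc (2 * a) \<noteq> 2 * b" for a b :: nat by presburger
  show ?thesis
    unfolding D_def by (rule exI[of _ "Mem (2 * i) (2 * j)"], rule exI[of _ undefined]) (simp add: *)
qed

lemma D_tl: "D C K \<Phi> \<Longrightarrow> D C K (\<lambda>M e. \<Phi> M (etl e))"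
  using D_ren[of Suc] by (simp add: etl_def)

lemma DF_in: "DF C K t \<Longrightarrow> valid C K M e \<Longrightarrow> t M e \<in> M"
  unfolding DF_def by blast

lemma DF_var: "DF C K (\<lambda>M e. e i)"
  unfolding DF_def using D_eq_var[of C K 0 "Suc i"] by (auto simp: valid_def etl_def)

lemma DF_vars:
  "DF C K (\<lambda>M e. e 0)" "DF C K (\<lambda>M e. etl e 0)" "DF C K (\<lambda>M e. etl (etl e) 0)"
  "DF C K (\<lambda>M e. etl (etl (etl e)) 0)" "DF C K (\<lambda>M e. etl (etl (etl (etl e))) 0)"
  "DF C K (\<lambda>M e. etl (etl (etl (etl (etl e)))) 0)"
  "DF C K (\<lambda>M e. etl (etl (etl (etl (etl (etl e))))) 0)"
  "DF C K (\<lambda>M e. etl (etl (etl (etl (etl (etl (etl e)))))) 0)"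
  "DF C K (\<lambda>M e. etl (etl (etl (etl (etl (etl (etl (etl e))))))) 0)"
  "DF C K (\<lambda>M e. etl (etl (etl (etl (etl (etl (etl (etl (etl e)))))))) 0)"
  by (simp_all add: etl_def DF_var)

lemma DF_const: "c \<in> K \<Longrightarrow> DF C K (\<lambda>M e. c)"
  unfolding DF_def D_def
  by (rule conjI, force simp: valid_def, intro exI[of _ "Eq 0 (Suc 0)"] exI[of _ "\<lambda>_. c"]) auto

lemma D_subst:
  assumes "DF C K t" "D C K (\<lambda>M e. Q M (etl e) (ehd e))"
  shows "D C K (\<lambda>M e. Q M e (t M e))"
proof (rule D_cong)
  show "Q M e (t M e) \<longleftrightarrow> (\<exists>x\<in>M. x = t M e \<and> Q M e x)" if "valid C K M e" for M e
    using DF_in[OF assms(1) that] by auto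
  show "D C K (\<lambda>M e. \<exists>x\<in>M. x = t M e \<and> Q M e x)"
    by (rule D_ex, rule D_conj) (use assms DF_def in auto)
qed

lemma DF_tl:
  assumes "DF C K t"
  shows "DF C K (\<lambda>M e. t M (etl e))"
proof -
  let ?r = "\<lambda>n. case n of 0 \<Rightarrow> 0 | Suc m \<Rightarrow> Suc (Suc m)"
  have "inj ?r" by (auto simp: inj_def split: nat.splits)
  then have "D C K (\<lambda>M e. e (?r 0) = t M (etl (\<lambda>i. e (?r i))))"
    using D_ren[of ?r C K "\<lambda>M e. ehd e = t M (etl e)"] assms by (simp add: DF_def)
  moreover have "t M (etl e) \<in> M" if "valid C K M e" for M e
    using assms valid_etl[OF that] unfolding DF_def by blast
  ultimately show ?thesis unfolding DF_def by (simp add: etl_def)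
qed

lemma D_swap:
  assumes "D C K (\<lambda>M e. Q M (etl (etl e)) (e 0) (etl e 0))"
  shows "D C K (\<lambda>M e. Q M (etl (etl e)) (etl e 0) (e 0))"
proof -
  let ?r = "\<lambda>n::nat. if n = 0 then 1 else if n = 1 then 0 else n"
  have "inj ?r" by (auto simp: inj_def split: if_splits)
  from D_ren[OF this assms] show ?thesis by (simp add: etl_def)
qed

lemma D_mem:
  assumes "DF C K t" "DF C K s"
  shows "D C K (\<lambda>M e. t M e \<in> elts (s M e))"
proof (rule D_subst[OF assms(1)])
  show "D C K (\<lambda>M e. ehd e \<in> elts (s M (etl e)))"
    by (rule D_subst[OF DF_tl[OF assms(2)]]) (use D_mem_var[of C K "Suc 0" 0] in \<open>simp add: etl_def\<close>)
qed

lemma D_eq: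
  assumes "DF C K t" "DF C K s"
  shows "D C K (\<lambda>M e. t M e = s M e)"
proof (rule D_subst[OF assms(1)])
  show "D C K (\<lambda>M e. ehd e = s M (etl e))"
    by (rule D_subst[OF DF_tl[OF assms(2)]]) (use D_eq_var[of C K "Suc 0" 0] in \<open>simp add: etl_def\<close>)
qed

lemma DF_subst:
  assumes "DF C K t" "DF C K (\<lambda>M e. q M (etl e) (ehd e))"
  shows "DF C K (\<lambda>M e. q M e (t M e))"
proof -
  have "D C K (\<lambda>M e. e 0 = q M (etl (etl e)) (etl e 0))" using assms(2) unfolding DF_def by auto
  then have "D C K (\<lambda>M e. etl e 0 = q M (etl (etl e)) (ehd e))" by (rule D_swap)
  then have "D C K (\<lambda>M e. ehd e = q M (etl e) (t M (etl e)))"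
    by (rule D_subst[OF DF_tl[OF assms(1)]])
  moreover have "q M e (t M e) \<in> M" if "valid C K M e" for M e
    using DF_in[OF assms(2) valid_econs[OF that DF_in[OF assms(1) that]]] by simp
  ultimately show ?thesis unfolding DF_def by auto
qed

lemma valid_inner: "valid C K M e \<Longrightarrow> inner M"
  unfolding valid_def by blast

lemma D_ball:
  assumes "DF C K t" "D C K (\<lambda>M e. Q M (etl e) (ehd e))"
  shows "D C K (\<lambda>M e. \<forall>x\<in>elts (t M e). Q M e x)"
proof (rule D_cong)
  show "(\<forall>x\<in>elts (t M e). Q M e x) \<longleftrightarrow> (\<forall>x\<in>M. x \<in> elts (t M e) \<longrightarrow> Q M e x)" if "valid C K M e" for M e
    using DF_in[OF assms(1) that] valid_inner[OF that] innerD by blast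
qed (intro D_all D_imp D_mem assms DF_tl DF_vars)

lemma D_bex:
  assumes "DF C K t" "D C K (\<lambda>M e. Q M (etl e) (ehd e))"
  shows "D C K (\<lambda>M e. \<exists>x\<in>elts (t M e). Q M e x)"
proof (rule D_cong)
  show "(\<exists>x\<in>elts (t M e). Q M e x) \<longleftrightarrow> (\<exists>x\<in>M. x \<in> elts (t M e) \<and> Q M e x)" if "valid C K M e" for M e
    using DF_in[OF assms(1) that] valid_inner[OF that] innerD by blast
qed (intro D_ex D_conj D_mem assms DF_tl DF_vars)

lemma D_subset:
  assumes "DF C K t" "DF C K s"
  shows "D C K (\<lambda>M e. elts (t M e) \<subseteq> elts (s M e))"
  unfolding subset_iff Ball_def[symmetric] by (intro D_ball D_mem DF_tl assms DF_vars)

text \<open>By extensionality, being equal to the set is a statement about membership in it. A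
  definable membership condition together with existence in \<open>M\<close> therefore yields a
  definable term.\<close>

lemma DF_set:
  assumes ex: "\<And>M e. valid C K M e \<Longrightarrow> \<exists>z\<in>M. elts z = A M e"
    and D: "D C K (\<lambda>M e. ehd e \<in> A M (etl e))"
  shows "DF C K (\<lambda>M e. vset (A M e))"
proof -
  have in_M: "vset (A M e) \<in> M \<and> elts (vset (A M e)) = A M e" if v: "valid C K M e" for M e
  proof -
    obtain z where "z \<in> M" "elts z = A M e" using ex[OF v] by (elim bexE)
    then show ?thesis using vset_eqI[of z "A M e"] by simp
  qed
  have "D C K (\<lambda>M e. ehd e = vset (A M (etl e)))"
  proof (rule D_cong)
    fix M e assume v: "valid C K M e"
    then have "e 0 \<in> M" "inner M" by (auto simp: valid_def)
    then show "(ehd e = vset (A M (etl e))) = (\<forall>x\<in>M. x \<in> elts (ehd e) \<longleftrightarrow> x \<in> A M (etl e))"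
      using in_M[OF valid_etl[OF v]] innerD[of M] by (auto simp: elts_eq_iff[symmetric])
  next
    let ?r = "\<lambda>n. case n of 0 \<Rightarrow> 0 | Suc m \<Rightarrow> Suc (Suc m)"
    have "inj ?r" by (auto simp: inj_def split: nat.splits)
    from D_ren[OF this D] have "D C K (\<lambda>M e. e 0 \<in> A M (etl (etl e)))" by (simp add: etl_def)
    then show "D C K (\<lambda>M e. \<forall>x\<in>M. x \<in> elts (ehd e) \<longleftrightarrow> x \<in> A M (etl e))"
      by (intro D_all D_iff D_mem DF_vars)
  qed
  then show ?thesis unfolding DF_def using in_M by auto
qed


lemma vset_inI: "z \<in> M \<Longrightarrow> elts z = A \<Longrightarrow> vset A \<in> M"
  by (drule vset_eqI) simp

lemma smallI: "elts z = A \<Longrightarrow> small A"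
  unfolding small_def by (rule exI)

lemma bex_small: "\<exists>z\<in>M. elts z = A \<Longrightarrow> small A"
  by (elim bexE) (rule smallI)

lemma bex_vset: "\<exists>z\<in>M. elts z = A \<Longrightarrow> vset A \<in> M"
  by (elim bexE) (rule vset_inI)

lemma inner_pair: "inner M \<Longrightarrow> x \<in> M \<Longrightarrow> y \<in> M \<Longrightarrow> \<exists>z\<in>M. elts z = {x, y}"
  unfolding inner_def by (elim conjE) simp

lemma inner_Union: "inner M \<Longrightarrow> x \<in> M \<Longrightarrow> \<exists>z\<in>M. elts z = (\<Union>y\<in>elts x. elts y)"
  unfolding inner_def by (elim conjE) simp

lemma inner_Pow: "inner M \<Longrightarrow> x \<in> M \<Longrightarrow> \<exists>z\<in>M. elts z = {y\<in>M. elts y \<subseteq> elts x}"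
  unfolding inner_def by (elim conjE) simp

lemma inner_infinity: "inner M \<Longrightarrow> \<exists>z\<in>M. (\<exists>x\<in>elts z. elts x = {}) \<and>
    (\<forall>x\<in>elts z. \<exists>y\<in>elts z. elts y = insert x (elts x))"
  unfolding inner_def by (elim conjE) assumption

lemma inner_choice: "inner M \<Longrightarrow> a \<in> M \<Longrightarrow> \<forall>x\<in>elts a. elts x \<noteq> {} \<Longrightarrow>
    \<forall>x\<in>elts a. \<forall>y\<in>elts a. x \<noteq> y \<longrightarrow> elts x \<inter> elts y = {} \<Longrightarrow>
    \<exists>c\<in>M. \<forall>x\<in>elts a. \<exists>!y. y \<in> elts c \<inter> elts x"
  unfolding inner_def by (elim conjE) (drule bspec[where A = M and x = a], assumption, simp)+

definition Uni :: "'v::zfc \<Rightarrow> 'v" where "Uni x = vset (\<Union>y\<in>elts x. elts y)"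

lemma small_pair[simp]: "small {x, y}"
  using inner_pair[OF inner_UNIV] by (rule bex_small) auto

lemma small_single[simp]: "small {x}"
  using small_pair[of x x] by simp

lemma small_Union[simp]: "small (\<Union>y\<in>elts x. elts y)"
  using inner_Union[OF inner_UNIV] by (rule bex_small) auto

lemma elts_Uni[simp]: "elts (Uni x) = (\<Union>y\<in>elts x. elts y)"
  by (simp add: Uni_def)

lemma small_Un[simp]: "small (elts x \<union> elts y)"
  using small_Union[of "vset {x, y}"] by simp

lemma small_insert[simp]: "small (insert x (elts y))"
  using small_Un[of "vset {x}" y] by simp

lemma inner_nonempty: "inner M \<Longrightarrow> M \<noteq> {}"
  using inner_infinity by blast

lemma inner_in:
  assumes "inner M" "DF {M} M (\<lambda>M e. t)"
  shows "t \<in> M"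
proof -
  obtain c where "c \<in> M" using inner_nonempty[OF assms(1)] by blast
  then have "valid {M} M M (\<lambda>_. c)" using assms(1) by (auto simp: valid_def)
  then show ?thesis using DF_in[OF assms(2)] by blast
qed

lemma DF_Union: "DF C K t \<Longrightarrow> DF C K (\<lambda>M e. vset (\<Union>y\<in>elts (t M e). elts y))"
  by (rule DF_set) (blast intro: inner_Union valid_inner DF_in, unfold UN_iff, intro D_bex D_mem DF_tl DF_vars)

lemma DF_Uni: "DF C K t \<Longrightarrow> DF C K (\<lambda>M e. Uni (t M e))"
  unfolding Uni_def by (rule DF_Union)

lemma DF_pair: "DF C K t \<Longrightarrow> DF C K s \<Longrightarrow> DF C K (\<lambda>M e. vset {t M e, s M e})"
  by (rule DF_set) (blast intro: inner_pair valid_inner DF_in, unfold insert_iff empty_iff simp_thms, 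
     intro D_disj D_eq DF_tl DF_vars)

lemma DF_single: "DF C K t \<Longrightarrow> DF C K (\<lambda>M e. vset {t M e})"
  using DF_pair[of C K t t] by simp

lemma DF_Collect:
  assumes "DF C K t" "D C K (\<lambda>M e. Q M (etl e) (ehd e))"
  shows "DF C K (\<lambda>M e. vset {x \<in> elts (t M e). Q M e x})"
proof (rule DF_set)
  show "\<exists>z\<in>M. elts z = {x \<in> elts (t M e). Q M e x}" if "valid C K M e" for M e
    using separation_inner[OF assms(2) that DF_in[OF assms(1) that]] .
  show "D C K (\<lambda>M e. e 0 \<in> {x \<in> elts (t M (etl e)). Q M (etl e) x})"
    unfolding mem_Collect_eq by (intro D_conj D_mem assms DF_tl DF_vars)
qed

lemma DF_empty: "DF C K (\<lambda>M e. vset {})"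
  using DF_Collect[OF DF_vars(1), of C K "\<lambda>M e x. \<not> True"] D_not[OF D_true[OF TrueI], of C K] by simp

lemma DF_image:
  assumes "DF C K t" "DF C K (\<lambda>M e. s M (etl e) (ehd e))"
  shows "DF C K (\<lambda>M e. vset ((\<lambda>x. s M e x) ` elts (t M e)))"
proof (rule DF_set)
  fix M e assume v: "valid C K M e"
  have sM: "s M e x \<in> M" if "x \<in> elts (t M e)" for x
    using DF_in[OF assms(2) valid_econs[OF v]] innerD[OF valid_inner[OF v] DF_in[OF assms(1) v] that] by simp
  have "D C K (\<lambda>M e. e 0 = s M (etl (etl e)) (etl e 0))" using assms(2) by (simp add: DF_def)
  then have "\<exists>z\<in>M. elts z = {y\<in>M. \<exists>x\<in>elts (t M e). y = s M e x}"
    by (rule replacement_inner[OF _ v DF_in[OF assms(1) v]]) (use sM in auto)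
  moreover have "{y\<in>M. \<exists>x\<in>elts (t M e). y = s M e x} = s M e ` elts (t M e)" using sM by auto
  ultimately show "\<exists>z\<in>M. elts z = s M e ` elts (t M e)" by simp
next
  have "DF C K (\<lambda>M e. s M (etl (etl e)) (ehd e))"
  proof -
    have "D C K (\<lambda>M e. e 0 = s M (etl (etl e)) (etl e 0))" using assms(2) by (simp add: DF_def)
    let ?r = "\<lambda>n::nat. if n < 2 then n else Suc n"
    have "inj ?r" by (auto simp: inj_def split: if_splits)
    from D_ren[OF this \<open>D C K (\<lambda>M e. e 0 = s M (etl (etl e)) (etl e 0))\<close>]
    have "D C K (\<lambda>M e. e 0 = s M (etl (etl (etl e))) (etl e 0))" by (simp add: etl_def)
    moreover have "s M (etl (etl e)) (e 0) \<in> M" if v: "valid C K M e" for M e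
      using DF_in[OF assms(2) valid_econs[OF valid_etl[OF valid_etl[OF v]]], of "e 0"] v by (simp add: valid_def)
    ultimately show ?thesis unfolding DF_def by simp
  qed
  then show "D C K (\<lambda>M e. e 0 \<in> s M (etl e) ` elts (t M (etl e)))"
    unfolding image_iff
    by (intro D_bex D_eq DF_tl DF_vars assms) 
qed

lemma DF_Un: "DF C K t \<Longrightarrow> DF C K s \<Longrightarrow> DF C K (\<lambda>M e. vset (elts (t M e) \<union> elts (s M e)))"
  using DF_Union[OF DF_pair] by simp

lemma DF_insert: "DF C K t \<Longrightarrow> DF C K s \<Longrightarrow> DF C K (\<lambda>M e. vset (insert (t M e) (elts (s M e))))"
  using DF_Un[OF DF_single] by simp

lemma DF_Int: "DF C K t \<Longrightarrow> DF C K s \<Longrightarrow> DF C K (\<lambda>M e. vset (elts (t M e) \<inter> elts (s M e)))"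
  unfolding Int_def Collect_mem_eq mem_Collect_eq by (intro DF_Collect D_mem DF_tl DF_vars)

lemma DF_Diff: "DF C K t \<Longrightarrow> DF C K s \<Longrightarrow> DF C K (\<lambda>M e. vset (elts (t M e) - elts (s M e)))"
  unfolding set_diff_eq by (intro DF_Collect D_not D_mem DF_tl DF_vars)

lemma DF_opair: "DF C K t \<Longrightarrow> DF C K s \<Longrightarrow> DF C K (\<lambda>M e. opair (t M e) (s M e))"
  unfolding opair_def by (intro DF_pair DF_single)

lemma DF_Pow:
  assumes "DF C K t"
  shows "DF C K (\<lambda>M e. vset {y \<in> M. elts y \<subseteq> elts (t M e)})"
proof (rule DF_set)
  show "\<exists>z\<in>M. elts z = {y \<in> M. elts y \<subseteq> elts (t M e)}" if "valid C K M e" for M e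
    using inner_Pow[OF valid_inner[OF that] DF_in[OF assms that]] .
  show "D C K (\<lambda>M e. e 0 \<in> {y \<in> M. elts y \<subseteq> elts (t M (etl e))})"
    by (rule D_cong[of _ _ _ "\<lambda>M e. elts (e 0) \<subseteq> elts (t M (etl e))"])
       (auto simp: valid_def, intro D_subset assms DF_tl DF_vars)
qed

lemma DF_lam:
  assumes "DF C K t" "DF C K (\<lambda>M e. s M (etl e) (ehd e))"
  shows "DF C K (\<lambda>M e. lam (t M e) (\<lambda>x. s M e x))"
  unfolding lam_def Setcompr_eq_image
  by (intro DF_image DF_opair assms DF_vars)

lemma DF_if:
  assumes "D C K P" "DF C K t" "DF C K s"
  shows "DF C K (\<lambda>M e. if P M e then t M e else s M e)"
  unfolding DF_def
proof (intro conjI allI impI)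
  have "D C K (\<lambda>M e. (P M (etl e) \<longrightarrow> e 0 = t M (etl e)) \<and> (\<not> P M (etl e) \<longrightarrow> e 0 = s M (etl e)))"
    by (intro D_conj D_imp D_not D_tl[OF assms(1)] D_eq DF_tl assms DF_vars)
  then show "D C K (\<lambda>M e. e 0 = (if P M (etl e) then t M (etl e) else s M (etl e)))"
    by (rule D_cong[rotated]) simp
qed (use DF_in assms in auto)

lemmas D_base = D_not D_conj D_disj D_imp D_iff D_all D_ex D_ball D_bex D_mem D_eq D_subset
lemmas DF_base = DF_vars DF_Uni DF_pair DF_single DF_empty DF_Un DF_insert DF_Int DF_Diff DF_opair DF_Pow DF_lam DF_if
  DF_Union DF_Collect DF_image

section \<open>Set theory in an inner model\<close>

lemma elts_opair: "elts (opair x y) = {vset {x}, vset {x, y}}"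
  by (simp add: opair_def)

lemma opair_inj[simp]: "opair x y = opair x' y' \<longleftrightarrow> x = x' \<and> y = y'"
proof
  assume "opair x y = opair x' y'"
  then have "elts ` elts (opair x y) = elts ` elts (opair x' y')" by simp
  then have "{{x}, {x, y}} = {{x'}, {x', y'}}" by (simp add: elts_opair)
  then show "x = x' \<and> y = y'" by (auto simp: doubleton_eq_iff)
qed simp

lemma inner_opair:
  assumes "inner M"
  shows "opair x y \<in> M \<longleftrightarrow> x \<in> M \<and> y \<in> M"
proof
  assume "opair x y \<in> M"
  then have "vset {x, y} \<in> M" using innerD[OF assms] by (auto simp: elts_opair)
  then show "x \<in> M \<and> y \<in> M" using innerD[OF assms] by auto
next
  assume "x \<in> M \<and> y \<in> M"
  moreover have "vset {a, b} \<in> M" if "a \<in> M" "b \<in> M" for a b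
    using inner_pair[OF assms that] by (rule bex_vset)
  ultimately show "opair x y \<in> M" unfolding opair_def by (metis insert_absorb2)
qed

text \<open>A substitute for \<open>app\<close> inside the calculus: the definite description is
  replaced by the union of the set of values, which is the value itself when there is exactly
  one.\<close>

definition ap :: "'v::zfc \<Rightarrow> 'v \<Rightarrow> 'v" where
  "ap f x = Uni (vset {y \<in> elts (Uni (Uni f)). opair x y \<in> elts f})"

lemma DF_ap: "DF C K t \<Longrightarrow> DF C K s \<Longrightarrow> DF C K (\<lambda>M e. ap (t M e) (s M e))"
  unfolding ap_def by (intro DF_Uni DF_Collect D_mem DF_opair DF_tl DF_vars)

lemma opair_UniUni: "opair x y \<in> elts f \<Longrightarrow> y \<in> elts (Uni (Uni f))"
proof -
  assume "opair x y \<in> elts f"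
  moreover have "vset {x, y} \<in> elts (opair x y)" by (simp add: elts_opair)
  ultimately have "vset {x, y} \<in> elts (Uni f)" unfolding elts_Uni by blast
  moreover have "y \<in> elts (vset {x, y})" by simp
  ultimately show ?thesis unfolding elts_Uni[of "Uni f"] by blast
qed

lemma ap_eqI:
  assumes "\<exists>!y. opair x y \<in> elts f" "opair x y \<in> elts f"
  shows "ap f x = y"
proof -
  have "{y \<in> elts (Uni (Uni f)). opair x y \<in> elts f} = {y}" using assms opair_UniUni by blast
  then have "ap f x = Uni (vset {y})" unfolding ap_def by (simp only:)
  then show ?thesis by (simp add: Uni_def)
qed

lemma function_onD: "function_on X f \<Longrightarrow> x \<in> elts X \<Longrightarrow> \<exists>!y. opair x y \<in> elts f"
  unfolding function_on_def by blast

lemma app_eqI: "function_on X f \<Longrightarrow> x \<in> elts X \<Longrightarrow> opair x y \<in> elts f \<Longrightarrow> app f x = y"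
  unfolding app_def by (drule (1) function_onD) (rule the1_equality)

lemma app_mem: "function_on X f \<Longrightarrow> x \<in> elts X \<Longrightarrow> opair x (app f x) \<in> elts f"
  unfolding app_def by (drule (1) function_onD) (rule theI')

lemma ap_app: "function_on X f \<Longrightarrow> x \<in> elts X \<Longrightarrow> ap f x = app f x"
  by (rule ap_eqI[OF function_onD app_mem])

lemma function_on_mem: "function_on X f \<Longrightarrow> p \<in> elts f \<longleftrightarrow> (\<exists>x\<in>elts X. p = opair x (app f x))"
proof
  assume f: "function_on X f" and p: "p \<in> elts f"
  then obtain x y where "x \<in> elts X" "p = opair x y" unfolding function_on_def by blast
  then show "\<exists>x\<in>elts X. p = opair x (app f x)" using app_eqI[OF f, of x y] p by auto
qed (auto intro: app_mem)

lemma function_ext: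
  assumes "function_on X f" "function_on X g" "\<And>x. x \<in> elts X \<Longrightarrow> app f x = app g x"
  shows "f = g"
proof -
  have "elts f = elts g" using assms function_on_mem[OF assms(1)] function_on_mem[OF assms(2)] by auto
  then show ?thesis by (simp add: elts_eq_iff)
qed

lemma app_in: "inner M \<Longrightarrow> f \<in> M \<Longrightarrow> function_on X f \<Longrightarrow> x \<in> elts X \<Longrightarrow> app f x \<in> M"
  using app_mem innerD inner_opair by metis

lemma function_on_lam:
  assumes "small ((\<lambda>x. opair x (F x)) ` elts X)"
  shows "function_on X (lam X F)" "x \<in> elts X \<Longrightarrow> app (lam X F) x = F x"
proof -
  have e: "elts (lam X F) = (\<lambda>x. opair x (F x)) ` elts X"
    using assms unfolding lam_def Setcompr_eq_image by simp
  show 1: "function_on X (lam X F)" unfolding function_on_def e by auto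
  show "x \<in> elts X \<Longrightarrow> app (lam X F) x = F x"
    by (rule app_eqI[OF 1]) (auto simp: e)
qed

lemma lam_cong: "(\<And>x. x \<in> elts X \<Longrightarrow> F x = G x) \<Longrightarrow> lam X F = lam X G"
  unfolding lam_def by (rule arg_cong[where f = vset]) auto

section \<open>Definability of the basic notions\<close>

lemma D1: "D C K (\<lambda>M e. P (e 0)) \<Longrightarrow> DF C K t \<Longrightarrow> D C K (\<lambda>M e. P (t M e))"
  by (rule D_subst)

lemma D2:
  assumes "D C K (\<lambda>M e. R (etl e 0) (e 0))" "DF C K t" "DF C K s"
  shows "D C K (\<lambda>M e. R (t M e) (s M e))"
proof (rule D_subst[OF assms(3)], rule D_subst[OF DF_tl[OF assms(2)]])
  show "D C K (\<lambda>M e. R (e 0) (etl e 0))"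
    using D_swap[where Q = "\<lambda>M e x y. R y x"] assms(1) by simp
qed

lemma DF1: "DF C K (\<lambda>M e. G (e 0)) \<Longrightarrow> DF C K t \<Longrightarrow> DF C K (\<lambda>M e. G (t M e))"
  by (rule DF_subst)

lemma DF2:
  assumes "DF C K (\<lambda>M e. G (etl e 0) (e 0))" "DF C K t" "DF C K s"
  shows "DF C K (\<lambda>M e. G (t M e) (s M e))"
proof (rule DF_subst[OF assms(3)], rule DF_subst[OF DF_tl[OF assms(2)]])
  let ?r = "\<lambda>n::nat. if n = 1 then 2 else if n = 2 then 1 else n"
  have "inj ?r" by (auto simp: inj_def split: if_splits)
  moreover have D: "D C K (\<lambda>M e. e 0 = G (etl (etl e) 0) (etl e 0))" using assms(1) by (simp add: DF_def)
  ultimately have "D C K (\<lambda>M e. e 0 = G (etl e 0) (etl (etl e) 0))"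
    using D_ren[of ?r C K "\<lambda>M e. e 0 = G (etl (etl e) 0) (etl e 0)"] by (simp add: etl_def eval_nat_numeral)
  moreover have "G (e 0) (etl e 0) \<in> M" if v: "valid C K M e" for M e
    using DF_in[OF assms(1) valid_econs[OF valid_econs[OF v, of "e 0"], of "etl e 0"]] v
    by (simp add: valid_def etl_def)
  ultimately show "DF C K (\<lambda>M e. G (e 0) (etl e 0))" unfolding DF_def by simp
qed

lemma valid_single: "valid {M} K N e \<Longrightarrow> N = M"
  by (simp add: valid_def)

text \<open>In the one-element family \<open>{M}\<close> a quantifier over the literal class
  \<open>M\<close> is a quantifier over the ambient class, so predicates that mention
  \<open>M\<close> by name stay within the calculus.\<close>

lemma D_allM: "D {M} K (\<lambda>N e. Q (etl e) (e 0)) \<Longrightarrow> D {M} K (\<lambda>N e. \<forall>x\<in>M. Q e x)"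
  by (rule D_cong[where \<Psi> = "\<lambda>N e. \<forall>x\<in>N. Q e x"]) (simp add: valid_def, rule D_all)

lemma D_exM: "D {M} K (\<lambda>N e. Q (etl e) (e 0)) \<Longrightarrow> D {M} K (\<lambda>N e. \<exists>x\<in>M. Q e x)"
  by (rule D_cong[where \<Psi> = "\<lambda>N e. \<exists>x\<in>N. Q e x"]) (simp add: valid_def, rule D_ex)

lemma D_exU: "D {UNIV} K (\<lambda>N e. Q (etl e) (e 0)) \<Longrightarrow> D {UNIV} K (\<lambda>N e. \<exists>x. Q e x)"
  using D_exM[where M = UNIV] by simp

lemma D_allU: "D {UNIV} K (\<lambda>N e. Q (etl e) (e 0)) \<Longrightarrow> D {UNIV} K (\<lambda>N e. \<forall>x. Q e x)"
  using D_allM[where M = UNIV] by simp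

lemma DF_cong:
  assumes "\<And>M e. valid C K M e \<Longrightarrow> t M e = s M e" "DF C K s"
  shows "DF C K t"
  unfolding DF_def
proof (intro conjI allI impI)
  show "D C K (\<lambda>M e. e 0 = t M (etl e))"
  proof (rule D_cong)
    show "(e 0 = t M (etl e)) = (e 0 = s M (etl e))" if "valid C K M e" for M e
      using assms(1)[OF valid_etl[OF that]] by simp
  qed (use assms(2) DF_def in blast)
qed (use assms DF_in in auto)

lemma DF_PowM: "DF {M} K t \<Longrightarrow> DF {M} K (\<lambda>N e. vset {y \<in> M. elts y \<subseteq> elts (t N e)})"
  by (rule DF_cong[OF _ DF_Pow[of "{M}" K t]]) (auto dest: valid_single)

lemma D_function_on:
  assumes "DF C K t" "DF C K s"
  shows "D C K (\<lambda>M e. function_on (t M e) (s M e))"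
proof (rule D_cong)
  fix M e assume v: "valid C K M e"
  note i = valid_inner[OF v] and tM = DF_in[OF assms(1) v] and sM = DF_in[OF assms(2) v]
  have "(\<exists>x\<in>elts X. \<exists>y. p = opair x y) \<longleftrightarrow> (\<exists>x\<in>elts X. \<exists>y\<in>M. p = opair x y)" if "p \<in> M" for X p
    using inner_opair[OF i] that by auto
  moreover have "(\<exists>!y. opair x y \<in> elts (s M e)) \<longleftrightarrow> (\<exists>y\<in>M. opair x y \<in> elts (s M e) \<and> (\<forall>z\<in>M. opair x z \<in> elts (s M e) \<longrightarrow> z = y))" for x
    using inner_opair[OF i] innerD[OF i sM] by blast
  ultimately show "function_on (t M e) (s M e) \<longleftrightarrow> 
    (\<forall>p\<in>elts (s M e). \<exists>x\<in>elts (t M e). \<exists>y\<in>M. p = opair x y) \<and>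
    (\<forall>x\<in>elts (t M e). \<exists>y\<in>M. opair x y \<in> elts (s M e) \<and> (\<forall>z\<in>M. opair x z \<in> elts (s M e) \<longrightarrow> z = y))"
    unfolding function_on_def using innerD[OF i sM] by simp
qed (intro D_base DF_opair DF_tl DF_vars assms)

lemma D_transitive: "DF C K t \<Longrightarrow> D C K (\<lambda>M e. transitive (t M e))"
  unfolding transitive_def by (intro D_base DF_tl DF_vars)

lemma D_Ord: "DF C K t \<Longrightarrow> D C K (\<lambda>M e. Ord (t M e))"
  unfolding Ord_def by (intro D_base D_transitive DF_tl DF_vars)

lemma D_inductive: "DF C K t \<Longrightarrow> D C K (\<lambda>M e. is_inductive (t M e))"
  unfolding is_inductive_def by (intro D_base DF_empty DF_insert DF_tl DF_vars)

lemmas D_rules = D_base D_function_on D_transitive D_Ord D_inductive D_allM D_exM D_allU D_exU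
  DF_base DF_ap DF_PowM

section \<open>Separation, functions and recursion inside an inner model\<close>

lemma sep:
  assumes "inner M" "a \<in> M" "D {M} M (\<lambda>N e. P (e 0))"
  shows "\<exists>z\<in>M. elts z = {x\<in>elts a. P x}"
  using separation_inner[of "{M}" M "\<lambda>N e x. P x" M "\<lambda>_. a" a] assms by (simp add: valid_def)

lemma fun_of_rel:
  assumes i: "inner M" and a: "a \<in> M" and R: "D {M} M (\<lambda>N e. R (etl e 0) (e 0))"
    and ex: "\<And>x. x \<in> elts a \<Longrightarrow> \<exists>!y. y \<in> M \<and> R x y"
  shows "\<exists>f\<in>M. function_on a f \<and> (\<forall>x\<in>elts a. R x (app f x))"
proof -
  have "D {M} M (\<lambda>N e. \<exists>y\<in>M. R (etl e 0) y \<and> e 0 = opair (etl e 0) y)"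
    by (intro D_exM D_conj D_eq DF_opair DF_vars D2[OF R])
  moreover have "valid {M} M M (\<lambda>_. a)" using i a by (simp add: valid_def)
  moreover have "\<forall>x\<in>elts a. \<exists>!p. p \<in> M \<and> (\<exists>y\<in>M. R x y \<and> p = opair x y)"
  proof
    fix x assume x: "x \<in> elts a"
    then obtain y where y: "y \<in> M" "R x y" and u: "\<And>z. z \<in> M \<Longrightarrow> R x z \<Longrightarrow> z = y"
      using ex[OF x] by blast
    show "\<exists>!p. p \<in> M \<and> (\<exists>y\<in>M. R x y \<and> p = opair x y)"
    proof (rule ex1I[of _ "opair x y"])
      show "opair x y \<in> M \<and> (\<exists>z\<in>M. R x z \<and> opair x y = opair x z)"
        using y inner_opair[OF i] innerD[OF i a x] by auto
      show "p = opair x y" if "p \<in> M \<and> (\<exists>z\<in>M. R x z \<and> p = opair x z)" for p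
        using that by (elim conjE bexE) (drule (1) u, simp)
    qed
  qed
  ultimately have "\<exists>z\<in>M. elts z = {p\<in>M. \<exists>x\<in>elts a. \<exists>y\<in>M. R x y \<and> p = opair x y}"
    using replacement_inner[of "{M}" M "\<lambda>N e x p. \<exists>y\<in>M. R x y \<and> p = opair x y" M "\<lambda>_. a" a] a by simp
  then obtain f where f: "f \<in> M" "elts f = {p\<in>M. \<exists>x\<in>elts a. \<exists>y\<in>M. R x y \<and> p = opair x y}" by (elim bexE)
  have m: "opair x y \<in> elts f \<longleftrightarrow> y \<in> M \<and> R x y" if "x \<in> elts a" for x y
    using that innerD[OF i a] inner_opair[OF i] by (auto simp: f)
  have fo: "function_on a f"
    unfolding function_on_def using m ex by (auto simp: f)
  then have "\<forall>x\<in>elts a. R x (app f x)" using app_mem m by blast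
  then show ?thesis using f(1) fo by blast
qed

lemma lam_inner:
  assumes i: "inner M" and X: "X \<in> M" and F: "DF {M} M (\<lambda>N e. F (e 0))"
  shows "lam X F \<in> M" "function_on X (lam X F)" "x \<in> elts X \<Longrightarrow> app (lam X F) x = F x"
proof -
  have "DF {M} M (\<lambda>N e. lam X F)" by (intro DF_lam DF_const X DF1[OF F] DF_vars)
  then show "lam X F \<in> M" by (rule inner_in[OF i])
  have "D {M} M (\<lambda>N e. e 0 = F (etl e 0))" using F by (simp add: DF_def)
  have FM: "F x \<in> M" if "x \<in> elts X" for x
    using DF_in[OF F, of M "\<lambda>_. x"] innerD[OF i X that] i by (simp add: valid_def)
  have "\<exists>f\<in>M. function_on X f \<and> (\<forall>x\<in>elts X. app f x = F x)"
    by (rule fun_of_rel[OF i X]) (use \<open>D {M} M (\<lambda>N e. e 0 = F (etl e 0))\<close> FM in auto)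
  then obtain f where f: "function_on X f" "\<forall>x\<in>elts X. app f x = F x" by blast
  have "elts f = (\<lambda>x. opair x (F x)) ` elts X" using function_on_mem[OF f(1)] f(2) by auto
  then have "small ((\<lambda>x. opair x (F x)) ` elts X)" by (rule smallI)
  from function_on_lam[OF this] 
  show "function_on X (lam X F)" "x \<in> elts X \<Longrightarrow> app (lam X F) x = F x" by auto
qed

lemma foundation_min: "elts S \<noteq> {} \<Longrightarrow> \<exists>g\<in>elts S. \<forall>h\<in>elts S. h \<notin> elts g"
  using foundation[of S] by blast

lemma elts_irrefl: "x \<notin> elts x"
  using foundation[of "vset {x}"] by auto

text \<open>The solution is the union of all attempts \<open>att d t\<close>, i.e. of the solutions \<open>t\<close> of the recursion on
  downward closed subsets \<open>d\<close> of \<open>F\<close>.\<close>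

lemma wf_recursion:
  assumes i: "inner M" and F: "F \<in> M" and R: "D {M} M (\<lambda>N e. R (etl e 0) (e 0))"
    and G: "DF {M} M (\<lambda>N e. G (etl e 0) (e 0))"
    and wf: "\<And>S. S \<in> M \<Longrightarrow> elts S \<subseteq> elts F \<Longrightarrow> elts S \<noteq> {} \<Longrightarrow> \<exists>g\<in>elts S. \<forall>h\<in>elts S. \<not> R h g"
  shows "\<exists>t\<in>M. function_on F t \<and> (\<forall>g\<in>elts F. \<exists>r\<in>M. function_on (vset {h\<in>elts F. R h g}) r \<and>
    (\<forall>h\<in>elts F. R h g \<longrightarrow> app r h = app t h) \<and> app t g = G g r)"
proof -
  define pr where "pr g = vset {h\<in>elts F. R h g}" for g
  have DFpr: "DF {M} M (\<lambda>N e. pr (t N e))" if "DF {M} M t" for t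
    unfolding pr_def by (intro DF_Collect DF_const F D2[OF R] DF_vars DF_tl that)
  have FM: "x \<in> M" if "x \<in> elts F" for x using innerD[OF i F that] .
  have prM: "pr g \<in> M" "elts (pr g) = {h\<in>elts F. R h g}" if "g \<in> M" for g
  proof -
    have *: "\<exists>z\<in>M. elts z = {h\<in>elts F. R h g}"
      by (rule sep[OF i F]) (intro D2[OF R] DF_vars DF_const that)
    show "pr g \<in> M" "elts (pr g) = {h\<in>elts F. R h g}" unfolding pr_def
      using bex_vset[OF *] elts_vset[OF bex_small[OF *]] by auto
  qed
  define rs where "rs t g = lam (pr g) (ap t)" for t g
  have DFrs: "DF {M} M (\<lambda>N e. rs (t N e) (s N e))" if "DF {M} M t" "DF {M} M s" for t s
    unfolding rs_def by (intro DF_lam DFpr DF_ap that DF_tl DF_vars)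
  have rsM: "rs t g \<in> M" "function_on (pr g) (rs t g)" "h \<in> elts (pr g) \<Longrightarrow> app (rs t g) h = ap t h"
    if "g \<in> M" "t \<in> M" for g t h
  proof -
    have "DF {M} M (\<lambda>N e. ap t (e 0))" by (intro DF_ap DF_const that DF_vars)
    note * = lam_inner[OF i prM(1)[OF that(1)] this]
    show "rs t g \<in> M" "function_on (pr g) (rs t g)" "h \<in> elts (pr g) \<Longrightarrow> app (rs t g) h = ap t h"
      unfolding rs_def by (rule *, rule *, erule *)
  qed
  define att where "att d t \<longleftrightarrow> elts d \<subseteq> elts F \<and> (\<forall>g\<in>elts d. elts (pr g) \<subseteq> elts d) \<and> function_on d t \<and>
      (\<forall>g\<in>elts d. ap t g = G g (rs t g))" for d t
  have "D {M} M (\<lambda>N e. att (etl e 0) (e 0))"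
    unfolding att_def by ((rule D_base D_function_on DFpr DF_ap DFrs DF2[OF G] DF_vars DF_const F)+)
  note Datt = D2[OF this]
  have uniq: "ap t g = ap t' g" 
    if "d \<in> M" "t \<in> M" "att d t" "d' \<in> M" "t' \<in> M" "att d' t'" "g \<in> elts d" "g \<in> elts d'" for d t d' t' g
  proof (rule ccontr)
    assume ne: "ap t g \<noteq> ap t' g"
    have "\<exists>z\<in>M. elts z = {g\<in>elts d. g \<in> elts d' \<and> ap t g \<noteq> ap t' g}"
      by (rule sep[OF i that(1)]) ((rule D_base DF_ap DF_vars DF_const that)+)
    then obtain S where S: "S \<in> M" "elts S = {g\<in>elts d. g \<in> elts d' \<and> ap t g \<noteq> ap t' g}" by (elim bexE)
    then have "elts S \<subseteq> elts F" "elts S \<noteq> {}" using that ne unfolding att_def by auto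
    then obtain m where m: "m \<in> elts S" "\<forall>h\<in>elts S. \<not> R h m" using wf[OF S(1)] by blast
    then have md: "m \<in> elts d" "m \<in> elts d'" and mF: "m \<in> elts F" using S that(3) att_def by auto
    have "ap t h = ap t' h" if h: "h \<in> elts (pr m)" for h
    proof -
      have "R h m" using h prM(2)[OF FM[OF mF]] by auto
      then have "h \<notin> elts S" using m by blast
      then show ?thesis using S(2) h \<open>att d t\<close> \<open>att d' t'\<close> md unfolding att_def by blast
    qed
    then have "rs t m = rs t' m" unfolding rs_def by (rule lam_cong)
    then have "ap t m = ap t' m" using \<open>att d t\<close> \<open>att d' t'\<close> md unfolding att_def by simp
    then show False using m(1) S(2) by blast
  qed
  define val where "val g y \<longleftrightarrow> (\<exists>d\<in>M. \<exists>t\<in>M. att d t \<and> g \<in> elts d \<and> y = ap t g)" for g y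
  have Dval: "D {M} M (\<lambda>N e. val (etl e 0) (e 0))"
    unfolding val_def by (intro D_exM D_conj Datt D_mem D_eq DF_ap DF_vars)
  have "\<exists>z\<in>M. elts z = {g\<in>elts F. \<exists>y\<in>M. val g y}"
    by (rule sep[OF i F]) (intro D_exM D2[OF Dval] DF_vars)
  then obtain d0 where d0: "d0 \<in> M" "elts d0 = {g\<in>elts F. \<exists>y\<in>M. val g y}" by (elim bexE)
  have ex1: "\<exists>!y. y \<in> M \<and> val g y" if g: "g \<in> elts d0" for g
  proof -
    obtain y where y: "y \<in> M" "val g y" using g unfolding d0(2) by blast
    show ?thesis
    proof (rule ex1I[of _ y])
      fix z assume "z \<in> M \<and> val g z"
      then obtain d t where 1: "d \<in> M" "t \<in> M" "att d t" "g \<in> elts d" "z = ap t g" unfolding val_def by blast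
      obtain d' t' where 2: "d' \<in> M" "t' \<in> M" "att d' t'" "g \<in> elts d'" "y = ap t' g" using y unfolding val_def by blast
      show "z = y" using uniq[OF 1(1-3) 2(1-3) 1(4) 2(4)] 1(5) 2(5) by simp
    qed (use y in blast)
  qed
  obtain T where T: "T \<in> M" "function_on d0 T" "\<forall>g\<in>elts d0. val g (app T g)"
    using fun_of_rel[OF i d0(1) Dval ex1] by blast
  have apM: "ap t g \<in> M" if "t \<in> M" "g \<in> M" for t g
    by (rule inner_in[OF i]) (intro DF_ap DF_const that)
  have sub: "elts d \<subseteq> elts d0" and Teq: "\<And>g. g \<in> elts d \<Longrightarrow> ap T g = ap t g"
    if "d \<in> M" "t \<in> M" "att d t" for d t
  proof -
    have v: "val g (ap t g) \<and> ap t g \<in> M" if g: "g \<in> elts d" for g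
      unfolding val_def using g \<open>d \<in> M\<close> \<open>t \<in> M\<close> \<open>att d t\<close> apM[OF \<open>t \<in> M\<close> innerD[OF i \<open>d \<in> M\<close> g]] by blast
    then show sub: "elts d \<subseteq> elts d0" using \<open>att d t\<close> unfolding d0(2) att_def by blast
    show "ap T g = ap t g" if g: "g \<in> elts d" for g
    proof -
      have "g \<in> elts d0" using sub g by blast
      then have "val g (app T g)" "app T g \<in> M" "app T g = ap T g" using T app_in[OF i T(1,2)] ap_app[OF T(2)] by auto
      then show ?thesis using ex1[OF \<open>g \<in> elts d0\<close>] v[OF g] by metis
    qed
  qed
  have attT: "att d0 T" unfolding att_def
  proof (intro conjI ballI T(2))
    show "elts d0 \<subseteq> elts F" using d0 by auto
    fix g assume g: "g \<in> elts d0"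
    then obtain d t where dt: "d \<in> M" "t \<in> M" "att d t" "g \<in> elts d" unfolding d0(2) val_def by blast
    then show *: "elts (pr g) \<subseteq> elts d0" using sub[OF dt(1-3)] unfolding att_def by blast
    have "rs T g = rs t g" unfolding rs_def
    proof (rule lam_cong)
      fix x assume "x \<in> elts (pr g)"
      then have "x \<in> elts d" using dt(3,4) unfolding att_def by blast
      then show "ap T x = ap t x" by (rule Teq[OF dt(1-3)])
    qed
    then show "ap T g = G g (rs T g)" using Teq[OF dt(1-4)] dt(3,4) unfolding att_def by simp
  qed
  have "elts F \<subseteq> elts d0"
  proof (rule ccontr)
    assume "\<not> elts F \<subseteq> elts d0"
    have "\<exists>z\<in>M. elts z = {g\<in>elts F. g \<notin> elts d0}"
      by (rule sep[OF i F]) ((rule D_base DF_vars DF_const d0)+)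
    then obtain S where S: "S \<in> M" "elts S = {g\<in>elts F. g \<notin> elts d0}" by (elim bexE)
    then obtain m where m: "m \<in> elts S" "\<forall>h\<in>elts S. \<not> R h m" using wf[OF S(1)] \<open>\<not> elts F \<subseteq> elts d0\<close> by blast
    then have mF: "m \<in> elts F" "m \<notin> elts d0" using S by auto
    have prm: "elts (pr m) \<subseteq> elts d0" using m S(2) prM(2)[OF FM[OF mF(1)]] by auto
    \<comment> \<open>The point \<open>m\<close>, minimal outside \<open>d0\<close>, can be added to
      the union of all attempts. The result is again an attempt, although \<open>d0\<close> already
      contains the domain of every attempt.\<close>
    define y where "y = G m (rs T m)"
    define T' where "T' = vset (insert (opair m y) (elts T))"
    define d' where "d' = vset (insert m (elts d0))"
    have yM: "y \<in> M" unfolding y_def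
      by (rule inner_in[OF i]) (intro DF2[OF G] DFrs DF_const T FM mF)
    have d'M: "d' \<in> M" unfolding d'_def 
      by (rule inner_in[OF i]) (intro DF_insert DF_const d0 FM mF)
    have T'M: "T' \<in> M" unfolding T'_def
      by (rule inner_in[OF i]) (intro DF_insert DF_opair DF_const T FM mF yM)
    have ed: "elts d' = insert m (elts d0)" and eT: "elts T' = insert (opair m y) (elts T)"
      by (simp_all add: d'_def T'_def)
    have Tdom: "x \<in> elts d0" if "opair x z \<in> elts T" for x z
      using function_on_mem[OF T(2)] that by auto
    have fT': "function_on d' T'"
      unfolding function_on_def ed eT using function_on_mem[OF T(2)] Tdom function_onD[OF T(2)] mF(2) by auto
    have a1: "ap T' m = y" using ap_app[OF fT'] app_eqI[OF fT', of m y] by (simp add: ed eT)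
    have a2: "ap T' g = ap T g" if "g \<in> elts d0" for g
      using ap_app[OF fT'] app_eqI[OF fT', of g "app T g"] app_mem[OF T(2) that] ap_app[OF T(2)] that by (simp add: ed eT)
    have "att d' T'" unfolding att_def
    proof (intro conjI ballI fT')
      show "elts d' \<subseteq> elts F" using mF d0 by (auto simp: ed)
      fix g assume g: "g \<in> elts d'"
      then show 1: "elts (pr g) \<subseteq> elts d'" using prm attT unfolding ed att_def by blast
      have "elts (pr g) \<subseteq> elts d0" using g prm attT unfolding ed att_def by blast
      then have "rs T' g = rs T g" unfolding rs_def by (intro lam_cong a2) blast
      then show "ap T' g = G g (rs T' g)" using g a1 a2 attT unfolding ed att_def y_def by auto
    qed
    then have "elts d' \<subseteq> elts d0" using sub[OF d'M T'M] by blast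
    then show False using mF by (simp add: ed)
  qed
  then have d0F: "d0 = F" using d0 elts_eq_iff[of d0 F] by auto
  show ?thesis
  proof (rule bexI[OF _ T(1)], intro conjI ballI)
    show "function_on F T" using T d0F by simp
    fix g assume g: "g \<in> elts F"
    then have gM: "g \<in> M" by (rule FM)
    show "\<exists>r\<in>M. function_on (vset {h\<in>elts F. R h g}) r \<and>
      (\<forall>h\<in>elts F. R h g \<longrightarrow> app r h = app T h) \<and> app T g = G g r"
    proof (intro bexI[of _ "rs T g"] conjI ballI impI)
      show "function_on (vset {h\<in>elts F. R h g}) (rs T g)" using rsM(2)[OF gM T(1)] by (simp add: pr_def)
      show "rs T g \<in> M" using rsM(1)[OF gM T(1)] .
      show "app T g = G g (rs T g)" using attT ap_app[OF T(2)] g unfolding att_def d0F by auto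
      fix h assume h: "h \<in> elts F" "R h g"
      then have "h \<in> elts (pr g)" using prM(2)[OF gM] by auto
      then show "app (rs T g) h = app T h" using rsM(3)[OF gM T(1)] ap_app[OF T(2)] h d0F by auto
    qed
  qed
qed


lemma image_inner:
  assumes i: "inner M" and a: "a \<in> M" and F: "DF {M} M (\<lambda>N e. F (e 0))"
  shows "\<exists>z\<in>M. elts z = F ` elts a"
proof -
  have "small (F ` elts a)"
  proof -
    have "elts (lam a F) = (\<lambda>x. opair x (F x)) ` elts a"
      using function_on_mem[OF lam_inner(2)[OF i a F]] lam_inner(3)[OF i a F] by auto
    then have "F ` elts a = {y\<in>elts (Uni (Uni (lam a F))). \<exists>x. opair x y \<in> elts (lam a F)}"
    proof (intro equalityI subsetI)
      fix y assume "y \<in> F ` elts a"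
      then obtain x where "opair x y \<in> elts (lam a F)" using \<open>elts (lam a F) = _\<close> by blast
      then show "y \<in> {y\<in>elts (Uni (Uni (lam a F))). \<exists>x. opair x y \<in> elts (lam a F)}"
        using opair_UniUni by blast
    qed (use \<open>elts (lam a F) = _\<close> in auto)
    moreover have "\<exists>z\<in>UNIV. elts z = {y\<in>elts (Uni (Uni (lam a F))). \<exists>x. opair x y \<in> elts (lam a F)}"
      by (rule sep[OF inner_UNIV UNIV_I]) (rule D_rules DF_const UNIV_I)+
    ultimately show ?thesis using bex_small by metis
  qed
  moreover have "vset (F ` elts a) \<in> M"
    by (rule inner_in[OF i]) (rule DF_image DF1[OF F] DF_vars DF_const a)+
  ultimately show ?thesis by (intro bexI[of _ "vset (F ` elts a)"]) auto
qed

section \<open>The natural numbers\<close>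

lemma elts_empty[simp]: "elts (vset {}) = {}"
proof -
  obtain z x :: 'a where "elts x = {}" using infinity by blast
  then show ?thesis using elts_vset[OF smallI] by blast
qed

lemma elts_empty_iff: "elts x = {} \<longleftrightarrow> x = vset {}"
  by (metis elts_empty elts_eq_iff)

lemma inductive_ex:
  assumes "inner M"
  shows "\<exists>z\<in>M. is_inductive z"
proof -
  obtain z where z: "z \<in> M" "\<exists>x\<in>elts z. elts x = {}" "\<forall>x\<in>elts z. \<exists>y\<in>elts z. elts y = insert x (elts x)"
    using inner_infinity[OF assms] by blast
  have "is_inductive z" unfolding is_inductive_def
  proof (intro conjI ballI)
    show "vset {} \<in> elts z" using z(2) elts_empty_iff by metis
    show "vset (insert x (elts x)) \<in> elts z" if "x \<in> elts z" for x
      using z(3) that vset_eqI by metis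
  qed
  then show ?thesis using z by blast
qed

lemma elts_omega: "elts omega = {n. \<forall>z. is_inductive z \<longrightarrow> n \<in> elts z}"
proof -
  obtain z :: 'a where z: "is_inductive z" using inductive_ex[OF inner_UNIV] by blast
  have "\<exists>w\<in>UNIV. elts w = {n\<in>elts z. \<forall>z. is_inductive z \<longrightarrow> n \<in> elts z}"
    by (rule sep[OF inner_UNIV UNIV_I]) (rule D_rules DF_const UNIV_I)+
  then have "small {n\<in>elts z. \<forall>z. is_inductive z \<longrightarrow> n \<in> elts z}" by (rule bex_small)
  moreover have "{n\<in>elts z. \<forall>z. is_inductive z \<longrightarrow> n \<in> elts z} = {n. \<forall>z. is_inductive z \<longrightarrow> n \<in> elts z}"
    using z by blast
  ultimately show ?thesis unfolding omega_def by simp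
qed

lemma inductive_omega: "is_inductive omega"
  unfolding is_inductive_def elts_omega by (simp add: is_inductive_def)

lemma omega_0: "vset {} \<in> elts omega" and omega_Suc: "n \<in> elts omega \<Longrightarrow> vset (insert n (elts n)) \<in> elts omega"
  using inductive_omega unfolding is_inductive_def by auto

lemma omega_least: "is_inductive z \<Longrightarrow> elts omega \<subseteq> elts z"
  unfolding elts_omega by blast

lemma omega_induct:
  assumes s: "small {n\<in>elts omega. P n}" and "P (vset {})"
    and "\<And>n. n \<in> elts omega \<Longrightarrow> P n \<Longrightarrow> P (vset (insert n (elts n)))" and n: "n \<in> elts omega"
  shows "P n"
proof -
  have "is_inductive (vset {n\<in>elts omega. P n})"
    unfolding is_inductive_def using s assms omega_0 omega_Suc by auto
  from omega_least[OF this] show ?thesis using s n by auto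
qed

text \<open>\<open>M\<close> may have fewer inductive sets than the universe, so its own least one
  could be too large. An \<in>-minimal element of it outside \<open>omega\<close> would have to be a
  successor, for otherwise it could be removed; its predecessor lies in \<open>omega\<close> by
  minimality, and hence so does the element itself.\<close>

lemma omega_in:
  assumes i: "inner M"
  shows "omega \<in> M"
proof -
  obtain z0 where z0: "z0 \<in> M" "is_inductive z0" using inductive_ex[OF i] by blast
  have "\<exists>w\<in>M. elts w = {n\<in>elts z0. \<forall>z\<in>M. is_inductive z \<longrightarrow> n \<in> elts z}"
    by (rule sep[OF i z0(1)]) (rule D_rules DF_const)+
  then obtain w where w: "w \<in> M" "elts w = {n\<in>elts z0. \<forall>z\<in>M. is_inductive z \<longrightarrow> n \<in> elts z}" by (elim bexE)
  have indw: "is_inductive w" using z0(2) unfolding is_inductive_def w(2) by blast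
  have "elts w \<subseteq> elts omega"
  proof (rule ccontr)
    assume c: "\<not> elts w \<subseteq> elts omega"
    have "\<exists>S\<in>UNIV. elts S = {n\<in>elts w. n \<notin> elts omega}"
      by (rule sep[OF inner_UNIV UNIV_I]) (rule D_rules DF_const UNIV_I)+
    then obtain S where S: "elts S = {n\<in>elts w. n \<notin> elts omega}" by blast
    then have "elts S \<noteq> {}" using c by blast
    then obtain n where n: "n \<in> elts S" "\<forall>m\<in>elts S. m \<notin> elts n" using foundation_min by blast
    have "\<exists>w'\<in>M. elts w' = {m\<in>elts w. m \<noteq> n}"
      by (rule sep[OF i w(1)]) (rule D_rules DF_const innerD[OF i w(1)] | use n S in simp)+
    then obtain w' where w': "w' \<in> M" "elts w' = {m\<in>elts w. m \<noteq> n}" by (elim bexE)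
    have "n \<notin> elts w'" "n \<in> elts w" using w' n S by auto
    then have "\<not> is_inductive w'" using w'(1) w(2) by blast
    moreover have "vset {} \<in> elts w'" using indw omega_0 n S unfolding w'(2) is_inductive_def by auto
    ultimately obtain m where m: "m \<in> elts w" "n = vset (insert m (elts m))"
      using indw unfolding is_inductive_def w'(2) by auto
    then have "m \<in> elts n" by simp
    then have "m \<in> elts omega" using n m S by blast
    then show False using omega_Suc m n S by auto
  qed
  then have "omega = w" using omega_least[OF indw] elts_eq_iff by blast
  then show ?thesis using w by simp
qed

lemma DF_omega: "DF C K (\<lambda>M e. omega)"
  unfolding DF_def
proof (intro conjI allI impI)
  show "omega \<in> M" if "valid C K M e" for M e using omega_in[OF valid_inner[OF that]] .
  show "D C K (\<lambda>M e. e 0 = omega)"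
  proof (rule D_cong)
    fix M e assume "valid C K M e"
    then have "e 0 \<in> M" "omega \<in> M" using omega_in valid_inner by (auto simp: valid_def)
    then show "e 0 = omega \<longleftrightarrow> is_inductive (e 0) \<and> (\<forall>z\<in>M. is_inductive z \<longrightarrow> elts (e 0) \<subseteq> elts z)"
      using inductive_omega omega_least elts_eq_iff by (metis subset_antisym)
  qed (rule D_rules)+
qed

lemmas D_intros = UNIV_I D_rules DF_omega DF_const

lemma omega_transitive: "n \<in> elts omega \<Longrightarrow> elts n \<subseteq> elts omega"
proof (rule omega_induct[where P = "\<lambda>n. elts n \<subseteq> elts omega"])
  have "\<exists>z\<in>UNIV. elts z = {n\<in>elts omega. elts n \<subseteq> elts omega}"
    by (rule sep[OF inner_UNIV UNIV_I]) (rule D_intros)+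
  then show "small {n\<in>elts omega. elts n \<subseteq> elts omega}" by (rule bex_small)
qed auto

section \<open>Transitive supersets, induction, rank and choice\<close>

lemma transitive_superset:
  assumes i: "inner M" and x: "x \<in> M"
  shows "\<exists>T\<in>M. transitive T \<and> x \<in> elts T"
proof -
  \<comment> \<open>Course-of-values form: stage \<open>n\<close> collects \<open>x\<close> and the
    members of members of all earlier stages, so zero and successors need no separate
    clauses.\<close>
  define G where "G n r = vset (elts (vset {x}) \<union> elts (Uni (Uni (vset (ap r ` elts n)))))" for n r
  have "\<exists>t\<in>M. function_on omega t \<and> (\<forall>g\<in>elts omega. \<exists>r\<in>M. function_on (vset {h\<in>elts omega. h \<in> elts g}) r \<and>
    (\<forall>h\<in>elts omega. h \<in> elts g \<longrightarrow> app r h = app t h) \<and> app t g = G g r)"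
    apply (rule wf_recursion[OF i omega_in[OF i]])
      apply (rule D_rules)+
    unfolding G_def
     apply (rule x D_intros)+
    using foundation_min by blast
  then obtain t where t: "t \<in> M" "function_on omega t" "\<forall>g\<in>elts omega. \<exists>r\<in>M. function_on (vset {h\<in>elts omega. h \<in> elts g}) r \<and>
    (\<forall>h\<in>elts omega. h \<in> elts g \<longrightarrow> app r h = app t h) \<and> app t g = G g r" by blast
  have tn: "elts (app t n) = insert x (\<Union>m\<in>elts n. \<Union>z\<in>elts (app t m). elts z)" if n: "n \<in> elts omega" for n
  proof -
    obtain r where r: "r \<in> M" "function_on (vset {h\<in>elts omega. h \<in> elts n}) r"
      "\<forall>h\<in>elts omega. h \<in> elts n \<longrightarrow> app r h = app t h" "app t n = G n r" using t(3) n by blast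
    have *: "{h\<in>elts omega. h \<in> elts n} = elts n" using omega_transitive[OF n] by blast
    have fr: "function_on n r" using r(2) unfolding * by simp
    have nM: "n \<in> M" using innerD[OF i omega_in[OF i] n] .
    have "\<exists>z\<in>M. elts z = ap r ` elts n"
      by (rule image_inner[OF i nM]) (rule r D_intros)+
    then have *: "elts (vset (ap r ` elts n)) = ap r ` elts n" using bex_small elts_vset by metis
    have "ap r m = app t m" if "m \<in> elts n" for m
      using ap_app[OF fr that] r(3) omega_transitive[OF n] that by auto
    moreover have "elts (G n r) = {x} \<union> (\<Union>z\<in>(\<Union>y\<in>ap r ` elts n. elts y). elts z)"
    proof -
      have "elts (G n r) = elts (vset {x}) \<union> elts (Uni (Uni (vset (ap r ` elts n))))"
        unfolding G_def by (rule elts_vset[OF small_Un])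
      then show ?thesis by (simp only: elts_vset[OF small_single] elts_Uni *)
    qed
    ultimately show ?thesis unfolding r(4) by auto
  qed
  have *: "\<exists>z\<in>M. elts z = ap t ` elts omega"
    by (rule image_inner[OF i omega_in[OF i]]) (rule t D_intros)+
  define T where "T = Uni (vset (ap t ` elts omega))"
  have TM: "T \<in> M" unfolding T_def
    by (rule inner_in[OF i]) (rule bex_vset[OF *] D_intros)+
  have eT: "elts T = (\<Union>n\<in>elts omega. elts (app t n))"
    unfolding T_def elts_Uni elts_vset[OF bex_small[OF *]] using ap_app[OF t(2)] by auto
  have "transitive T" unfolding transitive_def
  proof (intro ballI subsetI)
    fix y z assume "y \<in> elts T" "z \<in> elts y"
    then obtain n where n: "n \<in> elts omega" "y \<in> elts (app t n)" unfolding eT by blast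
    have "z \<in> elts (app t (vset (insert n (elts n))))"
      unfolding tn[OF omega_Suc[OF n(1)]] using n \<open>z \<in> elts y\<close> by auto
    then show "z \<in> elts T" unfolding eT using omega_Suc[OF n(1)] by blast
  qed
  moreover have "x \<in> elts T" unfolding eT using tn[OF omega_0] omega_0 by blast
  ultimately show ?thesis using TM by blast
qed

text \<open>Foundation concerns sets of the model only, which is why the predicate has to be
  definable. A transitive set around \<open>x\<close> turns the class of counterexamples into a set
  that has an \<in>-minimal element.\<close>

lemma inner_induct:
  assumes i: "inner M" and P: "D {M} M (\<lambda>N e. P (e 0))"
    and step: "\<And>x. x \<in> M \<Longrightarrow> (\<And>y. y \<in> elts x \<Longrightarrow> P y) \<Longrightarrow> P x" and x: "x \<in> M"
  shows "P x"
proof (rule ccontr)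
  assume nP: "\<not> P x"
  obtain T where T: "T \<in> M" "transitive T" "x \<in> elts T" using transitive_superset[OF i x] by blast
  have "\<exists>S\<in>M. elts S = {y\<in>elts T. \<not> P y}"
    by (rule sep[OF i T(1)]) (rule D_not P)+
  then obtain S where S: "S \<in> M" "elts S = {y\<in>elts T. \<not> P y}" by (elim bexE)
  then have "elts S \<noteq> {}" using T nP by blast
  then obtain m where m: "m \<in> elts S" "\<forall>h\<in>elts S. h \<notin> elts m" using foundation_min by blast
  then have mT: "m \<in> elts T" "\<not> P m" using S by auto
  have "P y" if "y \<in> elts m" for y using m that S(2) T(2) mT unfolding transitive_def by blast
  then show False using step[OF innerD[OF i T(1) mT(1)]] mT by blast
qed

text \<open>\<open>H x\<close> is the level of the cumulative hierarchy of \<open>M\<close> indexed by the rank of \<open>x\<close>.\<close>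

lemma rank_hierarchy:
  assumes i: "inner M"
  shows "\<exists>H. DF {M} M (\<lambda>N e. H (e 0)) \<and> 
    (\<forall>x\<in>M. elts (H x) = {z\<in>M. \<exists>y\<in>elts x. elts z \<subseteq> elts (H y)})"
proof -
  define G where "G g r = Uni (vset ((\<lambda>h. vset {y \<in> M. elts y \<subseteq> elts (ap r h)}) ` elts g))" for g r
  have DG: "DF {M} M (\<lambda>N e. G (etl e 0) (e 0))"
    unfolding G_def by (rule D_intros)+
  define att where "att T t \<longleftrightarrow> transitive T \<and> function_on T t \<and> (\<forall>g\<in>elts T. ap t g = G g t)" for T t
  have Datt: "D {M} M (\<lambda>N e. att (etl e 0) (e 0))"
    unfolding att_def by (rule DF2[OF DG] D_intros)+
  define val where "val x y \<longleftrightarrow> (\<exists>T\<in>M. \<exists>t\<in>M. att T t \<and> x \<in> elts T \<and> y = ap t x)" for x y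
  have Dval: "D {M} M (\<lambda>N e. val (etl e 0) (e 0))"
    unfolding val_def by (rule D2[OF Datt] D_intros)+
  have apM: "ap t g \<in> M" if "t \<in> M" "g \<in> M" for t g
    by (rule inner_in[OF i]) (rule that D_intros)+
  have ex: "\<exists>y\<in>M. val x y" if x: "x \<in> M" for x
  proof -
    obtain T where T: "T \<in> M" "transitive T" "x \<in> elts T" using transitive_superset[OF i x] by blast
    have "\<exists>t\<in>M. function_on T t \<and> (\<forall>g\<in>elts T. \<exists>r\<in>M. function_on (vset {h\<in>elts T. h \<in> elts g}) r \<and>
      (\<forall>h\<in>elts T. h \<in> elts g \<longrightarrow> app r h = app t h) \<and> app t g = G g r)"
      apply (rule wf_recursion[OF i T(1) _ DG])
       apply (rule D_rules)+
      using foundation_min by blast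
    then obtain t where t: "t \<in> M" "function_on T t" "\<forall>g\<in>elts T. \<exists>r\<in>M. function_on (vset {h\<in>elts T. h \<in> elts g}) r \<and>
      (\<forall>h\<in>elts T. h \<in> elts g \<longrightarrow> app r h = app t h) \<and> app t g = G g r" by blast
    have "ap t g = G g t" if g: "g \<in> elts T" for g
    proof -
      obtain r where r: "function_on (vset {h\<in>elts T. h \<in> elts g}) r"
        "\<forall>h\<in>elts T. h \<in> elts g \<longrightarrow> app r h = app t h" "app t g = G g r" using t(3) g by blast
      have gT: "elts g \<subseteq> elts T" using T(2) g unfolding transitive_def by blast
      then have *: "{h\<in>elts T. h \<in> elts g} = elts g" by blast
      have fr: "function_on g r" using r(1) unfolding * by simp
      have "ap r h = ap t h" if "h \<in> elts g" for h
        using ap_app[OF fr that] ap_app[OF t(2)] r(2) gT that by auto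
      then have "G g r = G g t" unfolding G_def by (simp cong: image_cong)
      then show ?thesis using r(3) ap_app[OF t(2) g] by simp
    qed
    then have "att T t" using T t unfolding att_def by blast
    then show ?thesis unfolding val_def using T t apM[OF t(1) x] by blast
  qed
  have uniq: "ap t x = ap t' x" if "att T t" "att T' t'" "x \<in> elts T" "x \<in> elts T'"
     for T t T' t' x
  proof (rule ccontr)
    assume ne: "ap t x \<noteq> ap t' x"
    have "\<exists>z\<in>UNIV. elts z = {g\<in>elts T. g \<in> elts T' \<and> ap t g \<noteq> ap t' g}"
      by (rule sep[OF inner_UNIV UNIV_I]) (rule D_intros)+
    then obtain S where S: "elts S = {g\<in>elts T. g \<in> elts T' \<and> ap t g \<noteq> ap t' g}" by blast
    then have "elts S \<noteq> {}" using that ne by blast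
    then obtain m where m: "m \<in> elts S" "\<forall>h\<in>elts S. h \<notin> elts m" using foundation_min by blast
    then have mT: "m \<in> elts T" "m \<in> elts T'" using S by auto
    have "ap t h = ap t' h" if "h \<in> elts m" for h
      using m(2) that mT \<open>att T t\<close> \<open>att T' t'\<close> unfolding S att_def transitive_def by blast
    then have "G m t = G m t'" unfolding G_def by (simp cong: image_cong)
    then show False using m(1) mT \<open>att T t\<close> \<open>att T' t'\<close> unfolding S att_def by simp
  qed
  have uval: "y = y'" if "val x y" "val x y'" for x y y'
    using that uniq unfolding val_def by metis
  define H where "H x = (THE y. val x y)" for x
  have H: "val x y \<longleftrightarrow> y = H x" "H x \<in> M" if x: "x \<in> M" for x y
  proof -
    obtain z where z: "z \<in> M" "val x z" using ex[OF x] by blast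
    then have "H x = z" unfolding H_def using uval by blast
    then show "val x y \<longleftrightarrow> y = H x" "H x \<in> M" using z uval by auto
  qed
  have "DF {M} M (\<lambda>N e. H (e 0))" unfolding DF_def
  proof (intro conjI allI impI)
    show "H (e 0) \<in> N" if "valid {M} M N e" for N e using that H by (auto simp: valid_def)
    show "D {M} M (\<lambda>N e. e 0 = H (etl e 0))"
      by (rule D_cong[OF _ Dval]) (auto simp: valid_def etl_def H)
  qed
  moreover have "elts (H x) = {z\<in>M. \<exists>y\<in>elts x. elts z \<subseteq> elts (H y)}" if x: "x \<in> M" for x
  proof -
    have "val x (H x)" using H[OF x] by blast
    then obtain T t where Tt: "T \<in> M" "t \<in> M" "att T t" "x \<in> elts T" "H x = ap t x" unfolding val_def by blast
    have Hy: "ap t y = H y" if "y \<in> elts x" for y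
    proof -
      have "y \<in> elts T" using Tt that unfolding att_def transitive_def by blast
      then have "val y (ap t y)" using Tt unfolding val_def by blast
      then show ?thesis using H innerD[OF i x that] by blast
    qed
    have pw: "\<exists>z\<in>M. elts z = {y \<in> M. elts y \<subseteq> elts (ap t h)}" if "h \<in> elts x" for h
      using inner_Pow[OF i apM[OF Tt(2) innerD[OF i x that]]] .
    have *: "\<exists>z\<in>M. elts z = (\<lambda>h. vset {y \<in> M. elts y \<subseteq> elts (ap t h)}) ` elts x"
      by (rule image_inner[OF i x]) (rule Tt D_intros)+
    have "H x = G x t" using Tt unfolding att_def by simp
    then have "elts (H x) = (\<Union>y\<in>(\<lambda>h. vset {y \<in> M. elts y \<subseteq> elts (ap t h)}) ` elts x. elts y)"
      by (simp only: G_def elts_Uni elts_vset[OF bex_small[OF *]])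
    moreover have "elts (vset {y \<in> M. elts y \<subseteq> elts (ap t h)}) = {y \<in> M. elts y \<subseteq> elts (ap t h)}" if "h \<in> elts x" for h
      using elts_vset[OF bex_small[OF pw[OF that]]] .
    ultimately have "elts (H x) = (\<Union>h\<in>elts x. {y \<in> M. elts y \<subseteq> elts (ap t h)})" by simp
    then show ?thesis using Hy by auto
  qed
  ultimately show ?thesis by blast
qed

lemma collection:
  assumes i: "inner M" and a: "a \<in> M" and R: "D {M} M (\<lambda>N e. R (etl e 0) (e 0))"
    and ex: "\<And>x. x \<in> elts a \<Longrightarrow> \<exists>y\<in>M. R x y"
  shows "\<exists>B\<in>M. \<forall>x\<in>elts a. \<exists>y\<in>elts B. R x y"
proof -
  obtain H where DH: "DF {M} M (\<lambda>N e. H (e 0))"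
    and H: "\<And>x. x \<in> M \<Longrightarrow> elts (H x) = {z\<in>M. \<exists>y\<in>elts x. elts z \<subseteq> elts (H y)}"
    using rank_hierarchy[OF i] by blast
  have HM: "H x \<in> M" if "x \<in> M" for x
    by (rule inner_in[OF i]) (rule DF1[OF DH] DF_const that)+
  have sub: "elts x \<subseteq> elts (H x)" if "x \<in> M" for x
    apply (rule inner_induct[OF i, of "\<lambda>x. elts x \<subseteq> elts (H x)", OF _ _ that])
     apply (rule DF1[OF DH] D_intros)+
    using H innerD[OF i] by blast
  have H1: "elts (H y) \<subseteq> elts (H x)" if "\<And>w. w \<in> elts y \<Longrightarrow> {z\<in>M. elts z \<subseteq> elts (H w)} \<subseteq> elts (H x)" "y \<in> M" for x y
    unfolding H[OF that(2)] using that(1) by blast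
  \<comment> \<open>One induction suffices for the comparability of levels: the hypothesis at the
    elements of \<open>x\<close> first gives the mirrored dichotomy \<open>1\<close>, from which the
    stated one follows for every \<open>y\<close>.\<close>
  have C: "\<forall>y\<in>M. elts (H y) \<subseteq> elts (H x) \<or> {z\<in>M. elts z \<subseteq> elts (H x)} \<subseteq> elts (H y)" (is "?C x") if x: "x \<in> M" for x
  proof (rule inner_induct[OF i, of ?C, OF _ _ x])
    have "D {M} M (\<lambda>N e. \<forall>y\<in>M. elts (H y) \<subseteq> elts (H (e 0)) \<or> (\<forall>z\<in>M. elts z \<subseteq> elts (H (e 0)) \<longrightarrow> z \<in> elts (H y)))"
      by (rule DF1[OF DH] D_intros)+
    then show "D {M} M (\<lambda>N e. ?C (e 0))" by (rule D_cong[rotated]) blast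
    fix x assume x: "x \<in> M" and IH: "\<And>v. v \<in> elts x \<Longrightarrow> ?C v"
    have 1: "elts (H x) \<subseteq> elts (H w) \<or> {z\<in>M. elts z \<subseteq> elts (H w)} \<subseteq> elts (H x)" if "w \<in> M" for w
    proof (rule disjCI)
      assume n: "\<not> {z\<in>M. elts z \<subseteq> elts (H w)} \<subseteq> elts (H x)"
      show "elts (H x) \<subseteq> elts (H w)"
      proof (rule H1[OF _ x])
        fix v assume v: "v \<in> elts x"
        then have "elts (H w) \<subseteq> elts (H v) \<or> {z\<in>M. elts z \<subseteq> elts (H v)} \<subseteq> elts (H w)" using IH that by blast
        moreover have "{z\<in>M. elts z \<subseteq> elts (H v)} \<subseteq> elts (H x)" unfolding H[OF x] using v by blast
        ultimately show "{z\<in>M. elts z \<subseteq> elts (H v)} \<subseteq> elts (H w)" using n by blast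
      qed
    qed
    show "?C x"
    proof (intro ballI disjCI)
      fix y assume y: "y \<in> M" and n: "\<not> {z\<in>M. elts z \<subseteq> elts (H x)} \<subseteq> elts (H y)"
      show "elts (H y) \<subseteq> elts (H x)"
      proof (rule H1[OF _ y])
        fix w assume w: "w \<in> elts y"
        have "{z\<in>M. elts z \<subseteq> elts (H w)} \<subseteq> elts (H y)" unfolding H[OF y] using w by blast
        then show "{z\<in>M. elts z \<subseteq> elts (H w)} \<subseteq> elts (H x)" using 1[OF innerD[OF i y w]] n by blast
      qed
    qed
  qed
  \<comment> \<open>Scott's trick: among the levels that include a witness for \<open>x\<close> as a
    subset, the least one is unique because levels are comparable. This turns the relation into a
    function, to which replacement applies.\<close>
  define good where "good x l \<longleftrightarrow> (\<exists>w\<in>M. l = H w) \<and> (\<exists>y\<in>M. elts y \<subseteq> elts l \<and> R x y)" for x l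
  have Dgood: "D {M} M (\<lambda>N e. good (etl e 0) (e 0))"
    unfolding good_def by (rule DF1[OF DH] D2[OF R] D_intros)+
  define L where "L x l \<longleftrightarrow> good x l \<and> (\<forall>l'\<in>M. good x l' \<longrightarrow> elts l \<subseteq> elts l')" for x l
  have DL: "D {M} M (\<lambda>N e. L (etl e 0) (e 0))"
    unfolding L_def by (rule D2[OF Dgood] D_intros)+
  have "\<exists>!l. l \<in> M \<and> L x l" if x: "x \<in> elts a" for x
  proof -
    have xM: "x \<in> M" using innerD[OF i a x] .
    obtain y where y: "y \<in> M" "R x y" using ex[OF x] by blast
    have "\<exists>l\<in>M. good x l" unfolding good_def using y sub[OF y(1)] HM by blast
    moreover have "\<exists>l\<in>M. good x l \<and> (\<forall>k\<in>elts l. \<not> good x k)"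
    proof (rule ccontr)
      assume n: "\<not> ?thesis"
      have "\<not> good x l" if "l \<in> M" for l
        apply (rule inner_induct[OF i, of "\<lambda>l. \<not> good x l", OF _ _ that])
         apply (rule D2[OF Dgood] xM D_intros)+
        using n by blast
      then show False using \<open>\<exists>l\<in>M. good x l\<close> by blast
    qed
    then obtain l where l: "l \<in> M" "good x l" "\<forall>k\<in>elts l. \<not> good x k" by blast
    have "L x l" unfolding L_def
    proof (intro conjI ballI impI l)
      fix l' assume l': "l' \<in> M" "good x l'"
      obtain w w' where w: "w \<in> M" "l = H w" "w' \<in> M" "l' = H w'" using l l' unfolding good_def by blast
      then have "elts (H w) \<subseteq> elts (H w') \<or> {z\<in>M. elts z \<subseteq> elts (H w')} \<subseteq> elts (H w)" using C by blast
      moreover have "l' \<notin> elts l" using l l' by blast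
      ultimately show "elts l \<subseteq> elts l'" using w l' by blast
    qed
    moreover have "l1 = l2" if "l1 \<in> M" "L x l1" "l2 \<in> M" "L x l2" for l1 l2
      using that unfolding L_def by (metis elts_eq_iff subset_antisym)
    ultimately show ?thesis using l(1) by (intro ex1I[of _ l]) auto
  qed
  from fun_of_rel[OF i a DL this] obtain f where f: "f \<in> M" "function_on a f" "\<forall>x\<in>elts a. L x (app f x)" by blast
  define B where "B = Uni (vset ((\<lambda>x. vset {y\<in>M. elts y \<subseteq> elts (ap f x)}) ` elts a))"
  have BM: "B \<in> M" unfolding B_def
    by (rule inner_in[OF i]) (rule f a D_intros)+
  have *: "\<exists>z\<in>M. elts z = (\<lambda>x. vset {y\<in>M. elts y \<subseteq> elts (ap f x)}) ` elts a"
    by (rule image_inner[OF i a]) (rule f D_intros)+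
  have "\<exists>y\<in>elts B. R x y" if x: "x \<in> elts a" for x
  proof -
    have "good x (ap f x)" using f x ap_app[OF f(2)] unfolding L_def by simp
    then obtain y where y: "y \<in> M" "elts y \<subseteq> elts (ap f x)" "R x y" unfolding good_def by blast
    have pw: "\<exists>z\<in>M. elts z = {y \<in> M. elts y \<subseteq> elts (ap f x)}"
      using inner_Pow[OF i, of "ap f x"] ap_app[OF f(2) x] app_in[OF i f(1,2) x] by simp
    have "y \<in> elts (vset {y\<in>M. elts y \<subseteq> elts (ap f x)})" using elts_vset[OF bex_small[OF pw]] y by blast
    then have "y \<in> elts B" unfolding B_def elts_Uni elts_vset[OF bex_small[OF *]] using x by blast
    then show ?thesis using y by blast
  qed
  then show ?thesis using BM by blast
qed

text \<open>The axiom of choice speaks of disjoint families of sets. Collection bounds the witnesses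
  by a set \<open>B\<close>, and tagging each witness with its argument makes the family
  disjoint.\<close>

lemma uniformization:
  assumes i: "inner M" and a: "a \<in> M" and R: "D {M} M (\<lambda>N e. R (etl e 0) (e 0))"
    and ex: "\<And>x. x \<in> elts a \<Longrightarrow> \<exists>y\<in>M. R x y"
  shows "\<exists>f\<in>M. function_on a f \<and> (\<forall>x\<in>elts a. R x (app f x))"
proof -
  obtain B where B: "B \<in> M" "\<forall>x\<in>elts a. \<exists>y\<in>elts B. R x y" using collection[OF i a R] ex by blast
  define F where "F x = vset ((\<lambda>y. opair x y) ` elts (vset {y\<in>elts B. R x y}))" for x
  have DFF: "DF {M} M (\<lambda>N e. F (e 0))" unfolding F_def
    by (rule B D2[OF R] D_intros)+
  have eF: "elts (F x) = (\<lambda>y. opair x y) ` {y\<in>elts B. R x y}" if x: "x \<in> M" for x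
  proof -
    have 1: "\<exists>z\<in>M. elts z = {y\<in>elts B. R x y}"
      by (rule sep[OF i B(1)]) (rule D2[OF R] x D_intros)+
    have "\<exists>z\<in>M. elts z = (\<lambda>y. opair x y) ` elts (vset {y\<in>elts B. R x y})"
      by (rule image_inner[OF i bex_vset[OF 1]]) (rule x D_intros)+
    from elts_vset[OF bex_small[OF this]] show ?thesis unfolding F_def elts_vset[OF bex_small[OF 1]] .
  qed
  have "\<exists>z\<in>M. elts z = F ` elts a" by (rule image_inner[OF i a DFF])
  then obtain A where A: "A \<in> M" "elts A = F ` elts a" by (elim bexE)
  have aM: "x \<in> M" if "x \<in> elts a" for x using innerD[OF i a that] .
  have "\<exists>c\<in>M. \<forall>x\<in>elts A. \<exists>!y. y \<in> elts c \<inter> elts x"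
  proof (rule inner_choice[OF i A(1)])
    show "\<forall>x\<in>elts A. elts x \<noteq> {}" unfolding A(2) using eF aM B by auto
    show "\<forall>x\<in>elts A. \<forall>y\<in>elts A. x \<noteq> y \<longrightarrow> elts x \<inter> elts y = {}" unfolding A(2) using eF aM by auto
  qed
  then obtain c where c: "c \<in> M" "\<forall>x\<in>elts A. \<exists>!y. y \<in> elts c \<inter> elts x" by blast
  have ex1: "\<exists>!y. y \<in> M \<and> (opair x y \<in> elts c \<and> y \<in> elts B \<and> R x y)" if x: "x \<in> elts a" for x
  proof -
    have "\<exists>!p. p \<in> elts c \<inter> elts (F x)" using c A x by blast
    then have "\<exists>!p. p \<in> elts c \<inter> (\<lambda>y. opair x y) ` {y\<in>elts B. R x y}" using eF[OF aM[OF x]] by simp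
    then obtain p where p: "p \<in> elts c \<inter> (\<lambda>y. opair x y) ` {y\<in>elts B. R x y}"
      "\<And>q. q \<in> elts c \<inter> (\<lambda>y. opair x y) ` {y\<in>elts B. R x y} \<Longrightarrow> q = p" by blast
    obtain y where y: "p = opair x y" "y \<in> elts B" "R x y" "opair x y \<in> elts c" using p(1) by blast
    show ?thesis
    proof (rule ex1I[of _ y])
      show "y \<in> M \<and> (opair x y \<in> elts c \<and> y \<in> elts B \<and> R x y)" using y innerD[OF i B(1)] by blast
      fix z assume "z \<in> M \<and> (opair x z \<in> elts c \<and> z \<in> elts B \<and> R x z)"
      then have "opair x z = p" by (intro p(2)) blast
      then show "z = y" using y(1) by simp
    qed
  qed
  have "D {M} M (\<lambda>N e. opair (etl e 0) (e 0) \<in> elts c \<and> e 0 \<in> elts B \<and> R (etl e 0) (e 0))"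
    by (rule c B D2[OF R] D_intros)+
  from fun_of_rel[OF i a this ex1] show ?thesis by blast
qed

subsection \<open>Ordinals\<close>

lemma Ord_elt: "Ord a \<Longrightarrow> x \<in> elts a \<Longrightarrow> Ord x"
  unfolding Ord_def transitive_def by blast

lemma Ord_trans: "Ord a \<Longrightarrow> x \<in> elts a \<Longrightarrow> y \<in> elts x \<Longrightarrow> y \<in> elts a"
  unfolding Ord_def transitive_def by blast

lemma small_sepU: "D {UNIV} UNIV (\<lambda>N e. P (e 0)) \<Longrightarrow> small {x\<in>elts a. P x}"
  using sep[OF inner_UNIV UNIV_I] bex_small by blast

lemma small_Int[simp]: "small (elts x \<inter> elts y)"
proof -
  have "small {z\<in>elts x. z \<in> elts y}" by (rule small_sepU) (rule D_intros)+
  then show ?thesis by (simp add: Int_def)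
qed

lemma small_Diff[simp]: "small (elts x - elts y)"
proof -
  have "small {z\<in>elts x. z \<notin> elts y}" by (rule small_sepU) (rule D_intros)+
  then show ?thesis by (simp add: set_diff_eq)
qed

lemma Ord_linear:
  assumes "Ord a" "Ord b"
  shows "a \<in> elts b \<or> a = b \<or> b \<in> elts a"
proof -
  have "\<forall>b. Ord a \<longrightarrow> Ord b \<longrightarrow> a \<in> elts b \<or> a = b \<or> b \<in> elts a" (is "?P a") for a :: 'a
  proof (rule inner_induct[OF inner_UNIV, of ?P, OF _ _ UNIV_I])
    fix a :: 'a assume IHa: "\<And>x. x \<in> elts a \<Longrightarrow> ?P x"
    have "Ord a \<longrightarrow> Ord b \<longrightarrow> a \<in> elts b \<or> a = b \<or> b \<in> elts a" (is "?Q b") for b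
    proof (rule inner_induct[OF inner_UNIV, of ?Q, OF _ _ UNIV_I])
      fix b :: 'a assume IHb: "\<And>y. y \<in> elts b \<Longrightarrow> ?Q y"
      show "?Q b"
      proof (intro impI)
        assume o: "Ord a" "Ord b"
        show "a \<in> elts b \<or> a = b \<or> b \<in> elts a"
        proof (rule ccontr)
          assume n: "\<not> ?thesis"
          have "y \<in> elts a" if "y \<in> elts b" for y
            using IHb[OF that] o Ord_elt[OF o(2) that] Ord_trans[OF o(2) that] n that by blast
          moreover have "x \<in> elts b" if "x \<in> elts a" for x
            using IHa[OF that] o Ord_elt[OF o(1) that] Ord_trans[OF o(1) that] n that by blast
          ultimately have "elts a = elts b" by blast
          then show False using n by (simp add: elts_eq_iff)
        qed
      qed
    qed (rule D_intros)+
    then show "?P a" by blast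
  qed (rule D_intros)+
  then show ?thesis using assms by blast
qed

lemma Ord_least:
  assumes "Ord a" "P a" "D {UNIV} UNIV (\<lambda>N e. P (e 0))"
  shows "\<exists>b. Ord b \<and> P b \<and> (\<forall>c\<in>elts b. \<not> P c)"
proof (rule ccontr)
  assume n: "\<not> ?thesis"
  have "Ord b \<longrightarrow> \<not> P b" for b
    apply (rule inner_induct[OF inner_UNIV, of "\<lambda>b. Ord b \<longrightarrow> \<not> P b", OF _ _ UNIV_I])
     apply (rule assms(3) D_intros)+
    using n Ord_elt by blast
  then show False using assms by blast
qed

lemma Ord_subset_iff: "Ord a \<Longrightarrow> Ord b \<Longrightarrow> elts a \<subseteq> elts b \<longleftrightarrow> a \<in> elts b \<or> a = b"
  using Ord_linear[of a b] Ord_trans elts_irrefl by blast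

section \<open>Ultrapowers of inner models\<close>

text \<open>The formula is arbitrary here, so that the proof of Los's theorem can treat its truth at
  represented points as a definable predicate of the index.\<close>

lemma D_sat:
  assumes "\<And>i. DF C K (t i)"
  shows "D C K (\<lambda>M e. satM M p (\<lambda>i. t i M e))"
  using assms
proof (induction p arbitrary: t)
  case (All i p)
  let ?t = "\<lambda>j. if j = i then (\<lambda>M e. e 0) else (\<lambda>M e. t j M (etl e))"
  have "D C K (\<lambda>M e. satM M p (\<lambda>j. ?t j M e))"
    by (rule All.IH) (simp add: DF_vars DF_tl[OF All.prems])
  moreover have "(\<lambda>j. ?t j M e) = (\<lambda>j. t j M (etl e))(i := e 0)" for M :: "'a set" and e by auto
  ultimately show ?case by (simp add: D_all)
qed (simp_all add: D_mem D_eq D_not D_conj)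

section \<open>Statements holding almost everywhere, and wellfoundedness of the ultrapower\<close>

locale ultrapower =
  fixes M :: "'v::zfc set" and Z :: 'v
  assumes inner: "inner M" and cc: "cc_ultrafilter M Z"
begin

abbreviation "X \<equiv> space Z"

lemma ultrafilter: "ultrafilter_on M X Z"
proof -
  obtain Y where Y: "ultrafilter_on M Y Z" using cc unfolding cc_ultrafilter_def by blast
  then have "(\<Union>A\<in>elts Z. elts A) = elts Y" unfolding ultrafilter_on_def by blast
  then have "X = Y" unfolding space_def by (simp add: vset_elts)
  then show ?thesis using Y by simp
qed

lemma X_in: "X \<in> M" and Z_in: "Z \<in> M" and X_mem: "X \<in> elts Z"
  and Z_sub: "A \<in> elts Z \<Longrightarrow> elts A \<subseteq> elts X" and Z_empty: "vset {} \<notin> elts Z"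
  and Z_up: "A \<in> elts Z \<Longrightarrow> B \<in> M \<Longrightarrow> elts A \<subseteq> elts B \<Longrightarrow> elts B \<subseteq> elts X \<Longrightarrow> B \<in> elts Z"
  and Z_Int: "A \<in> elts Z \<Longrightarrow> B \<in> elts Z \<Longrightarrow> vset (elts A \<inter> elts B) \<in> elts Z"
  and Z_ultra: "A \<in> M \<Longrightarrow> elts A \<subseteq> elts X \<Longrightarrow> A \<in> elts Z \<or> vset (elts X - elts A) \<in> elts Z"
  using ultrafilter unfolding ultrafilter_on_def by (blast+)

lemma XM: "x \<in> elts X \<Longrightarrow> x \<in> M"
  using innerD[OF inner X_in] .

text \<open>Stated through a witness in \<open>Z\<close> rather than through the set of all
  \<open>x\<close> such that \<open>P x\<close>, which makes it meaningful and monotone for every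
  HOL predicate. Definability of \<open>P\<close> enters where complements or countable
  intersections are formed.\<close>

definition ae :: "('v \<Rightarrow> bool) \<Rightarrow> bool" where
  "ae P \<longleftrightarrow> (\<exists>A\<in>elts Z. \<forall>x\<in>elts A. P x)"

lemma ae_mono: "ae P \<Longrightarrow> (\<And>x. x \<in> elts X \<Longrightarrow> P x \<Longrightarrow> Q x) \<Longrightarrow> ae Q"
  unfolding ae_def using Z_sub by blast

lemma ae_cong: "(\<And>x. x \<in> elts X \<Longrightarrow> P x = Q x) \<Longrightarrow> ae P = ae Q"
  using ae_mono by blast

lemma ae_conj: "ae (\<lambda>x. P x \<and> Q x) \<longleftrightarrow> ae P \<and> ae Q"
proof
  assume "ae P \<and> ae Q"
  then obtain A B where "A \<in> elts Z" "B \<in> elts Z" "\<forall>x\<in>elts A. P x" "\<forall>x\<in>elts B. Q x" unfolding ae_def by blast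
  then show "ae (\<lambda>x. P x \<and> Q x)" unfolding ae_def using Z_Int
    by (intro bexI[of _ "vset (elts A \<inter> elts B)"]) auto
qed (auto intro: ae_mono)

lemma ae_all: "(\<And>x. x \<in> elts X \<Longrightarrow> P x) \<Longrightarrow> ae P"
  unfolding ae_def using X_mem by blast

lemma ae_ex: "ae P \<Longrightarrow> \<exists>x\<in>elts X. P x"
  unfolding ae_def using Z_empty Z_sub elts_empty_iff by (metis all_not_in_conv subsetD)

lemma sepX: "D {M} M (\<lambda>N e. P (e 0)) \<Longrightarrow> \<exists>z\<in>M. elts z = {x\<in>elts X. P x}"
  using sep[OF inner X_in] .

lemma ae_set: "elts A = {x\<in>elts X. P x} \<Longrightarrow> A \<in> M \<Longrightarrow> ae P \<longleftrightarrow> A \<in> elts Z"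
proof
  assume A: "elts A = {x\<in>elts X. P x}" "A \<in> M" and "ae P"
  then obtain B where B: "B \<in> elts Z" "\<forall>x\<in>elts B. P x" unfolding ae_def by blast
  then have "elts B \<subseteq> elts A" using A Z_sub by blast
  then show "A \<in> elts Z" using Z_up B A by blast
qed (auto simp: ae_def)

lemma ae_not:
  assumes "D {M} M (\<lambda>N e. P (e 0))"
  shows "ae (\<lambda>x. \<not> P x) \<longleftrightarrow> \<not> ae P"
proof -
  obtain A where A: "A \<in> M" "elts A = {x\<in>elts X. P x}" using sepX[OF assms] by blast
  have "elts (vset (elts X - elts A)) = elts X - elts A" by simp
  then have "\<forall>x\<in>elts (vset (elts X - elts A)). \<not> P x" using A(2) by blast
  moreover have "A \<in> elts Z \<or> vset (elts X - elts A) \<in> elts Z" using Z_ultra[OF A(1)] A(2) by blast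
  moreover have "\<forall>x\<in>elts A. P x" using A(2) by blast
  ultimately have "ae P \<or> ae (\<lambda>x. \<not> P x)" unfolding ae_def by blast
  moreover have "\<not> (ae P \<and> ae (\<lambda>x. \<not> P x))"
    unfolding ae_conj[symmetric] using ae_ex by blast
  ultimately show ?thesis by blast
qed

lemma ae_omega:
  assumes P: "D {M} M (\<lambda>N e. P (etl e 0) (e 0))" and ae: "\<And>n. n \<in> elts omega \<Longrightarrow> ae (P n)"
  shows "ae (\<lambda>x. \<forall>n\<in>elts omega. P n x)"
proof -
  define F where "F n = vset {x\<in>elts X. P n x}" for n
  have DF: "DF {M} M (\<lambda>N e. F (e 0))"
    unfolding F_def by (rule X_in D2[OF P] D_intros)+
  have F: "\<exists>z\<in>M. elts z = {x\<in>elts X. P n x}" if "n \<in> M" for n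
    by (rule sepX) (rule D2[OF P] that D_intros)+
  have eF: "elts (F n) = {x\<in>elts X. P n x}" "F n \<in> M" if "n \<in> M" for n
    unfolding F_def using elts_vset[OF bex_small[OF F[OF that]]] bex_vset[OF F[OF that]] by auto
  have om: "n \<in> M" if "n \<in> elts omega" for n using innerD[OF inner omega_in[OF inner] that] .
  note s = lam_inner[OF inner omega_in[OF inner] DF]
  have FZ: "F n \<in> elts Z" if "n \<in> elts omega" for n
    using ae_set[of "F n" "P n"] eF[OF om[OF that]] ae[OF that] by simp
  have "vset (\<Inter>n\<in>elts omega. elts (app (lam omega F) n)) \<in> elts Z"
  proof -
    have "function_on omega (lam omega F) \<and> (\<forall>n\<in>elts omega. app (lam omega F) n \<in> elts Z)"
      using s(2,3) FZ by simp
    then show ?thesis using cc s(1) unfolding cc_ultrafilter_def countably_complete_def by blast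
  qed
  moreover have "(\<Inter>n\<in>elts omega. elts (app (lam omega F) n)) = {x\<in>elts X. \<forall>n\<in>elts omega. P n x}"
    using s(3) eF(1)[OF om] omega_0 by auto
  moreover have "\<exists>z\<in>M. elts z = {x\<in>elts X. \<forall>n\<in>elts omega. P n x}"
    by (rule sepX) (rule D2[OF P] D_intros)+
  then have "elts (vset {x\<in>elts X. \<forall>n\<in>elts omega. P n x}) = {x\<in>elts X. \<forall>n\<in>elts omega. P n x}"
    by (rule elts_vset[OF bex_small])
  ultimately show ?thesis unfolding ae_def by (intro bexI[of _ "vset {x\<in>elts X. \<forall>n\<in>elts omega. P n x}"]) auto
qed

definition Fn :: "'v set" where "Fn = {f\<in>M. function_on X f}"

lemma FnD: "f \<in> Fn \<Longrightarrow> f \<in> M" "f \<in> Fn \<Longrightarrow> function_on X f"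
  by (auto simp: Fn_def)

lemma Fn_ap: "f \<in> Fn \<Longrightarrow> x \<in> elts X \<Longrightarrow> app f x = ap f x"
  using ap_app FnD(2) by fastforce

lemma ap_in: "f \<in> M \<Longrightarrow> x \<in> M \<Longrightarrow> ap f x \<in> M"
  by (rule inner_in[OF inner]) (rule DF_ap DF_const | assumption)+

lemma D_ap_mem: "f \<in> M \<Longrightarrow> g \<in> M \<Longrightarrow> D {M} M (\<lambda>N e. ap f (e 0) \<in> elts (ap g (e 0)))"
  by (rule D_rules DF_const | assumption)+

lemma ult_mem_ae:
  assumes "f \<in> Fn" "g \<in> Fn"
  shows "ult_mem Z f g \<longleftrightarrow> ae (\<lambda>x. ap f x \<in> elts (ap g x))"
proof -
  obtain A where A: "A \<in> M" "elts A = {x\<in>elts X. ap f x \<in> elts (ap g x)}"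
    using sepX[OF D_ap_mem] FnD assms by blast
  have "{x\<in>elts X. app f x \<in> elts (app g x)} = elts A" unfolding A(2) using Fn_ap assms by auto
  then show ?thesis unfolding ult_mem_def using ae_set[OF A(2,1)] by (simp add: vset_elts)
qed

definition R :: "'v \<Rightarrow> 'v \<Rightarrow> bool" where
  "R h g \<longleftrightarrow> ae (\<lambda>x. ap h x \<in> elts (ap g x))"

lemma D_R: "D {M} M (\<lambda>N e. R (etl e 0) (e 0))"
  unfolding R_def ae_def by (rule Z_in D_intros)+

text \<open>If every element of \<open>S\<close> had an \<open>R\<close>-predecessor in
  \<open>S\<close>, choice in \<open>M\<close> would produce an \<omega>-sequence of functions, and
  countable completeness a single point of \<open>X\<close> at which their values descend forever
  along \<in>.\<close>

lemma R_wf: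
  assumes S: "S \<in> M" "elts S \<subseteq> Fn" "elts S \<noteq> {}"
  shows "\<exists>g\<in>elts S. \<forall>h\<in>elts S. \<not> R h g"
proof (rule ccontr)
  assume n: "\<not> ?thesis"
  have "D {M} M (\<lambda>N e. e 0 \<in> elts S \<and> R (e 0) (etl e 0))"
    by (rule S D2[OF D_R] D_intros)+
  moreover have "\<exists>h\<in>M. h \<in> elts S \<and> R h g" if "g \<in> elts S" for g
    using n that innerD[OF inner S(1)] by blast
  ultimately obtain c where c: "c \<in> M" "function_on S c" "\<forall>g\<in>elts S. app c g \<in> elts S \<and> R (app c g) g"
    using uniformization[OF inner S(1), of "\<lambda>g h. h \<in> elts S \<and> R h g"] by blast
  obtain g0 where g0: "g0 \<in> elts S" using S by blast
  have g0M: "g0 \<in> M" using innerD[OF inner S(1) g0] .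
  \<comment> \<open>On a successor \<open>Uni\<close> gives back the predecessor, because natural
    numbers are transitive.\<close>
  define G where "G n r = (if n = vset {} then g0 else ap c (ap r (Uni n)))" for n r
  have "\<exists>t\<in>M. function_on omega t \<and> (\<forall>g\<in>elts omega. \<exists>r\<in>M. function_on (vset {h\<in>elts omega. h \<in> elts g}) r \<and>
    (\<forall>h\<in>elts omega. h \<in> elts g \<longrightarrow> app r h = app t h) \<and> app t g = G g r)"
    apply (rule wf_recursion[OF inner omega_in[OF inner]])
      apply (rule D_rules)+
    unfolding G_def
     apply (rule c g0M D_intros)+
    using foundation_min by blast
  then obtain t where t: "t \<in> M" "function_on omega t" "\<forall>g\<in>elts omega. \<exists>r\<in>M. function_on (vset {h\<in>elts omega. h \<in> elts g}) r \<and>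
    (\<forall>h\<in>elts omega. h \<in> elts g \<longrightarrow> app r h = app t h) \<and> app t g = G g r" by blast
  have t0: "app t (vset {}) = g0" using t(3) omega_0 unfolding G_def by auto
  have tS: "app t (vset (insert m (elts m))) = ap c (app t m)" if m: "m \<in> elts omega" for m
  proof -
    let ?n = "vset (insert m (elts m))"
    have nn: "?n \<in> elts omega" using omega_Suc m .
    obtain r where r: "function_on (vset {h\<in>elts omega. h \<in> elts ?n}) r"
      "\<forall>h\<in>elts omega. h \<in> elts ?n \<longrightarrow> app r h = app t h" "app t ?n = G ?n r" using t(3) nn by blast
    have "{h\<in>elts omega. h \<in> elts ?n} = elts ?n" using omega_transitive[OF nn] by blast
    then have fr: "function_on ?n r" using r(1) by simp
    have "\<forall>y\<in>elts m. elts y \<subseteq> elts m"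
    proof (rule omega_induct[OF _ _ _ m, where P = "\<lambda>m. \<forall>y\<in>elts m. elts y \<subseteq> elts m"])
      show "small {n\<in>elts omega. \<forall>y\<in>elts n. elts y \<subseteq> elts n}"
        by (rule small_sepU) (rule D_intros)+
    qed auto
    then have "elts (Uni ?n) = elts m" by auto
    then have u: "Uni ?n = m" using elts_eq_iff by blast
    have "?n \<noteq> vset {}" by (metis elts_vset small_insert elts_empty insert_not_empty)
    then have "app t ?n = ap c (ap r m)" using r(3) u unfolding G_def by simp
    moreover have "ap r m = app t m" using ap_app[OF fr, of m] r(2) m by simp
    ultimately show ?thesis by simp
  qed
  have tin: "app t n \<in> elts S" if "n \<in> elts omega" for n
  proof (rule omega_induct[OF _ _ _ that, where P = "\<lambda>n. app t n \<in> elts S"])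
    have "small {n\<in>elts omega. ap t n \<in> elts S}" by (rule small_sepU) (rule D_intros)+
    moreover have "{n\<in>elts omega. ap t n \<in> elts S} = {n\<in>elts omega. app t n \<in> elts S}"
      using ap_app[OF t(2)] by auto
    ultimately show "small {n\<in>elts omega. app t n \<in> elts S}" by simp
  qed (use t0 g0 tS c ap_app[OF c(2)] in auto)
  have Rt: "R (app t (vset (insert n (elts n)))) (app t n)" if "n \<in> elts omega" for n
    using tS[OF that] c(3) tin[OF that] ap_app[OF c(2)] by simp
  let ?P = "\<lambda>n x. ap (ap t (vset (insert n (elts n)))) x \<in> elts (ap (ap t n) x)"
  have "ae (\<lambda>x. \<forall>n\<in>elts omega. ?P n x)"
  proof (rule ae_omega)
    show "D {M} M (\<lambda>N e. ?P (etl e 0) (e 0))" by (rule t D_intros)+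
    show "ae (?P n)" if "n \<in> elts omega" for n
      using Rt[OF that] ap_app[OF t(2)] omega_Suc[OF that] that unfolding R_def by simp
  qed
  then obtain x where x: "x \<in> elts X" "\<forall>n\<in>elts omega. ?P n x" using ae_ex by blast
  have "\<exists>z\<in>UNIV. elts z = (\<lambda>n. ap (ap t n) x) ` elts omega"
    by (rule image_inner[OF inner_UNIV UNIV_I]) (rule D_intros)+
  then obtain z where z: "elts z = (\<lambda>n. ap (ap t n) x) ` elts omega" by blast
  have "elts z \<noteq> {}" using z omega_0 by auto
  then obtain y where y: "y \<in> elts z" "\<forall>h\<in>elts z. h \<notin> elts y" using foundation_min by blast
  then obtain n where n: "n \<in> elts omega" "y = ap (ap t n) x" using z by auto
  have "ap (ap t (vset (insert n (elts n)))) x \<in> elts z" unfolding z by (rule imageI[OF omega_Suc[OF n(1)]])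
  then show False using y(2) x(2) n by auto
qed

section \<open>Set approximations of the transitive collapse\<close>

lemma funs_ex:
  assumes A: "A \<in> M"
  shows "\<exists>z\<in>M. elts z = {f\<in>M. function_on X f \<and> (\<forall>x\<in>elts X. app f x \<in> elts A)}"
proof -
  define P where "P = Uni (vset ((\<lambda>x. vset ((\<lambda>y. opair x y) ` elts A)) ` elts X))"
  have PM: "P \<in> M" unfolding P_def
    by (rule inner_in[OF inner]) (rule X_in A D_intros)+
  have 1: "\<exists>z\<in>M. elts z = (\<lambda>x. vset ((\<lambda>y. opair x y) ` elts A)) ` elts X"
    by (rule image_inner[OF inner X_in]) (rule A D_intros)+
  have 2: "\<exists>z\<in>M. elts z = (\<lambda>y. opair x y) ` elts A" if "x \<in> M" for x
    by (rule image_inner[OF inner A]) (rule that D_intros)+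
  have eP: "opair x y \<in> elts P" if "x \<in> elts X" "y \<in> elts A" for x y
  proof -
    have "opair x y \<in> elts (vset ((\<lambda>y. opair x y) ` elts A))"
      unfolding elts_vset[OF bex_small[OF 2[OF XM[OF that(1)]]]] using that by blast
    then show ?thesis unfolding P_def elts_Uni elts_vset[OF bex_small[OF 1]] using that(1) by blast
  qed
  obtain Q where Q: "Q \<in> M" "elts Q = {f\<in>M. elts f \<subseteq> elts P}" using inner_Pow[OF inner PM] by blast
  have "\<exists>z\<in>M. elts z = {f\<in>elts Q. function_on X f \<and> (\<forall>x\<in>elts X. ap f x \<in> elts A)}"
    by (rule sep[OF inner Q(1)]) (rule A X_in D_intros)+
  moreover have "{f\<in>elts Q. function_on X f \<and> (\<forall>x\<in>elts X. ap f x \<in> elts A)} =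
    {f\<in>M. function_on X f \<and> (\<forall>x\<in>elts X. app f x \<in> elts A)}"
  proof (intro Collect_eqI iffI)
    fix f assume f: "f \<in> M \<and> function_on X f \<and> (\<forall>x\<in>elts X. app f x \<in> elts A)"
    have "p \<in> elts P" if "p \<in> elts f" for p
      using function_on_mem[of X f p] f that eP by auto
    moreover have "ap f x \<in> elts A" if "x \<in> elts X" for x using ap_app[of X f x] f that by metis
    ultimately show "f \<in> elts Q \<and> function_on X f \<and> (\<forall>x\<in>elts X. ap f x \<in> elts A)" using f Q(2) by blast
  next
    fix f assume f: "f \<in> elts Q \<and> function_on X f \<and> (\<forall>x\<in>elts X. ap f x \<in> elts A)"
    have "app f x \<in> elts A" if "x \<in> elts X" for x using ap_app[of X f x] f that by metis
    then show "f \<in> M \<and> function_on X f \<and> (\<forall>x\<in>elts X. app f x \<in> elts A)" using f Q(2) by blast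
  qed
  ultimately show ?thesis by simp
qed

lemma elts_funs: "A \<in> M \<Longrightarrow> elts (funs M X A) = {f\<in>Fn. \<forall>x\<in>elts X. ap f x \<in> elts A}"
  unfolding funs_def using elts_vset[OF bex_small[OF funs_ex]] Fn_ap by (auto simp: Fn_def)

lemma funs_in: "A \<in> M \<Longrightarrow> funs M X A \<in> M"
  unfolding funs_def using bex_vset[OF funs_ex] .

text \<open>The approximations over which \<open>ult_class\<close> quantifies, with
  \<open>ult_mem\<close> replaced by \<open>R\<close>, to which it is equivalent on functions in
  \<open>M\<close> and which is known to be definable.\<close>

definition coll :: "'v \<Rightarrow> 'v \<Rightarrow> bool" where
  "coll A t \<longleftrightarrow> A \<in> M \<and> t \<in> M \<and> transitive A \<and> function_on (funs M X A) t \<and>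
    (\<forall>g\<in>elts (funs M X A). elts (app t g) = {app t h | h. h \<in> elts (funs M X A) \<and> R h g})"

lemma coll_ex:
  assumes A: "A \<in> M" "transitive A"
  shows "\<exists>t. coll A t"
proof -
  let ?F = "funs M X A"
  define G where "G g r = vset (ap r ` elts (vset {h\<in>elts ?F. R h g}))" for g r
  have "\<exists>t\<in>M. function_on ?F t \<and> (\<forall>g\<in>elts ?F. \<exists>r\<in>M. function_on (vset {h\<in>elts ?F. R h g}) r \<and>
    (\<forall>h\<in>elts ?F. R h g \<longrightarrow> app r h = app t h) \<and> app t g = G g r)"
  proof (rule wf_recursion[OF inner funs_in[OF A(1)] D_R])
    show "DF {M} M (\<lambda>N e. G (etl e 0) (e 0))" unfolding G_def
      by (rule funs_in A D2[OF D_R] D_intros)+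
    show "\<exists>g\<in>elts S. \<forall>h\<in>elts S. \<not> R h g" if "S \<in> M" "elts S \<subseteq> elts ?F" "elts S \<noteq> {}" for S
      using R_wf that elts_funs[OF A(1)] by blast
  qed
  then obtain t where t: "t \<in> M" "function_on ?F t" "\<forall>g\<in>elts ?F. \<exists>r\<in>M. function_on (vset {h\<in>elts ?F. R h g}) r \<and>
    (\<forall>h\<in>elts ?F. R h g \<longrightarrow> app r h = app t h) \<and> app t g = G g r" by blast
  have "elts (app t g) = {app t h | h. h \<in> elts ?F \<and> R h g}" if g: "g \<in> elts ?F" for g
  proof -
    obtain r where r: "r \<in> M" "function_on (vset {h\<in>elts ?F. R h g}) r"
      "\<forall>h\<in>elts ?F. R h g \<longrightarrow> app r h = app t h" "app t g = G g r" using t(3) g by blast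
    have gM: "g \<in> M" using innerD[OF inner funs_in[OF A(1)] g] .
    have s: "\<exists>z\<in>M. elts z = {h\<in>elts ?F. R h g}"
      by (rule sep[OF inner funs_in[OF A(1)]]) (rule D2[OF D_R] gM D_intros)+
    have "\<exists>z\<in>M. elts z = ap r ` elts (vset {h\<in>elts ?F. R h g})"
      by (rule image_inner[OF inner bex_vset[OF s]]) (rule r D_intros)+
    then have "elts (app t g) = ap r ` {h\<in>elts ?F. R h g}"
      unfolding r(4) G_def using elts_vset[OF bex_small] elts_vset[OF bex_small[OF s]] by metis
    moreover have "ap r h = app t h" if "h \<in> {h\<in>elts ?F. R h g}" for h
      using ap_app[OF r(2)] elts_vset[OF bex_small[OF s]] r(3) that by simp
    ultimately show ?thesis by auto
  qed
  then show ?thesis unfolding coll_def using t A by blast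
qed

lemma transitive_Un: "transitive A \<Longrightarrow> transitive B \<Longrightarrow> transitive (vset (elts A \<union> elts B))"
  unfolding transitive_def by auto

lemma bounding:
  assumes "f \<in> Fn"
  shows "\<exists>A\<in>M. transitive A \<and> f \<in> elts (funs M X A)"
proof -
  obtain A where A: "A \<in> M" "transitive A" "f \<in> elts A" using transitive_superset[OF inner FnD(1)[OF assms]] by blast
  have "ap f x \<in> elts A" if "x \<in> elts X" for x
  proof -
    have "opair x (ap f x) \<in> elts f" using app_mem[OF FnD(2)[OF assms] that] Fn_ap[OF assms that] by simp
    then have "ap f x \<in> elts (Uni (Uni f))" by (rule opair_UniUni)
    then show ?thesis using A unfolding transitive_def elts_Uni by blast
  qed
  then show ?thesis using A elts_funs assms by blast
qed

lemma funs_mono: "A \<in> M \<Longrightarrow> B \<in> M \<Longrightarrow> elts A \<subseteq> elts B \<Longrightarrow> f \<in> elts (funs M X A) \<Longrightarrow> f \<in> elts (funs M X B)"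
  using elts_funs by blast

lemma bounding2:
  assumes "f \<in> Fn" "g \<in> Fn"
  shows "\<exists>A\<in>M. transitive A \<and> f \<in> elts (funs M X A) \<and> g \<in> elts (funs M X A)"
proof -
  obtain A B where "A \<in> M" "transitive A" "f \<in> elts (funs M X A)" "B \<in> M" "transitive B" "g \<in> elts (funs M X B)"
    using bounding assms by meson
  moreover have "vset (elts A \<union> elts B) \<in> M"
    by (rule inner_in[OF inner]) (rule calculation D_intros)+
  ultimately show ?thesis using transitive_Un funs_mono[of A "vset (elts A \<union> elts B)"] 
      funs_mono[of B "vset (elts A \<union> elts B)"]
    by (intro bexI[of _ "vset (elts A \<union> elts B)"]) auto
qed

end

text \<open>Bisimilar points of two collapses have the same value. This gives the independence of
  \<open>ult_class\<close> from the approximation chosen and, in \<open>s_emb\<close>, relates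
  ultrapowers formed in two different models.\<close>

lemma collapse_bisim:
  assumes t1: "function_on F1 t1" "\<And>g. g \<in> elts F1 \<Longrightarrow> elts (app t1 g) = {app t1 h | h. h \<in> elts F1 \<and> R1 h g}"
    and t2: "function_on F2 t2" "\<And>g. g \<in> elts F2 \<Longrightarrow> elts (app t2 g) = {app t2 h | h. h \<in> elts F2 \<and> R2 h g}"
    and D: "D {UNIV} UNIV (\<lambda>N e. S (etl e 0) (e 0))"
    and zig: "\<And>g f h. S g f \<Longrightarrow> g \<in> elts F1 \<Longrightarrow> f \<in> elts F2 \<Longrightarrow> h \<in> elts F1 \<Longrightarrow> R1 h g \<Longrightarrow> \<exists>k\<in>elts F2. R2 k f \<and> S h k"
    and zag: "\<And>g f k. S g f \<Longrightarrow> g \<in> elts F1 \<Longrightarrow> f \<in> elts F2 \<Longrightarrow> k \<in> elts F2 \<Longrightarrow> R2 k f \<Longrightarrow> \<exists>h\<in>elts F1. R1 h g \<and> S h k"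
    and S: "S g f" "g \<in> elts F1" "f \<in> elts F2"
  shows "app t1 g = app t2 f"
proof -
  \<comment> \<open>The induction runs along \<in> on the value of \<open>t1\<close>;
    \<open>R1\<close> and \<open>R2\<close> are not assumed to be well founded.\<close>
  let ?P = "\<lambda>y. \<forall>g\<in>elts F1. \<forall>f\<in>elts F2. S g f \<and> ap t1 g = y \<longrightarrow> ap t1 g = ap t2 f"
  have "?P y" for y
  proof (rule inner_induct[OF inner_UNIV, of ?P, OF _ _ UNIV_I])
    show "D {UNIV} UNIV (\<lambda>N e. ?P (e 0))"
      by (rule D2[OF D] D_intros)+
    fix y assume IH: "\<And>z. z \<in> elts y \<Longrightarrow> ?P z"
    show "?P y"
    proof (intro ballI impI)
      fix g f assume gf: "g \<in> elts F1" "f \<in> elts F2" "S g f \<and> ap t1 g = y"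
      then have e: "elts y = {app t1 h | h. h \<in> elts F1 \<and> R1 h g}" using t1(2)[OF gf(1)] ap_app[OF t1(1) gf(1)] by simp
      have eq: "app t1 h = app t2 k" if "h \<in> elts F1" "k \<in> elts F2" "S h k" "R1 h g" for h k
      proof -
        have "app t1 h \<in> elts y" using e that by blast
        then show ?thesis using IH that ap_app[OF t1(1)] ap_app[OF t2(1)] by metis
      qed
      have "elts y = elts (app t2 f)"
      proof (intro equalityI subsetI)
        fix z assume "z \<in> elts y"
        then obtain h where h: "z = app t1 h" "h \<in> elts F1" "R1 h g" using e by blast
        obtain k where "k \<in> elts F2" "R2 k f" "S h k" using zig h gf by blast
        then show "z \<in> elts (app t2 f)" using eq h t2(2)[OF gf(2)] by blast
      next
        fix z assume "z \<in> elts (app t2 f)"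
        then obtain k where k: "z = app t2 k" "k \<in> elts F2" "R2 k f" using t2(2)[OF gf(2)] by blast
        obtain h where h: "h \<in> elts F1" "R1 h g" "S h k" using zag k gf by blast
        then have "z = app t1 h" using eq k by simp
        then show "z \<in> elts y" using e h by blast
      qed
      then show "ap t1 g = ap t2 f" using gf ap_app[OF t2(1)] by (simp add: elts_eq_iff)
    qed
  qed
  then show ?thesis using S ap_app[OF t1(1)] ap_app[OF t2(1)] by metis
qed

context ultrapower begin

abbreviation cl :: "'v \<Rightarrow> 'v" where "cl \<equiv> ult_class M Z"

lemma lam_Fn:
  assumes "DF {M} M (\<lambda>N e. F (e 0))"
  shows "lam X F \<in> Fn" "x \<in> elts X \<Longrightarrow> ap (lam X F) x = F x"
proof -
  note l = lam_inner[OF inner X_in assms]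
  show "lam X F \<in> Fn" using l(1,2) by (simp add: Fn_def)
  show "x \<in> elts X \<Longrightarrow> ap (lam X F) x = F x" using ap_app[OF l(2)] l(3) by simp
qed

lemma coll_eq:
  assumes c: "coll A t" "coll B s" and f: "f \<in> elts (funs M X A)" "g \<in> elts (funs M X B)"
    and ae: "ae (\<lambda>x. ap f x = ap g x)"
  shows "app t f = app s g"
proof (rule collapse_bisim[where S = "\<lambda>f g. ae (\<lambda>x. ap f x = ap g x)" and ?R1.0 = R and ?R2.0 = R, OF _ _ _ _ _ _ _ ae f])
  have zig: "\<exists>k\<in>elts (funs M X B). R k g \<and> ae (\<lambda>x. ap h x = ap k x)"
    if B: "B \<in> M" "transitive B" and ae: "ae (\<lambda>x. ap f x = ap g x)" and f: "f \<in> Fn" "g \<in> elts (funs M X B)" 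
      and h: "h \<in> Fn" "R h f" for f g h B
  proof -
    \<comment> \<open>\<open>h\<close> need not map into \<open>B\<close>. Where its value is an
      element of the value of \<open>g\<close> it lies in \<open>B\<close> by transitivity;
      elsewhere the value of \<open>g\<close> is used.\<close>
    let ?k = "\<lambda>x. if ap h x \<in> elts (ap g x) then ap h x else ap g x"
    have g: "g \<in> Fn" "\<forall>x\<in>elts X. ap g x \<in> elts B" using f elts_funs[OF B(1)] by auto
    have k: "lam X ?k \<in> Fn" "\<And>x. x \<in> elts X \<Longrightarrow> ap (lam X ?k) x = ?k x"
      by (rule lam_Fn, (rule FnD h g D_intros)+)+
    have "lam X ?k \<in> elts (funs M X B)"
      unfolding elts_funs[OF B(1)] using k g(2) B(2) by (auto simp: transitive_def)
    moreover have hg: "ae (\<lambda>x. ap h x \<in> elts (ap g x))"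
      using h(2) ae unfolding R_def by (rule ae_mono[OF iffD2[OF ae_conj conjI]]) auto
    moreover have "R (lam X ?k) g" unfolding R_def
      by (rule ae_mono[OF hg]) (use k in simp)
    moreover have "ae (\<lambda>x. ap h x = ap (lam X ?k) x)"
      by (rule ae_mono[OF hg]) (use k in simp)
    ultimately show ?thesis by blast
  qed
  have sym: "ae (\<lambda>x. ap f x = ap g x) \<Longrightarrow> ae (\<lambda>x. ap g x = ap f x)" for f g
    by (erule ae_mono) simp
  show "\<exists>k\<in>elts (funs M X B). R k g \<and> ae (\<lambda>x. ap h x = ap k x)"
    if "ae (\<lambda>x. ap f x = ap g x)" "f \<in> elts (funs M X A)" "g \<in> elts (funs M X B)" "h \<in> elts (funs M X A)" "R h f" for f g h
  proof -
    have "A \<in> M" "B \<in> M" "transitive B" using c unfolding coll_def by auto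
    moreover have "f \<in> Fn" "h \<in> Fn" using that elts_funs[OF \<open>A \<in> M\<close>] by auto
    ultimately show ?thesis by (intro zig[OF _ _ that(1) _ that(3) _ that(5)])
  qed
  show "\<exists>h\<in>elts (funs M X A). R h f \<and> ae (\<lambda>x. ap h x = ap k x)"
    if "ae (\<lambda>x. ap f x = ap g x)" "f \<in> elts (funs M X A)" "g \<in> elts (funs M X B)" "k \<in> elts (funs M X B)" "R k g" for f g k
  proof -
    have "A \<in> M" "transitive A" "B \<in> M" using c unfolding coll_def by auto
    moreover have "g \<in> Fn" "k \<in> Fn" using that elts_funs[OF \<open>B \<in> M\<close>] by auto
    ultimately have "\<exists>h\<in>elts (funs M X A). R h f \<and> ae (\<lambda>x. ap k x = ap h x)"
      by (intro zig[OF _ _ sym[OF that(1)] _ that(2) _ that(5)])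
    then show ?thesis using sym by blast
  qed
  show "D {UNIV} UNIV (\<lambda>N e. ae (\<lambda>x. ap (etl e 0) x = ap (e 0) x))"
    unfolding ae_def by (rule D_intros)+
qed (use c in \<open>auto simp: coll_def\<close>)

lemma cl_coll:
  assumes c: "coll A t" and f: "f \<in> elts (funs M X A)"
  shows "cl f = app t f"
proof -
  have coll: "(\<forall>g \<in> elts (funs M X A). elts (app t g) = {app t h | h. h \<in> elts (funs M X A) \<and> ult_mem Z h g}) \<longleftrightarrow>
    (\<forall>g \<in> elts (funs M X A). elts (app t g) = {app t h | h. h \<in> elts (funs M X A) \<and> R h g})" if "A \<in> M" for A t
  proof (intro ball_cong refl)
    fix g assume g: "g \<in> elts (funs M X A)"
    have "{app t h | h. h \<in> elts (funs M X A) \<and> ult_mem Z h g} = {app t h | h. h \<in> elts (funs M X A) \<and> R h g}"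
      unfolding R_def using ult_mem_ae g elts_funs[OF that] by blast
    then show "(elts (app t g) = {app t h | h. h \<in> elts (funs M X A) \<and> ult_mem Z h g}) \<longleftrightarrow>
      (elts (app t g) = {app t h | h. h \<in> elts (funs M X A) \<and> R h g})" by simp
  qed
  have collU: "coll A t \<longleftrightarrow> A \<in> M \<and> t \<in> M \<and> transitive A \<and> function_on (funs M X A) t \<and>
    (\<forall>g \<in> elts (funs M X A). elts (app t g) = {app t h | h. h \<in> elts (funs M X A) \<and> ult_mem Z h g})" for A t
    unfolding coll_def by (cases "A \<in> M") (simp_all only: coll simp_thms)
  note cU = c[unfolded collU]
  show ?thesis unfolding ult_class_def
  proof (rule the_equality)
    show "\<exists>A\<in>M. \<exists>s\<in>M. transitive A \<and> f \<in> elts (funs M X A) \<and> function_on (funs M X A) s \<and>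
      (\<forall>g\<in>elts (funs M X A). elts (app s g) = {app s h |h. h \<in> elts (funs M X A) \<and> ult_mem Z h g}) \<and> app t f = app s f"
      by (rule bexI[of _ A], rule bexI[of _ t]) (use cU f in auto)
    fix y assume "\<exists>A\<in>M. \<exists>t\<in>M. transitive A \<and> f \<in> elts (funs M X A) \<and> function_on (funs M X A) t \<and>
      (\<forall>g\<in>elts (funs M X A). elts (app t g) = {app t h |h. h \<in> elts (funs M X A) \<and> ult_mem Z h g}) \<and> y = app t f"
    then obtain B s where B: "B \<in> M" "s \<in> M" "transitive B" "f \<in> elts (funs M X B)" "function_on (funs M X B) s"
      "\<forall>g\<in>elts (funs M X B). elts (app s g) = {app s h |h. h \<in> elts (funs M X B) \<and> ult_mem Z h g}" "y = app s f"
      by (elim bexE conjE)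
    then have "coll B s" unfolding collU by (intro conjI)
    then show "y = app t f" unfolding B(7) by (rule coll_eq[OF _ c B(4) f ae_all]) simp
  qed
qed

lemma collD: "coll A t \<Longrightarrow> A \<in> M" "coll A t \<Longrightarrow> t \<in> M" "coll A t \<Longrightarrow> transitive A"
  "coll A t \<Longrightarrow> function_on (funs M X A) t"
  unfolding coll_def by simp_all

lemma coll_elts: "coll A t \<Longrightarrow> g \<in> elts (funs M X A) \<Longrightarrow>
    elts (app t g) = {app t h | h. h \<in> elts (funs M X A) \<and> R h g}"
  unfolding coll_def by simp

lemma coll_obtain:
  assumes "f \<in> Fn" "g \<in> Fn"
  obtains A t where "coll A t" "f \<in> elts (funs M X A)" "g \<in> elts (funs M X A)"
  using bounding2[OF assms] coll_ex by blast

lemma cl_in: "f \<in> Fn \<Longrightarrow> cl f \<in> M"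
proof -
  assume f: "f \<in> Fn"
  obtain A t where c: "coll A t" "f \<in> elts (funs M X A)" using coll_obtain[OF f f] by blast
  then show ?thesis using cl_coll[OF c] app_in[OF inner] unfolding coll_def by metis
qed

lemma elts_cl:
  assumes g: "g \<in> Fn"
  shows "elts (cl g) = {cl h | h. h \<in> Fn \<and> ae (\<lambda>x. ap h x \<in> elts (ap g x))}"
proof (intro equalityI subsetI)
  fix y assume y: "y \<in> elts (cl g)"
  obtain A t where c: "coll A t" "g \<in> elts (funs M X A)" using coll_obtain[OF g g] by blast
  have "y \<in> {app t h | h. h \<in> elts (funs M X A) \<and> R h g}"
    using y cl_coll[OF c] coll_elts[OF c] by simp
  then obtain h where h: "h \<in> elts (funs M X A)" "R h g" "y = app t h" by blast
  moreover have "h \<in> Fn" using elts_funs[OF collD(1)[OF c(1)]] h(1) by blast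
  ultimately show "y \<in> {cl h | h. h \<in> Fn \<and> ae (\<lambda>x. ap h x \<in> elts (ap g x))}"
    using cl_coll[OF c(1) h(1)] unfolding R_def by (intro CollectI exI[of _ h]) simp
next
  fix y assume "y \<in> {cl h | h. h \<in> Fn \<and> ae (\<lambda>x. ap h x \<in> elts (ap g x))}"
  then obtain h where h: "h \<in> Fn" "R h g" "y = cl h" unfolding R_def by blast
  obtain A t where c: "coll A t" "h \<in> elts (funs M X A)" "g \<in> elts (funs M X A)" using coll_obtain[OF h(1) g] by blast
  show "y \<in> elts (cl g)"
    using h cl_coll[OF c(1,2)] cl_coll[OF c(1,3)] coll_elts[OF c(1,3)] c(2) by auto
qed

lemma cl_eqI: "f \<in> Fn \<Longrightarrow> g \<in> Fn \<Longrightarrow> ae (\<lambda>x. ap f x = ap g x) \<Longrightarrow> cl f = cl g"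
  using coll_obtain[of f g] cl_coll coll_eq by metis

text \<open>The induction is on the common value. If almost everywhere the value of \<open>f\<close>
  is not included in that of \<open>g\<close>, a chosen element of the difference represents a
  member of the common value. By the induction hypothesis it agrees almost everywhere with a
  function that is pointwise an element of \<open>g\<close>, which is impossible.\<close>

lemma cl_eqD:
  assumes "f \<in> Fn" "g \<in> Fn" "cl f = cl g"
  shows "ae (\<lambda>x. ap f x = ap g x)"
proof -
  obtain A t where c: "coll A t" "f \<in> elts (funs M X A)" "g \<in> elts (funs M X A)" using coll_obtain[OF assms(1,2)] by blast
  let ?F = "funs M X A"
  note A = collD(1,2,4)[OF c(1)]
  let ?P = "\<lambda>y. \<forall>f\<in>elts ?F. \<forall>g\<in>elts ?F. ap t f = y \<and> ap t g = y \<longrightarrow> ae (\<lambda>x. ap f x = ap g x)"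
  have "?P y" for y
  proof (rule inner_induct[OF inner_UNIV, of ?P, OF _ _ UNIV_I])
    show "D {UNIV} UNIV (\<lambda>N e. ?P (e 0))"
      unfolding ae_def by (rule D_intros)+
    fix y assume IH: "\<And>z. z \<in> elts y \<Longrightarrow> ?P z"
    have ns: "ae (\<lambda>x. elts (ap f x) \<subseteq> elts (ap g x))" 
      if fg: "f \<in> elts ?F" "g \<in> elts ?F" "ap t f = y" "ap t g = y" for f g
    proof (rule ccontr)
      have F: "f \<in> Fn" "g \<in> Fn" using fg elts_funs[OF A(1)] by auto
      assume "\<not> ae (\<lambda>x. elts (ap f x) \<subseteq> elts (ap g x))"
      have "D {M} M (\<lambda>N e. elts (ap f (e 0)) \<subseteq> elts (ap g (e 0)))"
        by (rule FnD F D_intros)+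
      from ae_not[OF this] have n: "ae (\<lambda>x. \<not> elts (ap f x) \<subseteq> elts (ap g x))"
        using \<open>\<not> ae _\<close> by simp
      \<comment> \<open>Where the inclusion holds nothing is demanded of \<open>z\<close>, so a
        witness exists at every point and uniformization applies.\<close>
      let ?Q = "\<lambda>x z. \<not> elts (ap f x) \<subseteq> elts (ap g x) \<longrightarrow> z \<in> elts (ap f x) \<and> z \<notin> elts (ap g x)"
      have "D {M} M (\<lambda>N e. ?Q (etl e 0) (e 0))"
        by (rule FnD F D_intros)+
      moreover have "\<exists>z\<in>M. ?Q x z" if "x \<in> elts X" for x
        using innerD[OF inner ap_in[OF FnD(1)[OF F(1)] XM[OF that]]] XM[OF that] by blast
      ultimately obtain h0 where h0: "h0 \<in> M" "function_on X h0" "\<forall>x\<in>elts X. ?Q x (app h0 x)"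
        using uniformization[OF inner X_in, of ?Q] by blast
      then have h0F: "h0 \<in> Fn" by (simp add: Fn_def)
      have hf: "ae (\<lambda>x. ap h0 x \<in> elts (ap f x))" "ae (\<lambda>x. ap h0 x \<notin> elts (ap g x))"
        by (rule ae_mono[OF n], use h0 Fn_ap[OF h0F] in auto)+
      have "cl h0 \<in> elts (cl f)" using elts_cl[OF F(1)] h0F hf by blast
      then have "cl h0 \<in> elts y" using cl_coll[OF c(1) fg(1)] fg(3) ap_app[OF A(3) fg(1)] by simp
      obtain h where h: "h \<in> elts ?F" "app t h = cl h0" 
        using \<open>cl h0 \<in> elts y\<close> fg(3) coll_elts[OF c(1) fg(1)] ap_app[OF A(3) fg(1)] by auto
      obtain k where k: "k \<in> elts ?F" "R k g" "app t k = cl h0"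
        using \<open>cl h0 \<in> elts y\<close> fg(4) coll_elts[OF c(1) fg(2)] ap_app[OF A(3) fg(2)] by auto
      text \<open>\<open>h0\<close> itself need not map into \<open>A\<close>, so it is replaced by a modification \<open>h1\<close>.\<close>
      let ?k = "\<lambda>x. if ap h0 x \<in> elts (ap f x) then ap h0 x else ap f x"
      have h1: "lam X ?k \<in> Fn" "\<And>x. x \<in> elts X \<Longrightarrow> ap (lam X ?k) x = ?k x"
        by (rule lam_Fn, (rule FnD h0F F D_intros)+)+
      have h1F: "lam X ?k \<in> elts ?F"
        unfolding elts_funs[OF A(1)] using h1 fg(1) collD(3)[OF c(1)] elts_funs[OF A(1)]
        by (auto simp: transitive_def)
      have e1: "ae (\<lambda>x. ap (lam X ?k) x = ap h0 x)" by (rule ae_mono[OF hf(1)]) (use h1 in simp)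
      have "app t (lam X ?k) = cl h0" using cl_coll[OF c(1) h1F] cl_eqI[OF h1(1) h0F e1] by simp
      then have "ae (\<lambda>x. ap (lam X ?k) x = ap k x)"
        using IH[OF \<open>cl h0 \<in> elts y\<close>] h1F k ap_app[OF A(3)] by metis
      then have "ae (\<lambda>x. (ap (lam X ?k) x = ap k x \<and> ap (lam X ?k) x = ap h0 x) \<and> 
          (ap k x \<in> elts (ap g x) \<and> ap h0 x \<notin> elts (ap g x)))"
        unfolding ae_conj using e1 hf k(2) R_def by blast
      then show False using ae_ex by force
    qed
    show "?P y"
    proof (intro ballI impI)
      fix f g assume fg: "f \<in> elts ?F" "g \<in> elts ?F" "ap t f = y \<and> ap t g = y"
      then have "ae (\<lambda>x. elts (ap f x) \<subseteq> elts (ap g x) \<and> elts (ap g x) \<subseteq> elts (ap f x))"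
        unfolding ae_conj using ns by blast
      then show "ae (\<lambda>x. ap f x = ap g x)" by (rule ae_mono) (use elts_eq_iff in blast)
    qed
  qed
  then show ?thesis using c assms cl_coll[OF c(1)] ap_app[OF A(3)] by metis
qed

lemma cl_eq: "f \<in> Fn \<Longrightarrow> g \<in> Fn \<Longrightarrow> cl f = cl g \<longleftrightarrow> ae (\<lambda>x. ap f x = ap g x)"
  using cl_eqI cl_eqD by blast

lemma cl_mem:
  assumes "f \<in> Fn" "g \<in> Fn"
  shows "cl f \<in> elts (cl g) \<longleftrightarrow> ae (\<lambda>x. ap f x \<in> elts (ap g x))"
proof
  assume "cl f \<in> elts (cl g)"
  then obtain h where "h \<in> Fn" "ae (\<lambda>x. ap h x \<in> elts (ap g x))" "cl f = cl h" using elts_cl assms by blast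
  then have "ae (\<lambda>x. ap h x \<in> elts (ap g x) \<and> ap f x = ap h x)" unfolding ae_conj using cl_eqD assms by blast
  then show "ae (\<lambda>x. ap f x \<in> elts (ap g x))" by (rule ae_mono) auto
qed (use elts_cl assms in blast)

lemma Ult_iff: "y \<in> Ult M Z \<longleftrightarrow> (\<exists>f\<in>Fn. y = cl f)"
  unfolding Ult_def Fn_def by blast

lemma Ult_sub: "y \<in> Ult M Z \<Longrightarrow> y \<in> M"
  by (auto simp: Ult_iff cl_in)

lemma Ult_transitive: "y \<in> Ult M Z \<Longrightarrow> x \<in> elts y \<Longrightarrow> x \<in> Ult M Z"
  by (auto simp: Ult_iff elts_cl)

text \<open>In the quantifier case pointwise counterexamples are assembled by uniformization in
  \<open>M\<close> into one function, whose class is a counterexample in the ultrapower.\<close>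

lemma Los:
  assumes "\<And>i. f i \<in> Fn"
  shows "satM (Ult M Z) p (\<lambda>i. cl (f i)) \<longleftrightarrow> ae (\<lambda>x. satM M p (\<lambda>i. ap (f i) x))"
  using assms
proof (induction p arbitrary: f)
  case (Neg p)
  have "D {M} M (\<lambda>N e. satM N p (\<lambda>i. ap (f i) (e 0)))"
    by (rule D_sat) (rule FnD Neg.prems D_intros)+
  then have "D {M} M (\<lambda>N e. satM M p (\<lambda>i. ap (f i) (e 0)))"
    by (rule D_cong[rotated]) (auto dest: valid_single)
  from ae_not[OF this] show ?case using Neg by simp
next
  case (Conj p q)
  then show ?case by (simp add: ae_conj)
next
  case (All i p)
  have IH: "satM (Ult M Z) p ((\<lambda>i. cl (f i))(i := cl g)) \<longleftrightarrow> ae (\<lambda>x. satM M p ((\<lambda>i. ap (f i) x)(i := ap g x)))"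
    if "g \<in> Fn" for g
  proof -
    have "(\<lambda>j. cl ((f(i := g)) j)) = (\<lambda>i. cl (f i))(i := cl g)" by auto
    moreover have "(\<lambda>j. ap ((f(i := g)) j) x) = (\<lambda>i. ap (f i) x)(i := ap g x)" for x by auto
    ultimately show ?thesis using All.IH[of "f(i := g)"] All.prems that by simp
  qed
  let ?A = "\<lambda>x. \<forall>y\<in>M. satM M p ((\<lambda>i. ap (f i) x)(i := y))"
  have "D {M} M (\<lambda>N e. satM N (All i p) (\<lambda>i. ap (f i) (e 0)))"
    by (rule D_sat) (rule FnD All.prems D_intros)+
  then have DA: "D {M} M (\<lambda>N e. ?A (e 0))"
    by (rule D_cong[rotated]) (auto dest: valid_single)
  let ?B = "\<lambda>x y. satM M p ((\<lambda>i. ap (f i) x)(i := y))"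
  have "D {M} M (\<lambda>N e. satM N p (\<lambda>j. (if j = i then (\<lambda>N e. e 0) else (\<lambda>N e. ap (f j) (etl e 0))) N e))"
    by (rule D_sat) (auto intro!: DF_ap DF_const FnD All.prems DF_vars)
  moreover have "(\<lambda>j. (if j = i then (\<lambda>N e. e 0) else (\<lambda>N e. ap (f j) (etl e 0))) N e) = (\<lambda>i. ap (f i) (etl e 0))(i := e 0)" for N :: "'v set" and e
    by auto
  ultimately have "D {M} M (\<lambda>N e. satM N p ((\<lambda>i. ap (f i) (etl e 0))(i := e 0)))" by simp
  then have DB: "D {M} M (\<lambda>N e. ?B (etl e 0) (e 0))"
    by (rule D_cong[rotated]) (auto dest: valid_single)
  show ?case
  proof
    assume L: "satM (Ult M Z) (All i p) (\<lambda>i. cl (f i))"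
    have "ae ?A"
    proof (rule ccontr)
      assume "\<not> ae ?A"
      then have n: "ae (\<lambda>x. \<not> ?A x)" using ae_not[OF DA] by blast
      have "D {M} M (\<lambda>N e. \<not> ?A (etl e 0) \<longrightarrow> \<not> ?B (etl e 0) (e 0))"
        by (intro D_imp D_not D1[OF DA] DB DF_vars)
      moreover have "\<exists>y\<in>M. \<not> ?A x \<longrightarrow> \<not> ?B x y" if "x \<in> elts X" for x
        using X_in by blast
      ultimately obtain g where g: "g \<in> M" "function_on X g" "\<forall>x\<in>elts X. \<not> ?A x \<longrightarrow> \<not> ?B x (app g x)"
        using uniformization[OF inner X_in, of "\<lambda>x y. \<not> ?A x \<longrightarrow> \<not> ?B x y"] by blast
      then have gF: "g \<in> Fn" by (simp add: Fn_def)
      have "cl g \<in> Ult M Z" using gF by (auto simp: Ult_iff)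
      then have "ae (\<lambda>x. ?B x (ap g x))" using L IH[OF gF] by simp
      with n have "ae (\<lambda>x. ?B x (ap g x) \<and> \<not> ?A x)" unfolding ae_conj by blast
      then show False using ae_ex g(3) Fn_ap[OF gF] by fastforce
    qed
    then show "ae (\<lambda>x. satM M (All i p) (\<lambda>i. ap (f i) x))" by simp
  next
    assume "ae (\<lambda>x. satM M (All i p) (\<lambda>i. ap (f i) x))"
    then have A: "ae ?A" by simp
    have "ae (\<lambda>x. ?B x (ap g x))" if "g \<in> Fn" for g
      by (rule ae_mono[OF A]) (use ap_in[OF FnD(1)[OF that]] XM in blast)
    then show "satM (Ult M Z) (All i p) (\<lambda>i. cl (f i))" using IH Ult_iff by auto
  qed
qed (simp_all add: cl_mem cl_eq)

end

subsection \<open>The ultrapower is an inner model\<close>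

definition "fEx i p = Neg (All i (Neg p))"
definition "fImp p q = Neg (Conj p (Neg q))"
definition "fOr p q = Neg (Conj (Neg p) (Neg q))"
definition "fIff p q = Conj (fImp p q) (fImp q p)"

lemma satM_derived[simp]:
  "satM M (fEx i p) e \<longleftrightarrow> (\<exists>x\<in>M. satM M p (e(i := x)))"
  "satM M (fImp p q) e \<longleftrightarrow> (satM M p e \<longrightarrow> satM M q e)"
  "satM M (fOr p q) e \<longleftrightarrow> satM M p e \<or> satM M q e"
  "satM M (fIff p q) e \<longleftrightarrow> (satM M p e \<longleftrightarrow> satM M q e)"
  by (auto simp: fEx_def fImp_def fOr_def fIff_def)

text \<open>The axioms of \<open>inner\<close> as formulas, with the given sets in the lowest
  variables, so that Los's theorem can carry them to the ultrapower.\<close>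

definition "pair_fm = fEx 2 (All 3 (fIff (Mem 3 2) (fOr (Eq 3 0) (Eq 3 1))))"
definition "union_fm = fEx 2 (All 3 (fIff (Mem 3 2) (fEx 4 (Conj (Mem 4 0) (Mem 3 4)))))"
definition "power_fm = fEx 2 (All 3 (fIff (Mem 3 2) (All 4 (fImp (Mem 4 3) (Mem 4 0)))))"
definition "infinity_fm = fEx 2 (Conj (fEx 3 (Conj (Mem 3 2) (All 4 (Neg (Mem 4 3)))))
  (All 3 (fImp (Mem 3 2) (fEx 4 (Conj (Mem 4 2) (All 5 (fIff (Mem 5 4) (fOr (Eq 5 3) (Mem 5 3)))))))))"
definition "choice_fm = fImp (Conj (All 1 (fImp (Mem 1 0) (fEx 2 (Mem 2 1))))
    (All 1 (fImp (Mem 1 0) (All 2 (fImp (Mem 2 0) (fImp (Neg (Eq 1 2)) (All 3 (Neg (Conj (Mem 3 1) (Mem 3 2)))))))))) 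
  (fEx 4 (All 1 (fImp (Mem 1 0) (fEx 2 (Conj (Conj (Mem 2 4) (Mem 2 1))
    (All 3 (fImp (Conj (Mem 3 4) (Mem 3 1)) (Eq 3 2))))))))"
text \<open>For a bound \<open>n > 1\<close> on the variables of \<open>p\<close>, variable
  \<open>n\<close> holds the given set and \<open>Suc n\<close> the set to be formed; neither
  interferes with \<open>p\<close> or with the variables 0 and 1.\<close>

definition "separation_fm p n = fEx (Suc n) (All 0 (fIff (Mem 0 (Suc n)) (Conj (Mem 0 n) p)))"
definition "replacement_fm p n = fImp (All 0 (fImp (Mem 0 n) (fEx (Suc n) (All 1 (fIff p (Eq 1 (Suc n)))))))
  (fEx (Suc n) (All 1 (fIff (Mem 1 (Suc n)) (fEx 0 (Conj (Mem 0 n) p)))))"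

lemma vars_bound: "\<exists>n. (\<forall>i\<in>vars p. i < n) \<and> 1 < n"
proof -
  obtain n where "\<forall>i\<in>vars p. i < n" using finite_vars[of p] finite_nat_set_iff_bounded by blast
  then show ?thesis by (intro exI[of _ "Suc (Suc n)"]) auto
qed

context
  fixes N :: "'v::zfc set"
  assumes trN: "\<forall>x\<in>N. elts x \<subseteq> N"
begin

lemma tr: "x \<in> N \<Longrightarrow> y \<in> elts x \<Longrightarrow> y \<in> N"
  using trN by blast

lemma rel_eq: "z \<in> N \<Longrightarrow> (\<And>w. w \<in> A \<Longrightarrow> w \<in> N) \<Longrightarrow> elts z = A \<longleftrightarrow> (\<forall>w\<in>N. w \<in> elts z \<longleftrightarrow> w \<in> A)"
  using tr by blast

lemma ex_set_iff:
  assumes "\<And>w. w \<in> A \<Longrightarrow> w \<in> N" "\<And>w. w \<in> N \<Longrightarrow> P w \<longleftrightarrow> w \<in> A"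
  shows "(\<exists>z\<in>N. \<forall>w\<in>N. w \<in> elts z \<longleftrightarrow> P w) \<longleftrightarrow> (\<exists>z\<in>N. elts z = A)"
proof (rule bex_cong[OF refl])
  fix z assume "z \<in> N"
  from rel_eq[OF this assms(1)] show "(\<forall>w\<in>N. w \<in> elts z \<longleftrightarrow> P w) \<longleftrightarrow> elts z = A" using assms(2) by simp
qed

lemma tr_mem: "\<forall>i. e i \<in> N \<Longrightarrow> y \<in> elts (e i) \<Longrightarrow> y \<in> N"
  using tr by blast

lemma pair_fm: "\<forall>i. e i \<in> N \<Longrightarrow> satM N pair_fm e \<longleftrightarrow> (\<exists>z\<in>N. elts z = {e 0, e 1})"
  unfolding pair_fm_def by (simp, rule ex_set_iff) auto

lemma union_fm: "\<forall>i. e i \<in> N \<Longrightarrow> satM N union_fm e \<longleftrightarrow> (\<exists>z\<in>N. elts z = (\<Union>y\<in>elts (e 0). elts y))"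
  unfolding union_fm_def by (simp, rule ex_set_iff) (auto dest: tr_mem intro: tr)

lemma power_fm: "\<forall>i. e i \<in> N \<Longrightarrow> satM N power_fm e \<longleftrightarrow> (\<exists>z\<in>N. elts z = {y\<in>N. elts y \<subseteq> elts (e 0)})"
  unfolding power_fm_def by (simp, rule ex_set_iff) (auto intro: tr)

lemma infinity_fm: "satM N infinity_fm e \<longleftrightarrow> (\<exists>z\<in>N. (\<exists>x\<in>elts z. elts x = {}) \<and>
    (\<forall>x\<in>elts z. \<exists>y\<in>elts z. elts y = insert x (elts x)))"
proof -
  have 1: "elts x = {} \<longleftrightarrow> (\<forall>w\<in>N. w \<notin> elts x)" if "x \<in> N" for x using tr[OF that] by blast
  have 2: "elts y = insert x (elts x) \<longleftrightarrow> (\<forall>w\<in>N. w \<in> elts y \<longleftrightarrow> w = x \<or> w \<in> elts x)" if "x \<in> N" "y \<in> N" for x y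
    using that tr[OF that(1)] by (subst rel_eq) auto
  have b: "(\<forall>x\<in>elts z. P x) \<longleftrightarrow> (\<forall>x\<in>N. x \<in> elts z \<longrightarrow> P x)"
    "(\<exists>x\<in>elts z. P x) \<longleftrightarrow> (\<exists>x\<in>N. x \<in> elts z \<and> P x)" if "z \<in> N" for z P using tr[OF that] by blast+
  show ?thesis unfolding infinity_fm_def by (simp add: b 1 2 cong: bex_cong ball_cong conj_cong)
qed

lemma choice_fm: "\<forall>i. e i \<in> N \<Longrightarrow> satM N choice_fm e \<longleftrightarrow> ((\<forall>x\<in>elts (e 0). elts x \<noteq> {}) \<longrightarrow>
    (\<forall>x\<in>elts (e 0). \<forall>y\<in>elts (e 0). x \<noteq> y \<longrightarrow> elts x \<inter> elts y = {}) \<longrightarrow>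
    (\<exists>c\<in>N. \<forall>x\<in>elts (e 0). \<exists>!y. y \<in> elts c \<inter> elts x))"
proof -
  assume e: "\<forall>i. e i \<in> N"
  have 1: "elts x \<noteq> {} \<longleftrightarrow> (\<exists>w\<in>N. w \<in> elts x)" if "x \<in> N" for x using tr[OF that] by blast
  have 2: "elts x \<inter> elts y = {} \<longleftrightarrow> (\<forall>w\<in>N. \<not> (w \<in> elts x \<and> w \<in> elts y))" if "x \<in> N" for x y using tr[OF that] by blast
  have 3: "(\<exists>!y. y \<in> elts c \<inter> elts x) \<longleftrightarrow> (\<exists>y\<in>N. (y \<in> elts c \<and> y \<in> elts x) \<and> (\<forall>w\<in>N. w \<in> elts c \<and> w \<in> elts x \<longrightarrow> w = y))"
    if "x \<in> N" for x c using tr[OF that] by blast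
  have b: "(\<forall>x\<in>elts (e 0). P x) \<longleftrightarrow> (\<forall>x\<in>N. x \<in> elts (e 0) \<longrightarrow> P x)" for P using tr_mem[OF e] by blast
  have A: "(\<forall>x\<in>elts (e 0). elts x \<noteq> {}) \<longleftrightarrow> (\<forall>x\<in>N. x \<in> elts (e 0) \<longrightarrow> (\<exists>w\<in>N. w \<in> elts x))"
    unfolding b by (intro ball_cong refl imp_cong 1)
  have B: "(\<forall>x\<in>elts (e 0). \<forall>y\<in>elts (e 0). x \<noteq> y \<longrightarrow> elts x \<inter> elts y = {}) \<longleftrightarrow>
    (\<forall>x\<in>N. x \<in> elts (e 0) \<longrightarrow> (\<forall>y\<in>N. y \<in> elts (e 0) \<longrightarrow> x \<noteq> y \<longrightarrow> (\<forall>w\<in>N. \<not> (w \<in> elts x \<and> w \<in> elts y))))"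
    unfolding b by (intro ball_cong refl imp_cong 2)
  have C: "(\<forall>x\<in>elts (e 0). \<exists>!y. y \<in> elts c \<inter> elts x) \<longleftrightarrow> (\<forall>x\<in>N. x \<in> elts (e 0) \<longrightarrow>
    (\<exists>y\<in>N. (y \<in> elts c \<and> y \<in> elts x) \<and> (\<forall>w\<in>N. w \<in> elts c \<and> w \<in> elts x \<longrightarrow> w = y)))" for c
    unfolding b by (intro ball_cong refl imp_cong 3)
  have "satM N choice_fm e \<longleftrightarrow> ((\<forall>x\<in>N. x \<in> elts (e 0) \<longrightarrow> (\<exists>w\<in>N. w \<in> elts x)) \<and>
    (\<forall>x\<in>N. x \<in> elts (e 0) \<longrightarrow> (\<forall>y\<in>N. y \<in> elts (e 0) \<longrightarrow> x \<noteq> y \<longrightarrow> (\<forall>w\<in>N. \<not> (w \<in> elts x \<and> w \<in> elts y)))) \<longrightarrow>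
    (\<exists>c\<in>N. \<forall>x\<in>N. x \<in> elts (e 0) \<longrightarrow>
      (\<exists>y\<in>N. (y \<in> elts c \<and> y \<in> elts x) \<and> (\<forall>w\<in>N. w \<in> elts c \<and> w \<in> elts x \<longrightarrow> w = y))))"
    by (simp only: choice_fm_def satM.simps satM_derived fun_upd_apply one_eq_numeral_iff numeral_eq_one_iff
        numeral_eq_iff num.distinct num.inject zero_neq_numeral numeral_neq_zero zero_neq_one one_neq_zero
        if_True if_False refl)
  then show ?thesis unfolding A B C by (simp only: imp_conjL)
qed

lemma separation_fm:
  assumes n: "\<forall>i\<in>vars p. i < n" "1 < n" and e: "\<forall>i. e i \<in> N"
  shows "satM N (separation_fm p n) e \<longleftrightarrow> (\<exists>z\<in>N. elts z = {x\<in>elts (e n). satM N p (e(0 := x))})"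
proof -
  have "satM N p ((e(Suc n := z))(0 := x)) = satM N p (e(0 := x))" for x z
    by (rule satM_cong) (use n in auto)
  moreover have "elts z = {x\<in>elts (e n). satM N p (e(0 := x))} \<longleftrightarrow>
     (\<forall>w\<in>N. w \<in> elts z \<longleftrightarrow> w \<in> elts (e n) \<and> satM N p (e(0 := w)))" if "z \<in> N" for z
    using that tr_mem[OF e] by (subst rel_eq) auto
  ultimately show ?thesis unfolding separation_fm_def using n by (simp cong: bex_cong)
qed

lemma replacement_fm:
  assumes n: "\<forall>i\<in>vars p. i < n" "1 < n" and e: "\<forall>i. e i \<in> N"
  shows "satM N (replacement_fm p n) e \<longleftrightarrow> ((\<forall>x\<in>elts (e n). \<exists>!y. y \<in> N \<and> satM N p (e(0 := x, 1 := y))) \<longrightarrow>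
    (\<exists>z\<in>N. elts z = {y\<in>N. \<exists>x\<in>elts (e n). satM N p (e(0 := x, 1 := y))}))"
proof -
  have 1: "satM N p ((e(0 := x, Suc n := z, Suc 0 := y))) = satM N p (e(0 := x, Suc 0 := y))" for x y z
    by (rule satM_cong) (use n in auto)
  have 2: "satM N p ((e(Suc n := z, Suc 0 := y, 0 := x))) = satM N p (e(0 := x, Suc 0 := y))" for x y z
    by (rule satM_cong) (use n in auto)
  have 3: "elts z = {y\<in>N. \<exists>x\<in>elts (e n). satM N p (e(0 := x, 1 := y))} \<longleftrightarrow>
     (\<forall>y\<in>N. y \<in> elts z \<longleftrightarrow> (\<exists>x\<in>N. x \<in> elts (e n) \<and> satM N p (e(0 := x, 1 := y))))" if "z \<in> N" for z
    using that by (subst rel_eq) (auto intro: tr_mem[OF e])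
  have 4: "(\<forall>x\<in>elts (e n). P x) \<longleftrightarrow> (\<forall>x\<in>N. x \<in> elts (e n) \<longrightarrow> P x)" for P using tr_mem[OF e] by blast
  have 5: "(\<exists>!y. y \<in> N \<and> Q y) \<longleftrightarrow> (\<exists>z\<in>N. \<forall>y\<in>N. Q y \<longleftrightarrow> y = z)" for Q
  proof
    assume "\<exists>!y. y \<in> N \<and> Q y"
    then obtain y where "y \<in> N" "Q y" "\<forall>z. z \<in> N \<and> Q z \<longrightarrow> z = y" by (elim ex1E conjE)
    then show "\<exists>z\<in>N. \<forall>y\<in>N. Q y \<longleftrightarrow> y = z" by (intro bexI[of _ y] ballI iffI) blast+
  next
    assume "\<exists>z\<in>N. \<forall>y\<in>N. Q y \<longleftrightarrow> y = z"
    then obtain z where "z \<in> N" "\<forall>y\<in>N. Q y \<longleftrightarrow> y = z" by (elim bexE)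
    then show "\<exists>!y. y \<in> N \<and> Q y" by (intro ex1I[of _ z]) blast+
  qed
  show ?thesis unfolding replacement_fm_def 4 5 using n
    by (simp add: 1 2 3[simplified] cong: bex_cong)
qed

text \<open>For a transitive class the remaining clauses of \<open>inner\<close> become formulas
  evaluated at all assignments into the class, the shape to which Los's theorem applies. The element
  \<open>c\<close> provides an assignment at which the sentence \<open>infinity_fm\<close> can be
  read off.\<close>

lemma inner_iff:
  assumes ne: "c \<in> N"
  shows "inner N \<longleftrightarrow> (\<forall>e. (\<forall>i. e i \<in> N) \<longrightarrow> satM N pair_fm e \<and> satM N union_fm e \<and> satM N power_fm e \<and>
    satM N infinity_fm e \<and> satM N choice_fm e \<and>
    (\<forall>p n. (\<forall>i\<in>vars p. i < n) \<and> 1 < n \<longrightarrow> satM N (separation_fm p n) e \<and> satM N (replacement_fm p n) e))"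
    (is "_ \<longleftrightarrow> ?R")
proof
  assume i: "inner N"
  show ?R
  proof (intro allI impI conjI)
    fix e :: "nat \<Rightarrow> 'v" assume e: "\<forall>i. e i \<in> N"
    show "satM N pair_fm e" unfolding pair_fm[OF e] using inner_pair[OF i] e by blast
    show "satM N union_fm e" unfolding union_fm[OF e] by (rule inner_Union[OF i]) (use e in blast)
    show "satM N power_fm e" unfolding power_fm[OF e] by (rule inner_Pow[OF i]) (use e in blast)
    show "satM N infinity_fm e" unfolding infinity_fm by (rule inner_infinity[OF i])
    show "satM N choice_fm e" unfolding choice_fm[OF e] by (intro impI inner_choice[OF i]) (use e in auto)
    fix p n assume n: "(\<forall>i\<in>vars p. i < n) \<and> 1 < n"
    show "satM N (separation_fm p n) e"
      unfolding separation_fm[OF conjunct1[OF n] conjunct2[OF n] e]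
      by (rule inner_separation[OF i]) (use e in auto)
    show "satM N (replacement_fm p n) e"
      unfolding replacement_fm[OF conjunct1[OF n] conjunct2[OF n] e]
      by (intro impI inner_replacement[OF i]) (use e in auto)
  qed
next
  assume R: ?R
  show "inner N" unfolding inner_def
  proof (intro conjI)
    show "\<forall>x\<in>N. elts x \<subseteq> N" using tr by blast
    show "\<forall>x\<in>N. \<forall>y\<in>N. \<exists>z\<in>N. elts z = {x, y}"
    proof (intro ballI)
      fix x y assume "x \<in> N" "y \<in> N"
      then have e: "\<forall>i. (if i = 0 then x else y) \<in> N" by auto
      show "\<exists>z\<in>N. elts z = {x, y}" using pair_fm[OF e] R e by fastforce
    qed
    show "\<forall>x\<in>N. \<exists>z\<in>N. elts z = (\<Union>y\<in>elts x. elts y)"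
    proof
      fix x assume "x \<in> N"
      then have e: "\<forall>i. (\<lambda>_. x) i \<in> N" by auto
      show "\<exists>z\<in>N. elts z = (\<Union>y\<in>elts x. elts y)" using union_fm[OF e] R e by fastforce
    qed
    show "\<forall>x\<in>N. \<exists>z\<in>N. elts z = {y\<in>N. elts y \<subseteq> elts x}"
    proof
      fix x assume "x \<in> N"
      then have e: "\<forall>i. (\<lambda>_. x) i \<in> N" by auto
      show "\<exists>z\<in>N. elts z = {y\<in>N. elts y \<subseteq> elts x}" using power_fm[OF e] R e by fastforce
    qed
    have e: "\<forall>i. (\<lambda>_. c) i \<in> N" using ne by auto
    show "\<exists>z\<in>N. (\<exists>x\<in>elts z. elts x = {}) \<and> (\<forall>x\<in>elts z. \<exists>y\<in>elts z. elts y = insert x (elts x))"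
    proof -
      have "satM N infinity_fm (\<lambda>_. c)" using R[THEN spec, of "\<lambda>_. c"] ne by blast
      then show ?thesis unfolding infinity_fm .
    qed
    show "\<forall>a\<in>N. (\<forall>x\<in>elts a. elts x \<noteq> {}) \<longrightarrow>
         (\<forall>x\<in>elts a. \<forall>y\<in>elts a. x \<noteq> y \<longrightarrow> elts x \<inter> elts y = {}) \<longrightarrow>
         (\<exists>c\<in>N. \<forall>x\<in>elts a. \<exists>!y. y \<in> elts c \<inter> elts x)"
    proof
      fix x assume "x \<in> N"
      then have e: "\<forall>i. (\<lambda>_. x) i \<in> N" by auto
      have "satM N choice_fm (\<lambda>_. x)" using R[THEN spec, of "\<lambda>_. x"] \<open>x \<in> N\<close> by blast
      from this[unfolded choice_fm[OF e]] show "(\<forall>y\<in>elts x. elts y \<noteq> {}) \<longrightarrow>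
         (\<forall>z\<in>elts x. \<forall>y\<in>elts x. z \<noteq> y \<longrightarrow> elts z \<inter> elts y = {}) \<longrightarrow>
         (\<exists>c\<in>N. \<forall>z\<in>elts x. \<exists>!y. y \<in> elts c \<inter> elts z)" .
    qed
    have upd: "satM N p ((e(n := a))(0 := x)) = satM N p (e(0 := x))" 
      "satM N p ((e(n := a))(0 := x, 1 := y)) = satM N p (e(0 := x, 1 := y))" if "\<forall>i\<in>vars p. i < n" for p e n a x y
      by (rule satM_cong, insert that, force)+
    show "\<forall>p e. \<forall>a\<in>N. (\<forall>i. e i \<in> N) \<longrightarrow> (\<exists>z\<in>N. elts z = {x \<in> elts a. satM N p (e(0 := x))})"
    proof (intro allI ballI impI)
      fix p a and e :: "nat \<Rightarrow> 'v" assume a: "a \<in> N" "\<forall>i. e i \<in> N"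
      obtain n where n: "\<forall>i\<in>vars p. i < n" "1 < n" using vars_bound by blast
      have e: "\<forall>i. (e(n := a)) i \<in> N" using a by auto
      have "satM N (separation_fm p n) (e(n := a))" using R e n by blast
      from this[unfolded separation_fm[OF n e] upd(1)[OF n(1)]]
      show "\<exists>z\<in>N. elts z = {x \<in> elts a. satM N p (e(0 := x))}" by simp
    qed
    show "\<forall>p e. \<forall>a\<in>N. (\<forall>i. e i \<in> N) \<longrightarrow> (\<forall>x\<in>elts a. \<exists>!y. y \<in> N \<and> satM N p (e(0 := x, 1 := y))) \<longrightarrow>
         (\<exists>z\<in>N. elts z = {y\<in>N. \<exists>x\<in>elts a. satM N p (e(0 := x, 1 := y))})"
    proof (intro allI ballI impI)
      fix p a and e :: "nat \<Rightarrow> 'v" assume a: "a \<in> N" "\<forall>i. e i \<in> N"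
        and ex: "\<forall>x\<in>elts a. \<exists>!y. y \<in> N \<and> satM N p (e(0 := x, 1 := y))"
      obtain n where n: "\<forall>i\<in>vars p. i < n" "1 < n" using vars_bound by blast
      have e: "\<forall>i. (e(n := a)) i \<in> N" using a by auto
      have "satM N (replacement_fm p n) (e(n := a))" using R e n by blast
      from this[unfolded replacement_fm[OF n e] upd(2)[OF n(1)]] ex
      show "\<exists>z\<in>N. elts z = {y\<in>N. \<exists>x\<in>elts a. satM N p (e(0 := x, 1 := y))}" by simp
    qed
  qed
qed

end

text \<open>Terms are substituted for all variables at once, so that a notion shown definable with
  its arguments in fixed positions can be used with arbitrary terms.\<close>

lemma D_substs:
  assumes D: "D C K \<Phi>" and s: "\<And>i. DF C K (s i)"
  shows "D C K (\<lambda>M e. \<Phi> M (\<lambda>i. s i M e))"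
proof -
  obtain p c where p: "\<forall>j. Suc (2 * j) \<in> vars p \<longrightarrow> c j \<in> K"
    "\<forall>M e. valid C K M e \<longrightarrow> (\<Phi> M e \<longleftrightarrow> satM M p (mrg c e))" using D unfolding D_def by metis
  define t where "t n = (if even n then s (n div 2) else if c (n div 2) \<in> K then (\<lambda>M e. c (n div 2)) else (\<lambda>M e. e 0))" for n
  have "DF C K (t n)" for n unfolding t_def by (auto intro: s DF_const DF_vars)
  then have "D C K (\<lambda>M e. satM M p (\<lambda>i. t i M e))" by (rule D_sat)
  moreover have "\<Phi> M (\<lambda>i. s i M e) = satM M p (\<lambda>i. t i M e)" if v: "valid C K M e" for M e
  proof -
    have "valid C K M (\<lambda>i. s i M e)" using v DF_in[OF s v] by (simp add: valid_def)
    then have "\<Phi> M (\<lambda>i. s i M e) = satM M p (mrg c (\<lambda>i. s i M e))" using p(2) by blast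
    also have "\<dots> = satM M p (\<lambda>i. t i M e)"
      by (rule satM_cong[symmetric]) (use p(1) in \<open>auto simp: mrg_def t_def elim!: oddE\<close>)
    finally show ?thesis .
  qed
  ultimately show ?thesis by (rule D_cong[rotated])
qed

lemma DF_substs:
  assumes D: "DF C K t" and s: "\<And>i. DF C K (s i)"
  shows "DF C K (\<lambda>M e. t M (\<lambda>i. s i M e))"
  unfolding DF_def
proof (intro conjI allI impI)
  fix M e assume v: "valid C K M e"
  then have "valid C K M (\<lambda>i. s i M e)" using DF_in[OF s v] by (simp add: valid_def)
  then show "t M (\<lambda>i. s i M e) \<in> M" by (rule DF_in[OF D])
next
  have "D C K (\<lambda>M e. \<Phi> M (\<lambda>i. (case i of 0 \<Rightarrow> (\<lambda>M e. e 0) | Suc j \<Rightarrow> (\<lambda>M e. s j M (etl e))) M e))"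
    if "D C K \<Phi>" for \<Phi>
    by (rule D_substs[OF that]) (auto split: nat.split intro: DF_vars DF_tl s)
  from this[OF D[unfolded DF_def, THEN conjunct2]]
  show "D C K (\<lambda>M e. e 0 = t M (\<lambda>i. s i M (etl e)))" by (simp add: etl_def)
qed

text \<open>Uniform definitions without parameters are the ones that transfer to ultrapowers. This
  makes them available again over a single model with parameters.\<close>

lemma D_weaken:
  assumes "D UNIV {} \<Phi>"
  shows "D C K \<Phi>"
proof -
  obtain p c where "\<forall>j. Suc (2 * j) \<notin> vars p" "\<forall>M e. valid UNIV {} M e \<longrightarrow> (\<Phi> M e \<longleftrightarrow> satM M p (mrg c e))"
    using assms unfolding D_def by auto
  then show ?thesis unfolding D_def by (intro exI[of _ p] exI[of _ c]) (auto simp: valid_def)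
qed

lemma DF_weaken: "DF UNIV {} t \<Longrightarrow> DF C K t"
  unfolding DF_def using D_weaken by (auto simp: valid_def)

context ultrapower begin

lemma ap_const_id:
  "c \<in> M \<Longrightarrow> lam X (\<lambda>_. c) \<in> Fn" "c \<in> M \<Longrightarrow> x \<in> elts X \<Longrightarrow> ap (lam X (\<lambda>_. c)) x = c"
  "lam X (\<lambda>x. x) \<in> Fn" "x \<in> elts X \<Longrightarrow> ap (lam X (\<lambda>x. x)) x = x"
proof -
  show "lam X (\<lambda>_. c) \<in> Fn" if "c \<in> M" by (rule lam_Fn, rule DF_const[OF that])
  show "ap (lam X (\<lambda>_. c)) x = c" if "c \<in> M" "x \<in> elts X" by (rule lam_Fn(2)[OF _ that(2)], rule DF_const[OF that(1)])
  show "lam X (\<lambda>x. x) \<in> Fn" by (rule lam_Fn, rule DF_vars)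
  show "ap (lam X (\<lambda>x. x)) x = x" if "x \<in> elts X" by (rule lam_Fn(2)[OF _ that], rule DF_vars)
qed

lemma inner_Ult: "inner (Ult M Z)"
proof -
  obtain c where c: "c \<in> M" using X_in by blast
  have tr: "\<forall>x\<in>Ult M Z. elts x \<subseteq> Ult M Z" using Ult_transitive by blast
  have c': "cl (lam X (\<lambda>_. c)) \<in> Ult M Z" using ap_const_id(1)[OF c] by (auto simp: Ult_iff)
  have L: "satM (Ult M Z) p e" if p: "\<And>e. \<forall>i. e i \<in> M \<Longrightarrow> satM M p e" and e: "\<forall>i. e i \<in> Ult M Z" for p e
  proof -
    have "\<forall>i. \<exists>f\<in>Fn. e i = cl f" using e Ult_iff by simp
    then obtain f where f: "\<And>i. f i \<in> Fn" "\<And>i. e i = cl (f i)" by metis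
    have "e = (\<lambda>i. cl (f i))" using f(2) by auto
    moreover have "ae (\<lambda>x. satM M p (\<lambda>i. ap (f i) x))"
      by (rule ae_all, rule p) (use ap_in FnD f XM in blast)
    ultimately show ?thesis using Los[of f p, OF f(1)] by simp
  qed
  have R: "\<forall>e. (\<forall>i. e i \<in> M) \<longrightarrow> satM M pair_fm e \<and> satM M union_fm e \<and> satM M power_fm e \<and>
    satM M infinity_fm e \<and> satM M choice_fm e \<and>
    (\<forall>p n. (\<forall>i\<in>vars p. i < n) \<and> 1 < n \<longrightarrow> satM M (separation_fm p n) e \<and> satM M (replacement_fm p n) e)"
  proof -
    have "\<forall>x\<in>M. elts x \<subseteq> M" using innerD[OF inner] by blast
    from inner_iff[OF this c] inner show ?thesis by blast
  qed
  show ?thesis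
    unfolding inner_iff[OF tr c']
    by (intro allI impI conjI; rule L; (use R in blast))
qed

text \<open>The predicate takes the class as an argument and is evaluated at \<open>Ult M Z\<close>
  on one side and at \<open>M\<close> on the other. That the same parameter-free formula defines it
  in both is what \<open>D UNIV {}\<close> provides.\<close>

lemma transfer:
  assumes D: "D UNIV {} \<Phi>" and f: "\<And>i. f i \<in> Fn"
  shows "\<Phi> (Ult M Z) (\<lambda>i. cl (f i)) \<longleftrightarrow> ae (\<lambda>x. \<Phi> M (\<lambda>i. ap (f i) x))"
proof -
  obtain p c where p: "\<forall>j. Suc (2 * j) \<notin> vars p" "\<forall>M e. valid UNIV {} M e \<longrightarrow> (\<Phi> M e \<longleftrightarrow> satM M p (mrg c e))"
    using D unfolding D_def by auto
  \<comment> \<open>Without parameters no odd variable occurs, so variable \<open>i\<close> can be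
    read as position \<open>i div 2\<close> of the environment.\<close>
  have s: "satM N p (mrg c e) = satM N p (\<lambda>i. e (i div 2))" for N :: "'v set" and e
    by (rule satM_cong[symmetric]) (use p(1) in \<open>auto simp: mrg_def elim!: oddE\<close>)
  have "cl (f i) \<in> Ult M Z" for i using f by (auto simp: Ult_iff)
  then have "valid UNIV {} (Ult M Z) (\<lambda>i. cl (f i))" by (simp add: valid_def inner_Ult)
  then have "\<Phi> (Ult M Z) (\<lambda>i. cl (f i)) \<longleftrightarrow> ae (\<lambda>x. satM M p (\<lambda>i. ap (f (i div 2)) x))"
    using p(2) s Los[of "\<lambda>i. f (i div 2)", OF f] by simp
  also have "\<dots> \<longleftrightarrow> ae (\<lambda>x. \<Phi> M (\<lambda>i. ap (f i) x))"
  proof (rule ae_cong)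
    fix x assume "x \<in> elts X"
    then have "valid UNIV {} M (\<lambda>i. ap (f i) x)" using ap_in[OF FnD(1)[OF f]] XM by (simp add: valid_def inner)
    then show "satM M p (\<lambda>i. ap (f (i div 2)) x) = \<Phi> M (\<lambda>i. ap (f i) x)" using p(2) s by simp
  qed
  finally show ?thesis .
qed

lemma transfer_F:
  assumes D: "DF UNIV {} t" and f: "\<And>i. f i \<in> Fn"
  shows "t (Ult M Z) (\<lambda>i. cl (f i)) = cl (lam X (\<lambda>x. t M (\<lambda>i. ap (f i) x)))"
    "lam X (\<lambda>x. t M (\<lambda>i. ap (f i) x)) \<in> Fn"
    "x \<in> elts X \<Longrightarrow> ap (lam X (\<lambda>x. t M (\<lambda>i. ap (f i) x))) x = t M (\<lambda>i. ap (f i) x)"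
proof -
  have "DF {M} M (\<lambda>N e. t N (\<lambda>i. ap (f i) (e 0)))"
    by (rule DF_substs[OF DF_weaken[OF D]]) (rule FnD f D_intros)+
  then have DF: "DF {M} M (\<lambda>N e. t M (\<lambda>i. ap (f i) (e 0)))"
    by (rule DF_cong[rotated]) (auto dest: valid_single)
  let ?l = "lam X (\<lambda>x. t M (\<lambda>i. ap (f i) x))"
  show l: "?l \<in> Fn" "x \<in> elts X \<Longrightarrow> ap ?l x = t M (\<lambda>i. ap (f i) x)" for x
    using lam_Fn[OF DF] by auto
  let ?g = "\<lambda>i. case i of 0 \<Rightarrow> ?l | Suc j \<Rightarrow> f j"
  have "cl (?g 0) = t (Ult M Z) (etl (\<lambda>i. cl (?g i))) \<longleftrightarrow> ae (\<lambda>x. ap (?g 0) x = t M (etl (\<lambda>i. ap (?g i) x)))"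
    by (rule transfer[OF D[unfolded DF_def, THEN conjunct2], of ?g]) (use l f in \<open>auto split: nat.split\<close>)
  moreover have "ae (\<lambda>x. ap ?l x = t M (\<lambda>i. ap (f i) x))" by (rule ae_all) (rule l)
  ultimately show "t (Ult M Z) (\<lambda>i. cl (f i)) = cl ?l" by (simp add: etl_def)
qed

end

section \<open>The ultrapower embedding and its seed\<close>

context ultrapower begin

lemma transfer1:
  assumes "D UNIV {} (\<lambda>M e. P M (e 0))" "f \<in> Fn"
  shows "P (Ult M Z) (cl f) \<longleftrightarrow> ae (\<lambda>x. P M (ap f x))"
  using transfer[OF assms(1), of "\<lambda>_. f"] assms(2) by simp

lemma transfer2:
  assumes "D UNIV {} (\<lambda>M e. P M (e 0) (etl e 0))" "f \<in> Fn" "g \<in> Fn"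
  shows "P (Ult M Z) (cl f) (cl g) \<longleftrightarrow> ae (\<lambda>x. P M (ap f x) (ap g x))"
  using transfer[OF assms(1), of "\<lambda>i. if i = 0 then f else g"] assms(2,3) by (simp add: etl_def)

lemma transfer_F1:
  assumes "DF UNIV {} (\<lambda>M e. F M (e 0))" "f \<in> Fn"
  shows "F (Ult M Z) (cl f) = cl (lam X (\<lambda>x. F M (ap f x)))"
    "lam X (\<lambda>x. F M (ap f x)) \<in> Fn"
    "x \<in> elts X \<Longrightarrow> ap (lam X (\<lambda>x. F M (ap f x))) x = F M (ap f x)"
  using transfer_F[OF assms(1), of "\<lambda>_. f"] assms(2) by simp_all

lemma transfer_F2:
  assumes "DF UNIV {} (\<lambda>M e. F M (e 0) (etl e 0))" "f \<in> Fn" "g \<in> Fn"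
  shows "F (Ult M Z) (cl f) (cl g) = cl (lam X (\<lambda>x. F M (ap f x) (ap g x)))"
    "lam X (\<lambda>x. F M (ap f x) (ap g x)) \<in> Fn"
    "x \<in> elts X \<Longrightarrow> ap (lam X (\<lambda>x. F M (ap f x) (ap g x))) x = F M (ap f x) (ap g x)"
  using transfer_F[OF assms(1), of "\<lambda>i. if i = 0 then f else g"] assms(2,3) by (simp_all add: etl_def)

abbreviation j :: "'v \<Rightarrow> 'v" where "j \<equiv> ult_emb M Z"
abbreviation seed :: 'v where "seed \<equiv> ult_id M Z"
abbreviation const :: "'v \<Rightarrow> 'v" where "const c \<equiv> lam X (\<lambda>_. c)"

lemma j_cl: "j c = cl (const c)"
  by (simp add: ult_emb_def)

lemma seed_cl: "seed = cl (lam X (\<lambda>x. x))"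
  by (simp add: ult_id_def)

lemma ae_const: "ae (\<lambda>x. P) \<longleftrightarrow> P"
proof
  assume "ae (\<lambda>x. P)"
  from ae_ex[OF this] show P by blast
qed (rule ae_all)

lemma const_Fn: "c \<in> M \<Longrightarrow> const c \<in> Fn" and ap_const: "c \<in> M \<Longrightarrow> x \<in> elts X \<Longrightarrow> ap (const c) x = c"
  and id_Fn: "lam X (\<lambda>x. x) \<in> Fn" and ap_id: "x \<in> elts X \<Longrightarrow> ap (lam X (\<lambda>x. x)) x = x"
  by (rule ap_const_id; assumption)+

lemma cl_Ult: "f \<in> Fn \<Longrightarrow> cl f \<in> Ult M Z"
  by (auto simp: Ult_iff)

lemma j_in: "c \<in> M \<Longrightarrow> j c \<in> Ult M Z"
  unfolding j_cl by (intro cl_Ult const_Fn)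

lemma seed_in: "seed \<in> Ult M Z"
  unfolding seed_cl by (intro cl_Ult id_Fn)

lemma j_elem1:
  assumes "D UNIV {} (\<lambda>M e. P M (e 0))" "c \<in> M"
  shows "P (Ult M Z) (j c) \<longleftrightarrow> P M c"
proof -
  have "P (Ult M Z) (j c) \<longleftrightarrow> ae (\<lambda>x. P M (ap (const c) x))"
    unfolding j_cl by (rule transfer1[OF assms(1) const_Fn[OF assms(2)]])
  also have "\<dots> \<longleftrightarrow> ae (\<lambda>x. P M c)" by (rule ae_cong) (simp add: ap_const assms)
  finally show ?thesis by (simp add: ae_const)
qed

lemma j_elem2:
  assumes "D UNIV {} (\<lambda>M e. P M (e 0) (etl e 0))" "c \<in> M" "d \<in> M"
  shows "P (Ult M Z) (j c) (j d) \<longleftrightarrow> P M c d"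
proof -
  have "P (Ult M Z) (j c) (j d) \<longleftrightarrow> ae (\<lambda>x. P M (ap (const c) x) (ap (const d) x))"
    unfolding j_cl by (rule transfer2[OF assms(1) const_Fn[OF assms(2)] const_Fn[OF assms(3)]])
  also have "\<dots> \<longleftrightarrow> ae (\<lambda>x. P M c d)" by (rule ae_cong) (simp add: ap_const assms)
  finally show ?thesis by (simp add: ae_const)
qed

lemma j_F1:
  assumes "DF UNIV {} (\<lambda>M e. F M (e 0))" "c \<in> M"
  shows "F (Ult M Z) (j c) = j (F M c)"
proof -
  have "lam X (\<lambda>x. F M (ap (const c) x)) = const (F M c)" by (rule lam_cong) (simp add: ap_const assms)
  then show ?thesis using transfer_F1(1)[OF assms(1) const_Fn[OF assms(2)]] by (simp add: j_cl)
qed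

lemma j_F2:
  assumes "DF UNIV {} (\<lambda>M e. F M (e 0) (etl e 0))" "c \<in> M" "d \<in> M"
  shows "F (Ult M Z) (j c) (j d) = j (F M c d)"
proof -
  have "lam X (\<lambda>x. F M (ap (const c) x) (ap (const d) x)) = const (F M c d)"
    by (rule lam_cong) (simp add: ap_const assms)
  then show ?thesis using transfer_F2(1)[OF assms(1) const_Fn[OF assms(2)] const_Fn[OF assms(3)]] by (simp add: j_cl)
qed

lemma j_mem: "c \<in> M \<Longrightarrow> d \<in> M \<Longrightarrow> j c \<in> elts (j d) \<longleftrightarrow> c \<in> elts d"
  by (rule j_elem2[where P = "\<lambda>M c d. c \<in> elts d"]) (rule D_intros)+

lemma j_inj: "c \<in> M \<Longrightarrow> d \<in> M \<Longrightarrow> j c = j d \<longleftrightarrow> c = d"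
  by (rule j_elem2[where P = "\<lambda>M c d. c = d"]) (rule D_intros)+

lemma j_subset: "c \<in> M \<Longrightarrow> d \<in> M \<Longrightarrow> elts (j c) \<subseteq> elts (j d) \<longleftrightarrow> elts c \<subseteq> elts d"
  by (rule j_elem2[where P = "\<lambda>M c d. elts c \<subseteq> elts d"]) (rule D_intros)+

lemma j_Ord: "c \<in> M \<Longrightarrow> Ord (j c) \<longleftrightarrow> Ord c"
  by (rule j_elem1[where P = "\<lambda>M c. Ord c"]) (rule D_intros)+

lemma j_ap: "c \<in> M \<Longrightarrow> d \<in> M \<Longrightarrow> ap (j c) (j d) = j (ap c d)"
  by (rule j_F2[where F = "\<lambda>M c d. ap c d"]) (rule D_intros)+

lemma j_Int: "c \<in> M \<Longrightarrow> d \<in> M \<Longrightarrow> vset (elts (j c) \<inter> elts (j d)) = j (vset (elts c \<inter> elts d))"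
  by (rule j_F2[where F = "\<lambda>M c d. vset (elts c \<inter> elts d)"]) (rule D_intros)+

lemma j_space: "c \<in> M \<Longrightarrow> space (j c) = j (space c)"
  unfolding space_def Uni_def[symmetric] by (rule j_F1[where F = "\<lambda>M c. Uni c"]) (rule D_intros)+

lemma cl_mem_j: "f \<in> Fn \<Longrightarrow> c \<in> M \<Longrightarrow> cl f \<in> elts (j c) \<longleftrightarrow> ae (\<lambda>x. ap f x \<in> elts c)"
  unfolding j_cl by (simp add: cl_mem const_Fn) (rule ae_cong, simp add: ap_const)

lemma ap_cl: "f \<in> Fn \<Longrightarrow> g \<in> Fn \<Longrightarrow> ap (cl f) (cl g) = cl (lam X (\<lambda>x. ap (ap f x) (ap g x)))"
  by (rule transfer_F2(1)[where F = "\<lambda>M c d. ap c d"]) (assumption | rule DF_ap DF_vars)+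

text \<open>The seed generates the ultrapower over the range of \<open>j\<close>. An embedding of
  the ultrapower can thus be computed from its values on that range and at the seed.\<close>

lemma cl_rep:
  assumes f: "f \<in> Fn"
  shows "cl f = ap (j f) seed"
proof -
  note fM = FnD(1)[OF f]
  have "ap (j f) seed = cl (lam X (\<lambda>x. ap (ap (const f) x) (ap (lam X (\<lambda>x. x)) x)))"
    unfolding j_cl seed_cl by (rule ap_cl[OF const_Fn[OF fM] id_Fn])
  also have "lam X (\<lambda>x. ap (ap (const f) x) (ap (lam X (\<lambda>x. x)) x)) = lam X (\<lambda>x. app f x)"
    by (rule lam_cong) (simp add: ap_const[OF fM] ap_id Fn_ap[OF f])
  also have "\<dots> = f"
  proof -
    have l: "lam X (\<lambda>x. ap f x) \<in> Fn" "\<And>x. x \<in> elts X \<Longrightarrow> ap (lam X (\<lambda>x. ap f x)) x = ap f x"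
      by (rule lam_Fn, (rule fM D_intros)+)+
    have "lam X (\<lambda>x. app f x) = lam X (\<lambda>x. ap f x)" by (rule lam_cong) (simp add: Fn_ap[OF f])
    also have "\<dots> = f" by (rule function_ext[OF FnD(2)[OF l(1)] FnD(2)[OF f]]) (simp add: Fn_ap l f)
    finally show ?thesis .
  qed
  finally show ?thesis by simp
qed

lemma seed_mem_j: "c \<in> M \<Longrightarrow> seed \<in> elts (j c) \<longleftrightarrow> ae (\<lambda>x. x \<in> elts c)"
  unfolding seed_cl using cl_mem_j[OF id_Fn] ae_cong[of "\<lambda>x. ap (lam X (\<lambda>x. x)) x \<in> elts c" "\<lambda>x. x \<in> elts c"]
  by (simp add: ap_id)

lemma ae_mem_Int: "c \<in> M \<Longrightarrow> ae (\<lambda>x. x \<in> elts c) \<longleftrightarrow> vset (elts c \<inter> elts X) \<in> elts Z"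
proof (rule ae_set)
  show "elts (vset (elts c \<inter> elts X)) = {x \<in> elts X. x \<in> elts c}" by auto
  show "c \<in> M \<Longrightarrow> vset (elts c \<inter> elts X) \<in> M"
    by (rule inner_in[OF inner]) (rule DF_Int DF_const X_in | assumption)+
qed

lemma inner_ultrapower_Ult: "cc_ultrafilter (Ult M Z) Z' \<Longrightarrow> ultrapower (Ult M Z) Z'"
  by (simp add: ultrapower_def inner_Ult)

text \<open>Makes the value of the collapse a term of the calculus: all quantifiers range over
  \<open>M\<close>, and the auxiliary \<open>G\<close> stands for the set
  \<open>funs M X A\<close>.\<close>

lemma cl_iff:
  assumes f: "f \<in> Fn"
  shows "y = cl f \<longleftrightarrow> (\<exists>A\<in>M. \<exists>t\<in>M. \<exists>G\<in>M. transitive A \<and>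
    (\<forall>g\<in>M. g \<in> elts G \<longleftrightarrow> function_on X g \<and> (\<forall>x\<in>elts X. ap g x \<in> elts A)) \<and> f \<in> elts G \<and> function_on G t \<and>
    (\<forall>g\<in>elts G. \<forall>w\<in>M. w \<in> elts (ap t g) \<longleftrightarrow> (\<exists>h\<in>elts G. (\<exists>S\<in>elts Z. \<forall>x\<in>elts S. ap h x \<in> elts (ap g x)) \<and> w = ap t h)) \<and>
    y = ap t f)" (is "_ \<longleftrightarrow> ?R")
proof -
  have G: "(\<forall>g\<in>M. g \<in> elts G \<longleftrightarrow> function_on X g \<and> (\<forall>x\<in>elts X. ap g x \<in> elts A)) \<longleftrightarrow> G = funs M X A"
    if "A \<in> M" "G \<in> M" for A G
  proof -
    have "G = funs M X A \<longleftrightarrow> (\<forall>g\<in>M. g \<in> elts G \<longleftrightarrow> g \<in> elts (funs M X A))"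
      using innerD[OF inner] that funs_in[OF that(1)] by (subst elts_eq_iff[symmetric]) blast
    then show ?thesis unfolding elts_funs[OF that(1)] by (simp add: Fn_def)
  qed
  have R: "(\<exists>S\<in>elts Z. \<forall>x\<in>elts S. ap h x \<in> elts (ap g x)) = R h g" for h g unfolding R_def ae_def ..
  have c: "(\<forall>g\<in>elts (funs M X A). \<forall>w\<in>M. w \<in> elts (ap t g) \<longleftrightarrow> (\<exists>h\<in>elts (funs M X A). R h g \<and> w = ap t h)) \<longleftrightarrow>
    (\<forall>g\<in>elts (funs M X A). elts (app t g) = {app t h | h. h \<in> elts (funs M X A) \<and> R h g})"
    if t: "A \<in> M" "t \<in> M" "function_on (funs M X A) t" for A t
  proof (rule ball_cong[OF refl])
    fix g assume g: "g \<in> elts (funs M X A)"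
    have "app t h \<in> M" if "h \<in> elts (funs M X A)" for h using app_in[OF inner t(2,3) that] .
    moreover have "w \<in> M" if "w \<in> elts (app t g)" for w using innerD[OF inner app_in[OF inner t(2,3) g] that] .
    moreover have "(\<exists>h\<in>elts (funs M X A). R h g \<and> w = ap t h) \<longleftrightarrow> (\<exists>h\<in>elts (funs M X A). R h g \<and> w = app t h)" for w
      using ap_app[OF t(3)] by auto
    ultimately show "(\<forall>w\<in>M. w \<in> elts (ap t g) \<longleftrightarrow> (\<exists>h\<in>elts (funs M X A). R h g \<and> w = ap t h)) \<longleftrightarrow>
      (elts (app t g) = {app t h | h. h \<in> elts (funs M X A) \<and> R h g})"
      unfolding ap_app[OF t(3) g] by (simp only:) blast
  qed
  show ?thesis
  proof
    assume y: "y = cl f"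
    obtain A t where At: "coll A t" "f \<in> elts (funs M X A)" using coll_obtain[OF f f] by blast
    note A = collD[OF At(1)]
    show ?R
      apply (rule bexI[OF _ A(1)], rule bexI[OF _ A(2)], rule bexI[OF _ funs_in[OF A(1)]])
      unfolding G[OF A(1) funs_in[OF A(1)]] R c[OF A(1,2,4)]
      using A At coll_elts[OF At(1)] cl_coll[OF At] y ap_app[OF A(4) At(2)] by simp
  next
    assume ?R
    then obtain A t G where *: "A \<in> M" "t \<in> M" "G \<in> M" "transitive A"
      "\<forall>g\<in>M. g \<in> elts G \<longleftrightarrow> function_on X g \<and> (\<forall>x\<in>elts X. ap g x \<in> elts A)" "f \<in> elts G" "function_on G t"
      "\<forall>g\<in>elts G. \<forall>w\<in>M. w \<in> elts (ap t g) \<longleftrightarrow> (\<exists>h\<in>elts G. (\<exists>S\<in>elts Z. \<forall>x\<in>elts S. ap h x \<in> elts (ap g x)) \<and> w = ap t h)"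
      "y = ap t f" by (elim bexE conjE)
    have GG: "G = funs M X A" using *(5) G[OF *(1,3)] by simp
    have "coll A t" unfolding coll_def
      using *(1,2,4,7) *(8)[unfolded R GG c[OF *(1,2) *(7)[unfolded GG]]] GG by simp
    then show "y = cl f" using cl_coll[of A t f] *(6,7,9) ap_app[OF *(7,6)] GG by simp
  qed
qed

end

subsection \<open>Definability of the Ultrapower Axiom\<close>

lemma space_Uni: "space Z = Uni Z"
  unfolding space_def Uni_def ..

text \<open>The notion in the vocabulary of the calculus: the space becomes the union,
  \<open>app\<close> becomes \<open>ap\<close>, and the countable intersection is separated from its
  term at 0.\<close>

lemma cc_iff:
  "cc_ultrafilter N Z \<longleftrightarrow> Uni Z \<in> N \<and> Z \<in> N \<and> (\<forall>A\<in>elts Z. elts A \<subseteq> elts (Uni Z)) \<and> Uni Z \<in> elts Z \<and> vset {} \<notin> elts Z \<and>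
    (\<forall>A\<in>elts Z. \<forall>B\<in>N. elts A \<subseteq> elts B \<and> elts B \<subseteq> elts (Uni Z) \<longrightarrow> B \<in> elts Z) \<and>
    (\<forall>A\<in>elts Z. \<forall>B\<in>elts Z. vset (elts A \<inter> elts B) \<in> elts Z) \<and>
    (\<forall>A\<in>N. elts A \<subseteq> elts (Uni Z) \<longrightarrow> A \<in> elts Z \<or> vset (elts (Uni Z) - elts A) \<in> elts Z) \<and>
    (\<forall>s\<in>N. function_on omega s \<and> (\<forall>n\<in>elts omega. ap s n \<in> elts Z) \<longrightarrow>
      vset {x\<in>elts (ap s (vset {})). \<forall>n\<in>elts omega. x \<in> elts (ap s n)} \<in> elts Z)"
proof -
  have 1: "(\<exists>X. ultrafilter_on N X Z) \<longleftrightarrow> ultrafilter_on N (Uni Z) Z"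
  proof
    assume "\<exists>X. ultrafilter_on N X Z"
    then obtain Y where Y: "ultrafilter_on N Y Z" by blast
    then have "(\<Union>A\<in>elts Z. elts A) = elts Y" unfolding ultrafilter_on_def by blast
    then have "Uni Z = Y" unfolding Uni_def by simp
    then show "ultrafilter_on N (Uni Z) Z" using Y by simp
  qed blast
  have 2: "(function_on omega s \<and> (\<forall>n\<in>elts omega. app s n \<in> elts Z) \<longrightarrow> vset (\<Inter>n\<in>elts omega. elts (app s n)) \<in> elts Z) \<longleftrightarrow>
    (function_on omega s \<and> (\<forall>n\<in>elts omega. ap s n \<in> elts Z) \<longrightarrow>
      vset {x\<in>elts (ap s (vset {})). \<forall>n\<in>elts omega. x \<in> elts (ap s n)} \<in> elts Z)" for s
  proof (cases "function_on omega s")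
    case True
    have e: "app s n = ap s n" if "n \<in> elts omega" for n using ap_app[OF True that] by simp
    have "(\<Inter>n\<in>elts omega. elts (app s n)) = {x\<in>elts (ap s (vset {})). \<forall>n\<in>elts omega. x \<in> elts (ap s n)}"
      using e omega_0 by auto
    moreover have "(\<forall>n\<in>elts omega. app s n \<in> elts Z) = (\<forall>n\<in>elts omega. ap s n \<in> elts Z)" using e by simp
    ultimately show ?thesis by simp
  qed simp
  show ?thesis
    unfolding cc_ultrafilter_def 1 countably_complete_def 2 
    unfolding ultrafilter_on_def by (simp only: conj_assoc)
qed

text \<open>The value of the collapse made total. A fixed default makes the graph definable also at
  unintended arguments, where the definite description in \<open>ult_class\<close> has no tractable
  value.\<close>

definition uclass :: "'v::zfc set \<Rightarrow> 'v \<Rightarrow> 'v \<Rightarrow> 'v" where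
  "uclass N Z f = (if cc_ultrafilter N Z \<and> f \<in> N \<and> function_on (Uni Z) f then ult_class N Z f else vset {})"

text \<open>In a comparison the second ultrapower is taken in a class \<open>Ult M U\<close> that
  varies with \<open>U\<close>. Completeness and the collapse must therefore be definable relative
  to a class depending on an argument, and not only relative to the ambient class.\<close>

locale dclass =
  fixes N :: "'v::zfc set \<Rightarrow> 'v \<Rightarrow> 'v set"
  assumes N_inner: "\<And>M u. inner M \<Longrightarrow> inner (N M u)" and N_sub: "\<And>M u. inner M \<Longrightarrow> N M u \<subseteq> M"
    and D_N0: "D UNIV {} (\<lambda>M e. e 0 \<in> N M (etl e 0))"
begin

lemma D_N: "DF UNIV {} t \<Longrightarrow> DF UNIV {} u \<Longrightarrow> D UNIV {} (\<lambda>M e. t M e \<in> N M (u M e))"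
  using D_substs[OF D_N0, of "\<lambda>i. if i = 0 then t else u"] by (simp add: etl_def)

lemma D_allN:
  assumes "DF UNIV {} u" "D UNIV {} (\<lambda>M e. Q M (etl e) (e 0))"
  shows "D UNIV {} (\<lambda>M e. \<forall>x\<in>N M (u M e). Q M e x)"
proof (rule D_cong)
  show "(\<forall>x\<in>N M (u M e). Q M e x) \<longleftrightarrow> (\<forall>x\<in>M. x \<in> N M (u M e) \<longrightarrow> Q M e x)" if "valid UNIV {} M e" for M e
    using N_sub[OF valid_inner[OF that]] by blast
qed (rule D_all D_N assms DF_tl D_intros)+

lemma D_exN:
  assumes "DF UNIV {} u" "D UNIV {} (\<lambda>M e. Q M (etl e) (e 0))"
  shows "D UNIV {} (\<lambda>M e. \<exists>x\<in>N M (u M e). Q M e x)"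
proof (rule D_cong)
  show "(\<exists>x\<in>N M (u M e). Q M e x) \<longleftrightarrow> (\<exists>x\<in>M. x \<in> N M (u M e) \<and> Q M e x)" if "valid UNIV {} M e" for M e
    using N_sub[OF valid_inner[OF that]] by blast
qed (rule D_ex D_N assms DF_tl D_intros)+

lemma D_cc0: "D UNIV {} (\<lambda>M e. cc_ultrafilter (N M (etl e 0)) (e 0))"
  unfolding cc_iff
  by (rule D_allN D_N D_intros)+

lemma D_cc: "DF UNIV {} u \<Longrightarrow> DF UNIV {} z \<Longrightarrow> D UNIV {} (\<lambda>M e. cc_ultrafilter (N M (u M e)) (z M e))"
  using D_substs[OF D_cc0, of "\<lambda>i. if i = 0 then z else u"] by (simp add: etl_def)

lemma DF_uclass0: "DF UNIV {} (\<lambda>M e. uclass (N M (etl (etl e) 0)) (etl e 0) (e 0))"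
  unfolding DF_def
proof (intro conjI allI impI)
  fix M :: "'v set" and e assume v: "valid UNIV {} M e"
  note i = valid_inner[OF v]
  have "ult_class (N M u) z f \<in> M" if "cc_ultrafilter (N M u) z" "f \<in> N M u" "function_on (Uni z) f" for u z f
  proof -
    interpret ultrapower "N M u" z using that N_inner[OF i] by (simp add: ultrapower_def)
    have "f \<in> Fn" using that by (simp add: Fn_def space_Uni)
    then show ?thesis using cl_in N_sub[OF i] by blast
  qed
  moreover have "vset {} \<in> M" using DF_in[OF DF_empty v] .
  ultimately show "uclass (N M (etl (etl e) 0)) (etl e 0) (e 0) \<in> M" unfolding uclass_def by simp
next
  have "D UNIV {} (\<lambda>M e. (cc_ultrafilter (N M (etl (etl (etl e)) 0)) (etl (etl e) 0) \<and> etl e 0 \<in> N M (etl (etl (etl e)) 0) \<and>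
      function_on (Uni (etl (etl e) 0)) (etl e 0) \<longrightarrow>
    (\<exists>A\<in>N M (etl (etl (etl e)) 0). \<exists>t\<in>N M (etl (etl (etl e)) 0). \<exists>G\<in>N M (etl (etl (etl e)) 0). transitive A \<and>
    (\<forall>g\<in>N M (etl (etl (etl e)) 0). g \<in> elts G \<longleftrightarrow> function_on (Uni (etl (etl e) 0)) g \<and> (\<forall>x\<in>elts (Uni (etl (etl e) 0)). ap g x \<in> elts A)) \<and>
     etl e 0 \<in> elts G \<and> function_on G t \<and>
    (\<forall>g\<in>elts G. \<forall>w\<in>N M (etl (etl (etl e)) 0). w \<in> elts (ap t g) \<longleftrightarrow> 
      (\<exists>h\<in>elts G. (\<exists>S\<in>elts (etl (etl e) 0). \<forall>x\<in>elts S. ap h x \<in> elts (ap g x)) \<and> w = ap t h)) \<and>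
    e 0 = ap t (etl e 0))) \<and>
    (\<not> (cc_ultrafilter (N M (etl (etl (etl e)) 0)) (etl (etl e) 0) \<and> etl e 0 \<in> N M (etl (etl (etl e)) 0) \<and>
      function_on (Uni (etl (etl e) 0)) (etl e 0)) \<longrightarrow> e 0 = vset {}))"
    by (rule D_allN D_exN D_N D_cc D_intros)+
  then show "D UNIV {} (\<lambda>M e. e 0 = uclass (N M (etl (etl (etl e)) 0)) (etl (etl e) 0) (etl e 0))"
  proof (rule D_cong[rotated])
    fix M :: "'v set" and e assume v: "valid UNIV {} M e"
    note i = valid_inner[OF v]
    let ?u = "etl (etl (etl e)) 0" and ?z = "etl (etl e) 0" and ?f = "etl e 0"
    show "e 0 = uclass (N M ?u) ?z ?f \<longleftrightarrow> (cc_ultrafilter (N M ?u) ?z \<and> ?f \<in> N M ?u \<and> function_on (Uni ?z) ?f \<longrightarrow>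
    (\<exists>A\<in>N M ?u. \<exists>t\<in>N M ?u. \<exists>G\<in>N M ?u. transitive A \<and>
    (\<forall>g\<in>N M ?u. g \<in> elts G \<longleftrightarrow> function_on (Uni ?z) g \<and> (\<forall>x\<in>elts (Uni ?z). ap g x \<in> elts A)) \<and>
     ?f \<in> elts G \<and> function_on G t \<and>
    (\<forall>g\<in>elts G. \<forall>w\<in>N M ?u. w \<in> elts (ap t g) \<longleftrightarrow> 
      (\<exists>h\<in>elts G. (\<exists>S\<in>elts ?z. \<forall>x\<in>elts S. ap h x \<in> elts (ap g x)) \<and> w = ap t h)) \<and>
    e 0 = ap t ?f)) \<and>
    (\<not> (cc_ultrafilter (N M ?u) ?z \<and> ?f \<in> N M ?u \<and> function_on (Uni ?z) ?f) \<longrightarrow> e 0 = vset {})"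
    proof (cases "cc_ultrafilter (N M ?u) ?z \<and> ?f \<in> N M ?u \<and> function_on (Uni ?z) ?f")
      case True
      interpret ultrapower "N M ?u" ?z using True N_inner[OF i] by (simp add: ultrapower_def)
      have "?f \<in> Fn" using True by (simp add: Fn_def space_Uni)
      from cl_iff[OF this, of "e 0", unfolded space_Uni] True show ?thesis unfolding uclass_def by (simp only: if_True simp_thms)
    next
      case False
      then show ?thesis unfolding uclass_def by (simp only: if_False simp_thms)
    qed
  qed
qed

lemma DF_uclass:
  "DF UNIV {} u \<Longrightarrow> DF UNIV {} z \<Longrightarrow> DF UNIV {} f \<Longrightarrow> DF UNIV {} (\<lambda>M e. uclass (N M (u M e)) (z M e) (f M e))"
  using DF_substs[OF DF_uclass0, of "\<lambda>i. if i = 0 then f else if i = 1 then z else u"] by (simp add: etl_def)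

end

lemma D_True: "D C K (\<lambda>M e. True)"
  by (rule D_true) simp

interpretation self: dclass "\<lambda>M u. M"
proof
  show "D UNIV {} (\<lambda>M e. e 0 \<in> M)" by (rule D_cong[OF _ D_True]) (simp add: valid_def)
qed auto

lemmas self_D_cc = self.D_cc[OF DF_vars(1)]
lemmas self_DF_uclass = self.DF_uclass[OF DF_vars(1)]

text \<open>The default \<open>M\<close> keeps the class inner and included in \<open>M\<close> for
  every value of the parameter.\<close>

definition ult_or_self :: "'v::zfc set \<Rightarrow> 'v \<Rightarrow> 'v set" where
  "ult_or_self M u = (if cc_ultrafilter M u then Ult M u else M)"

lemma Ult_uclass:
  assumes "inner N" "cc_ultrafilter N z"
  shows "y \<in> Ult N z \<longleftrightarrow> (\<exists>f\<in>N. function_on (Uni z) f \<and> y = uclass N z f)"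
proof -
  interpret ultrapower N z using assms by (simp add: ultrapower_def)
  show ?thesis unfolding Ult_iff Fn_def uclass_def using assms by (auto simp: space_Uni)
qed

lemma ult_emb_uclass:
  assumes "inner N" "cc_ultrafilter N z" "x \<in> N"
  shows "ult_emb N z x = uclass N z (lam (Uni z) (\<lambda>_. x))"
proof -
  interpret ultrapower N z using assms by (simp add: ultrapower_def)
  show ?thesis unfolding j_cl uclass_def using assms const_Fn[OF assms(3)] by (simp add: Fn_def space_Uni)
qed

interpretation ult: dclass ult_or_self
proof
  fix M u assume i: "inner (M :: 'a set)"
  show "inner (ult_or_self M u)"
    unfolding ult_or_self_def using ultrapower.inner_Ult[of M u] i by (simp add: ultrapower_def)
  show "ult_or_self M u \<subseteq> M"
    unfolding ult_or_self_def using ultrapower.Ult_sub[of M u] i by (auto simp: ultrapower_def)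
next
  have "D UNIV {} (\<lambda>(M :: 'a set) e. (cc_ultrafilter M (etl e 0) \<longrightarrow> (\<exists>f\<in>M. function_on (Uni (etl e 0)) f \<and> e 0 = uclass M (etl e 0) f)))"
    by (rule D_ex self_D_cc self_DF_uclass D_intros)+
  then show "D UNIV {} (\<lambda>(M :: 'a set) e. e 0 \<in> ult_or_self M (etl e 0))"
  proof (rule D_cong[rotated])
    fix M :: "'a set" and e assume v: "valid UNIV {} M e"
    show "e 0 \<in> ult_or_self M (etl e 0) \<longleftrightarrow>
      (cc_ultrafilter M (etl e 0) \<longrightarrow> (\<exists>f\<in>M. function_on (Uni (etl e 0)) f \<and> e 0 = uclass M (etl e 0) f))"
    proof (cases "cc_ultrafilter M (etl e 0)")
      case True
      with Ult_uclass[OF valid_inner[OF v] True] show ?thesis by (simp only: ult_or_self_def if_True simp_thms)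
    next
      case False
      then show ?thesis using v by (simp add: ult_or_self_def valid_def)
    qed
  qed
qed

text \<open>A comparison equates proper classes. Since both iterated ultrapowers are included in
  \<open>M\<close>, their equality becomes a quantification over elements of \<open>M\<close>, and
  the axiom becomes a first-order sentence.\<close>

lemma ultrapower_axiom_iff:
  assumes i: "inner M"
  shows "ultrapower_axiom M \<longleftrightarrow> (\<forall>U\<in>M. \<forall>W\<in>M. cc_ultrafilter M U \<and> cc_ultrafilter M W \<longrightarrow>
    (\<exists>Z0\<in>M. \<exists>Z1\<in>M. cc_ultrafilter (ult_or_self M U) Z0 \<and> cc_ultrafilter (ult_or_self M W) Z1 \<and>
      (\<forall>y\<in>M. (\<exists>f\<in>ult_or_self M U. function_on (Uni Z0) f \<and> y = uclass (ult_or_self M U) Z0 f) \<longleftrightarrow>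
             (\<exists>f\<in>ult_or_self M W. function_on (Uni Z1) f \<and> y = uclass (ult_or_self M W) Z1 f)) \<and>
      (\<forall>x\<in>M. uclass (ult_or_self M U) Z0 (lam (Uni Z0) (\<lambda>_. uclass M U (lam (Uni U) (\<lambda>_. x)))) =
             uclass (ult_or_self M W) Z1 (lam (Uni Z1) (\<lambda>_. uclass M W (lam (Uni W) (\<lambda>_. x)))))))"
proof -
  have ccM: "U \<in> M" if "cc_ultrafilter M U" for U
    using that unfolding cc_iff by blast
  have "comparison M U W Z0 Z1 \<longleftrightarrow> Z0 \<in> M \<and> Z1 \<in> M \<and> cc_ultrafilter (ult_or_self M U) Z0 \<and> cc_ultrafilter (ult_or_self M W) Z1 \<and>
      (\<forall>y\<in>M. (\<exists>f\<in>ult_or_self M U. function_on (Uni Z0) f \<and> y = uclass (ult_or_self M U) Z0 f) \<longleftrightarrow>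
             (\<exists>f\<in>ult_or_self M W. function_on (Uni Z1) f \<and> y = uclass (ult_or_self M W) Z1 f)) \<and>
      (\<forall>x\<in>M. uclass (ult_or_self M U) Z0 (lam (Uni Z0) (\<lambda>_. uclass M U (lam (Uni U) (\<lambda>_. x)))) =
             uclass (ult_or_self M W) Z1 (lam (Uni Z1) (\<lambda>_. uclass M W (lam (Uni W) (\<lambda>_. x)))))"
    (is "_ \<longleftrightarrow> ?R") if cc: "cc_ultrafilter M U" "cc_ultrafilter M W" for U W Z0 Z1
  proof (cases "cc_ultrafilter (Ult M U) Z0 \<and> cc_ultrafilter (Ult M W) Z1")
    case False
    then show ?thesis using cc unfolding comparison_def ult_or_self_def by auto
  next
    case True
    then have c: "cc_ultrafilter (Ult M U) Z0" "cc_ultrafilter (Ult M W) Z1" by auto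
    interpret U: ultrapower M U using i cc by (simp add: ultrapower_def)
    interpret W: ultrapower M W using i cc by (simp add: ultrapower_def)
    interpret UZ: ultrapower "Ult M U" Z0 by (rule U.inner_ultrapower_Ult[OF c(1)])
    interpret WZ: ultrapower "Ult M W" Z1 by (rule W.inner_ultrapower_Ult[OF c(2)])
    have e: "ult_or_self M U = Ult M U" "ult_or_self M W = Ult M W" using cc by (simp_all add: ult_or_self_def)
    have 1: "Z0 \<in> M" "Z1 \<in> M" using U.Ult_sub W.Ult_sub UZ.Z_in WZ.Z_in by auto
    have 2: "Ult (Ult M U) Z0 = Ult (Ult M W) Z1 \<longleftrightarrow> (\<forall>y\<in>M. y \<in> Ult (Ult M U) Z0 \<longleftrightarrow> y \<in> Ult (Ult M W) Z1)"
      using U.Ult_sub W.Ult_sub UZ.Ult_sub WZ.Ult_sub by (auto simp: set_eq_iff)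
    have 3: "uclass (Ult M U) Z0 (lam (Uni Z0) (\<lambda>_. uclass M U (lam (Uni U) (\<lambda>_. x)))) = ult_emb (Ult M U) Z0 (ult_emb M U x)"
      "uclass (Ult M W) Z1 (lam (Uni Z1) (\<lambda>_. uclass M W (lam (Uni W) (\<lambda>_. x)))) = ult_emb (Ult M W) Z1 (ult_emb M W x)"
      if x: "x \<in> M" for x
      using ult_emb_uclass[OF i cc(1) x] ult_emb_uclass[OF i cc(2) x]
        ult_emb_uclass[OF UZ.inner c(1) U.j_in[OF x]] ult_emb_uclass[OF WZ.inner c(2) W.j_in[OF x]] by simp_all
    show ?thesis
      unfolding comparison_def e Ult_uclass[OF UZ.inner c(1), symmetric] Ult_uclass[OF WZ.inner c(2), symmetric] 2
      using 1 c 3 by simp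
  qed
  note * = this
  have logic: "(\<forall>U W. c U \<and> c W \<longrightarrow> (\<exists>Z0 Z1. K U W Z0 Z1)) \<longleftrightarrow>
      (\<forall>U\<in>M. \<forall>W\<in>M. c U \<and> c W \<longrightarrow> (\<exists>Z0\<in>M. \<exists>Z1\<in>M. R U W Z0 Z1))"
    if cM: "\<And>U. c U \<Longrightarrow> U \<in> M" and K:
      "\<And>U W Z0 Z1. c U \<Longrightarrow> c W \<Longrightarrow> K U W Z0 Z1 \<longleftrightarrow> Z0 \<in> M \<and> Z1 \<in> M \<and> R U W Z0 Z1" for c K R
  proof (intro iffI ballI allI impI)
    fix U W assume "\<forall>U W. c U \<and> c W \<longrightarrow> (\<exists>Z0 Z1. K U W Z0 Z1)" "c U \<and> c W"
    then obtain Z0 Z1 where "K U W Z0 Z1" by blast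
    then show "\<exists>Z0\<in>M. \<exists>Z1\<in>M. R U W Z0 Z1" using K[of U W Z0 Z1] \<open>c U \<and> c W\<close> by blast
  next
    fix U W assume "\<forall>U\<in>M. \<forall>W\<in>M. c U \<and> c W \<longrightarrow> (\<exists>Z0\<in>M. \<exists>Z1\<in>M. R U W Z0 Z1)" "c U \<and> c W"
    then obtain Z0 Z1 where "Z0 \<in> M" "Z1 \<in> M" "R U W Z0 Z1" using cM by meson
    then show "\<exists>Z0 Z1. K U W Z0 Z1" using K[of U W Z0 Z1] \<open>c U \<and> c W\<close> by blast
  qed
  show ?thesis unfolding ultrapower_axiom_def by (rule logic[OF ccM *])
qed

lemma D_ultrapower_axiom: "D UNIV {} (\<lambda>M e. ultrapower_axiom M)"
proof (rule D_cong[OF ultrapower_axiom_iff[OF valid_inner]])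
qed (assumption | rule D_all D_imp D_conj D_ex D_iff D_eq D_function_on ult.D_exN self_D_cc ult.D_cc ult.DF_uclass self_DF_uclass DF_lam DF_Uni DF_vars)+

lemma D_Unif: "D UNIV {} (\<lambda>M e. e 0 \<in> Unif M)"
  unfolding Unif_def mem_Collect_eq space_Uni
  by (rule self_D_cc D_intros)+

section \<open>Elementarity for uniform ultrafilters; derived and pushed-forward
  ultrafilters\<close>

context ultrapower begin

lemma ultrapower_axiom_Ult: "ultrapower_axiom (Ult M Z) \<longleftrightarrow> ultrapower_axiom M"
  using transfer[OF D_ultrapower_axiom, of "\<lambda>_. const X"] const_Fn[OF X_in] by (simp add: ae_const)

lemma j_Unif: "W \<in> M \<Longrightarrow> j W \<in> Unif (Ult M Z) \<longleftrightarrow> W \<in> Unif M"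
  by (rule j_elem1[where P = "\<lambda>M c. c \<in> Unif M"]) (rule D_Unif)

lemma ap_j_cl:
  assumes "c \<in> M" "g \<in> Fn"
  shows "ap (j c) (cl g) = cl (lam X (\<lambda>z. ap c (ap g z)))"
proof -
  have "lam X (\<lambda>z. ap (ap (const c) z) (ap g z)) = lam X (\<lambda>z. ap c (ap g z))"
    by (rule lam_cong) (simp add: ap_const assms)
  then show ?thesis unfolding j_cl using ap_cl[OF const_Fn[OF assms(1)] assms(2)] by simp
qed

lemma DF_cl: "DF {M} M (\<lambda>N e. uclass M Z (e 0))"
proof -
  have "DF UNIV {} (\<lambda>(M :: 'v set) e. uclass M (etl e 0) (e 0))" by (rule self_DF_uclass DF_vars)+
  from DF_substs[OF DF_weaken[OF this], of "{M}" M "\<lambda>i. if i = 0 then (\<lambda>N e. e 0) else (\<lambda>N e. Z)"]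
  have "DF {M} M (\<lambda>N e. uclass N Z (e 0))" by (simp add: etl_def DF_vars DF_const Z_in)
  then show ?thesis by (rule DF_cong[rotated]) (auto dest: valid_single)
qed

lemma uclass_cl: "f \<in> Fn \<Longrightarrow> uclass M Z f = cl f"
  unfolding uclass_def using cc by (simp add: Fn_def space_Uni)

lemma DF_j: "DF {M} M (\<lambda>N e. j (e 0))"
proof (rule DF_cong)
  show "j (e 0) = uclass M Z (lam X (\<lambda>_. e 0))" if "valid {M} M N e" for N e
  proof -
    have "e 0 \<in> M" using that by (auto simp: valid_def)
    from uclass_cl[OF const_Fn[OF this]] show ?thesis by (simp add: j_cl)
  qed
  show "DF {M} M (\<lambda>N e. uclass M Z (lam X (\<lambda>_. e 0)))"
    by (rule DF1[OF DF_cl] X_in D_intros)+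
qed

lemma j_function:
  assumes A: "A \<in> M"
  shows "\<exists>J\<in>M. function_on A J \<and> (\<forall>x\<in>elts A. app J x = j x)"
  using lam_inner[OF inner A DF_j] by (intro bexI[of _ "lam A j"]) auto

text \<open>The first set is the family derived from \<open>j\<close> by \<open>e\<close>, the
  second pulls \<open>e\<close> back along \<open>j\<close>. Both belong to \<open>M\<close> because
  a representative of \<open>e\<close> turns the condition into one that holds almost everywhere
  with respect to \<open>Z\<close>.\<close>

lemma derived:
  assumes e: "e \<in> Ult M Z" and b: "b \<in> M"
  shows "\<exists>E\<in>M. elts E = {x\<in>M. elts x \<subseteq> elts b \<and> e \<in> elts (j x)}"
    "\<exists>E\<in>M. elts E = {x\<in>M. elts x \<subseteq> elts b \<and> j x \<in> elts e}"
proof -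
  obtain g where g: "g \<in> Fn" "e = cl g" using e Ult_iff by blast
  obtain P where P: "P \<in> M" "elts P = {x\<in>M. elts x \<subseteq> elts b}" using inner_Pow[OF inner b] by blast
  have "\<exists>E\<in>M. elts E = {x\<in>elts P. ae (\<lambda>z. ap g z \<in> elts x)}" unfolding ae_def
    by (rule sep[OF inner P(1)]) (rule Z_in FnD(1)[OF g(1)] D_intros)+
  moreover have "{x\<in>elts P. ae (\<lambda>z. ap g z \<in> elts x)} = {x\<in>M. elts x \<subseteq> elts b \<and> e \<in> elts (j x)}"
    unfolding P(2) g(2) using cl_mem_j[OF g(1)] by auto
  ultimately show "\<exists>E\<in>M. elts E = {x\<in>M. elts x \<subseteq> elts b \<and> e \<in> elts (j x)}" by simp
  have "\<exists>E\<in>M. elts E = {x\<in>elts P. ae (\<lambda>z. x \<in> elts (ap g z))}" unfolding ae_def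
    by (rule sep[OF inner P(1)]) (rule Z_in FnD(1)[OF g(1)] D_intros)+
  moreover have "j x \<in> elts (cl g) \<longleftrightarrow> ae (\<lambda>z. x \<in> elts (ap g z))" if "x \<in> M" for x
    unfolding j_cl cl_mem[OF const_Fn[OF that] g(1)] by (rule ae_cong) (simp add: ap_const that)
  then have "{x\<in>elts P. ae (\<lambda>z. x \<in> elts (ap g z))} = {x\<in>M. elts x \<subseteq> elts b \<and> j x \<in> elts e}"
    unfolding P(2) g(2) by auto
  ultimately show "\<exists>E\<in>M. elts E = {x\<in>M. elts x \<subseteq> elts b \<and> j x \<in> elts e}" by simp
qed

text \<open>The image of \<open>Z\<close> under \<open>g\<close>, cut down to the sets of a possibly
  smaller model \<open>N\<close>; that it is an element of \<open>N\<close> is assumed, and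
  completeness is inherited from \<open>Z\<close>. The model is the ambient one for the ultrafilter
  derived from a comparison, and M_W inside the universe for s_W(U).\<close>

lemma pushforward:
  assumes N: "inner N" "N \<subseteq> M" and g: "g \<in> Fn" and d: "d \<in> N" and gd: "ae (\<lambda>z. ap g z \<in> elts d)" and Q: "Q \<in> N"
    "elts Q = {Y\<in>N. elts Y \<subseteq> elts d \<and> ae (\<lambda>z. ap g z \<in> elts Y)}"
  shows "cc_ultrafilter N Q" "space Q = d"
    "Y \<in> N \<Longrightarrow> ultrapower.ae Q (\<lambda>x. x \<in> elts Y) \<longleftrightarrow> ae (\<lambda>z. ap g z \<in> elts Y)"
proof -
  have in1: "t \<in> N" if "DF {N} N (\<lambda>M e. t)" for t by (rule inner_in[OF N(1) that])
  have u: "ultrafilter_on N d Q" unfolding ultrafilter_on_def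
  proof (intro conjI ballI impI)
    show "d \<in> elts Q" using Q d gd by auto
    show "vset {} \<notin> elts Q" using Q ae_ex by fastforce
    show "elts A \<subseteq> elts d" if "A \<in> elts Q" for A using that Q by auto
    show "B \<in> elts Q" if A: "A \<in> elts Q" "B \<in> N" "elts A \<subseteq> elts B \<and> elts B \<subseteq> elts d" for A B
      using that Q by (auto elim: ae_mono)
    show "vset (elts A \<inter> elts B) \<in> elts Q" if A: "A \<in> elts Q" "B \<in> elts Q" for A B
    proof -
      have "A \<in> N" "B \<in> N" using that Q by auto
      then have "vset (elts A \<inter> elts B) \<in> N" by (intro in1[OF DF_Int] DF_const)
      then show ?thesis using that unfolding Q(2) by (auto simp: ae_conj)
    qed
    show "A \<in> elts Q \<or> vset (elts d - elts A) \<in> elts Q" if A: "A \<in> N" "elts A \<subseteq> elts d" for A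
    proof -
      have "D {M} M (\<lambda>N e. ap g (e 0) \<in> elts A)" by (rule FnD(1)[OF g] subsetD[OF N(2) A(1)] D_intros)+
      from ae_not[OF this] have "ae (\<lambda>z. ap g z \<in> elts A) \<or> ae (\<lambda>z. ap g z \<notin> elts A)" by blast
      moreover have "vset (elts d - elts A) \<in> N" by (intro in1[OF DF_Diff] DF_const A d)
      ultimately show ?thesis using A gd unfolding Q(2) by (auto simp: ae_conj)
    qed
  qed (use d Q(1) in auto)
  have "countably_complete N Q" unfolding countably_complete_def
  proof (intro ballI impI, elim conjE)
    fix s assume s: "s \<in> N" "function_on omega s" "\<forall>n\<in>elts omega. app s n \<in> elts Q"
    let ?I = "vset {x\<in>elts d. \<forall>n\<in>elts omega. x \<in> elts (ap s n)}"
    have sI: "\<exists>z\<in>N. elts z = {x\<in>elts d. \<forall>n\<in>elts omega. x \<in> elts (ap s n)}"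
      by (rule sep[OF N(1) d]) (rule s D_intros)+
    have eI: "elts ?I = {x\<in>elts d. \<forall>n\<in>elts omega. x \<in> elts (ap s n)}" "?I \<in> N"
      using elts_vset[OF bex_small[OF sI]] bex_vset[OF sI] by auto
    have sD: "elts (app s n) \<subseteq> elts d \<and> ae (\<lambda>z. ap g z \<in> elts (ap s n))" if "n \<in> elts omega" for n
      using s(3) that Q(2) ap_app[OF s(2) that] by simp
    have "(\<Inter>n\<in>elts omega. elts (app s n)) = elts ?I"
      unfolding eI using ap_app[OF s(2)] sD omega_0 by auto
    moreover have "ae (\<lambda>z. \<forall>n\<in>elts omega. ap g z \<in> elts (ap s n))"
      by (rule ae_omega) ((rule subsetD[OF N(2) s(1)] FnD(1)[OF g] D_intros)+, use sD in blast)
    then have "ae (\<lambda>z. ap g z \<in> elts ?I)" unfolding eI using gd by (simp add: ae_conj)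
    ultimately show "vset (\<Inter>n\<in>elts omega. elts (app s n)) \<in> elts Q"
      unfolding Q(2) using eI by simp
  qed
  then show cc: "cc_ultrafilter N Q" using u unfolding cc_ultrafilter_def by blast
  have "(\<Union>A\<in>elts Q. elts A) = elts d" using u unfolding ultrafilter_on_def by blast
  then show sp: "space Q = d" unfolding space_def by simp
  interpret Q: ultrapower N Q using cc N(1) by (simp add: ultrapower_def)
  show "ultrapower.ae Q (\<lambda>x. x \<in> elts Y) \<longleftrightarrow> ae (\<lambda>z. ap g z \<in> elts Y)" if Y: "Y \<in> N"
  proof -
    have "vset (elts Y \<inter> elts d) \<in> N" using Y d by (intro in1[OF DF_Int] DF_const)
    then show ?thesis unfolding Q.ae_mem_Int[OF Y] sp Q(2) using gd by (simp add: ae_conj)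
  qed
qed

end

section \<open>The Ketonen order\<close>

abbreviation ae_in :: "'v::zfc \<Rightarrow> ('v \<Rightarrow> bool) \<Rightarrow> bool" where "ae_in \<equiv> ultrapower.ae"

text \<open>The strict Ketonen order, except that the sets \<open>E \<eta>\<close> of subsets of \<open>\<eta>\<close> need not be ultrafilters.\<close>

definition ket :: "'v::zfc set \<Rightarrow> 'v \<Rightarrow> 'v \<Rightarrow> bool" where
  "ket M A B \<longleftrightarrow> (\<exists>E\<in>M. \<forall>Y\<in>M. ae_in A (\<lambda>x. x \<in> elts Y) \<longleftrightarrow> ae_in B (\<lambda>\<eta>. vset (elts Y \<inter> elts \<eta>) \<in> elts (ap E \<eta>)))"

lemma UnifD:
  assumes "inner M" "A \<in> Unif M"
  shows "ultrapower M A" "Ord (space A)" "\<beta> \<in> elts (space A) \<Longrightarrow> vset (elts (space A) - elts \<beta>) \<in> elts A"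
  using assms unfolding Unif_def ultrapower_def by auto

text \<open>The set \<open>Y = {\<eta>. Y \<inter> \<eta> \<notin> E \<eta>}\<close>, defined by recursion, is in \<open>A\<close> iff its complement is.\<close>

lemma ket_irrefl:
  assumes i: "inner M" and A: "A \<in> Unif M"
  shows "\<not> ket M A A"
proof
  interpret ultrapower M A by (rule UnifD(1)[OF i A])
  assume "ket M A A"
  then obtain E where E: "E \<in> M" "\<forall>Y\<in>M. ae (\<lambda>x. x \<in> elts Y) \<longleftrightarrow> ae (\<lambda>\<eta>. vset (elts Y \<inter> elts \<eta>) \<in> elts (ap E \<eta>))"
    unfolding ket_def by blast
  define one :: 'a where "one = vset {vset {}}"
  have DFone: "DF {M} M (\<lambda>N e. one)" unfolding one_def by (rule D_intros)+
  have one_ne: "one \<noteq> vset {}" unfolding one_def by (metis elts_empty elts_vset insert_not_empty small_single)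
  \<comment> \<open>\<open>t\<close> becomes the characteristic function of the diagonal set, with
    \<open>one\<close> as the value for membership; deciding \<open>\<eta>\<close> consults only the
    values below \<open>\<eta>\<close>.\<close>
  define G where "G \<eta> r = (if vset {\<zeta>\<in>elts \<eta>. ap r \<zeta> = one} \<in> elts (ap E \<eta>) then vset {} else one)" for \<eta> r
  have "\<exists>t\<in>M. function_on X t \<and> (\<forall>g\<in>elts X. \<exists>r\<in>M. function_on (vset {h\<in>elts X. h \<in> elts g}) r \<and>
    (\<forall>h\<in>elts X. h \<in> elts g \<longrightarrow> app r h = app t h) \<and> app t g = G g r)"
    apply (rule wf_recursion[OF i X_in])
      apply (rule D_rules)+
    unfolding G_def
     apply (rule DFone E D_intros)+
    using foundation_min by blast
  then obtain t where t: "t \<in> M" "function_on X t" "\<forall>g\<in>elts X. \<exists>r\<in>M. function_on (vset {h\<in>elts X. h \<in> elts g}) r \<and>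
    (\<forall>h\<in>elts X. h \<in> elts g \<longrightarrow> app r h = app t h) \<and> app t g = G g r" by blast
  have "\<exists>z\<in>M. elts z = {\<eta>\<in>elts X. ap t \<eta> = one}" by (rule sepX) (rule t DFone D_intros)+
  then obtain Y where Y: "Y \<in> M" "elts Y = {\<eta>\<in>elts X. ap t \<eta> = one}" by (elim bexE)
  have *: "\<eta> \<in> elts Y \<longleftrightarrow> vset (elts Y \<inter> elts \<eta>) \<notin> elts (ap E \<eta>)" if \<eta>: "\<eta> \<in> elts X" for \<eta>
  proof -
    obtain r where r: "function_on (vset {h\<in>elts X. h \<in> elts \<eta>}) r"
      "\<forall>h\<in>elts X. h \<in> elts \<eta> \<longrightarrow> app r h = app t h" "app t \<eta> = G \<eta> r" using t(3) \<eta> by blast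
    have sub: "elts \<eta> \<subseteq> elts X" using UnifD(2)[OF i A] \<eta> Ord_trans by blast
    then have "{h\<in>elts X. h \<in> elts \<eta>} = elts \<eta>" by blast
    then have fr: "function_on \<eta> r" using r(1) by simp
    have "ap r \<zeta> = ap t \<zeta>" if "\<zeta> \<in> elts \<eta>" for \<zeta>
      using ap_app[OF fr that] ap_app[OF t(2)] r(2) sub that by auto
    then have "{\<zeta>\<in>elts \<eta>. ap r \<zeta> = one} = elts Y \<inter> elts \<eta>" unfolding Y(2) using sub by auto
    then have "ap t \<eta> = (if vset (elts Y \<inter> elts \<eta>) \<in> elts (ap E \<eta>) then vset {} else one)"
      using r(3) ap_app[OF t(2) \<eta>] unfolding G_def by simp
    then show ?thesis unfolding Y(2) using \<eta> one_ne by auto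
  qed
  have "ae (\<lambda>x. x \<in> elts Y) \<longleftrightarrow> ae (\<lambda>\<eta>. \<not> \<eta> \<in> elts Y)"
    using E(2) Y(1) ae_cong[of "\<lambda>\<eta>. \<not> \<eta> \<in> elts Y" "\<lambda>\<eta>. vset (elts Y \<inter> elts \<eta>) \<in> elts (ap E \<eta>)"] * by auto
  moreover have "D {M} M (\<lambda>N e. e 0 \<in> elts Y)" by (rule Y D_intros)+
  from ae_not[OF this] have "ae (\<lambda>\<eta>. \<not> \<eta> \<in> elts Y) \<longleftrightarrow> \<not> ae (\<lambda>\<eta>. \<eta> \<in> elts Y)" .
  ultimately show False by blast
qed

text \<open>The two witnesses compose to a witness for \<open>ket M A A\<close>, which irreflexivity
  excludes.\<close>

lemma ket_asym:
  assumes i: "inner M" and A: "A \<in> Unif M" and B: "B \<in> Unif M" and k: "ket M A B" "ket M B A"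
  shows False
proof -
  interpret A: ultrapower M A by (rule UnifD(1)[OF i A])
  interpret B: ultrapower M B by (rule UnifD(1)[OF i B])
  obtain E where E: "E \<in> M" "\<And>Y. Y \<in> M \<Longrightarrow> A.ae (\<lambda>x. x \<in> elts Y) \<longleftrightarrow> B.ae (\<lambda>\<eta>. vset (elts Y \<inter> elts \<eta>) \<in> elts (ap E \<eta>))"
    using k(1) unfolding ket_def by blast
  obtain F where F: "F \<in> M" "\<And>Y. Y \<in> M \<Longrightarrow> B.ae (\<lambda>x. x \<in> elts Y) \<longleftrightarrow> A.ae (\<lambda>\<xi>. vset (elts Y \<inter> elts \<xi>) \<in> elts (ap F \<xi>))"
    using k(2) unfolding ket_def by blast
  \<comment> \<open>The composite: \<open>F \<xi>\<close> is asked about the set of those \<eta>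
    below \<xi> at which \<open>E \<eta>\<close> accepts the intersection of \<open>x\<close> with
    \<eta>.\<close>
  let ?P = "\<lambda>\<xi> x. vset {\<eta>\<in>elts \<xi>. \<eta> \<in> elts B.X \<and> vset (elts x \<inter> elts \<eta>) \<in> elts (ap E \<eta>)} \<in> elts (ap F \<xi>)"
  define H where "H \<xi> = vset {x\<in>elts (vset {y\<in>M. elts y \<subseteq> elts \<xi>}). ?P \<xi> x}" for \<xi>
  have DH: "DF {M} M (\<lambda>N e. H (e 0))" unfolding H_def
    by (rule E F B.X_in D_intros)+
  have eH: "elts (H \<xi>) = {x\<in>M. elts x \<subseteq> elts \<xi> \<and> ?P \<xi> x}" if \<xi>: "\<xi> \<in> M" for \<xi>
  proof -
    have 1: "\<exists>z\<in>M. elts z = {y\<in>M. elts y \<subseteq> elts \<xi>}" by (rule inner_Pow[OF i \<xi>])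
    have "\<exists>z\<in>M. elts z = {x\<in>elts (vset {y\<in>M. elts y \<subseteq> elts \<xi>}). ?P \<xi> x}"
      by (rule sep[OF i bex_vset[OF 1]]) (rule E F B.X_in \<xi> D_intros)+
    from elts_vset[OF bex_small[OF this]] show ?thesis unfolding H_def elts_vset[OF bex_small[OF 1]] by auto
  qed
  note L = A.lam_Fn[OF DH]
  have "ket M A A" unfolding ket_def
  proof (intro bexI[of _ "lam A.X H"] ballI)
    fix Y assume Y: "Y \<in> M"
    have "\<exists>z\<in>M. elts z = {\<eta>\<in>elts B.X. vset (elts Y \<inter> elts \<eta>) \<in> elts (ap E \<eta>)}"
      by (rule B.sepX) (rule Y E D_intros)+
    then obtain Y' where Y': "Y' \<in> M" "elts Y' = {\<eta>\<in>elts B.X. vset (elts Y \<inter> elts \<eta>) \<in> elts (ap E \<eta>)}" by (elim bexE)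
    have "A.ae (\<lambda>x. x \<in> elts Y) \<longleftrightarrow> B.ae (\<lambda>\<eta>. \<eta> \<in> elts Y')"
      unfolding E(2)[OF Y] by (rule B.ae_cong) (simp add: Y')
    also have "\<dots> \<longleftrightarrow> A.ae (\<lambda>\<xi>. vset (elts Y' \<inter> elts \<xi>) \<in> elts (ap F \<xi>))" by (rule F(2)[OF Y'(1)])
    also have "\<dots> \<longleftrightarrow> A.ae (\<lambda>\<xi>. vset (elts Y \<inter> elts \<xi>) \<in> elts (ap (lam A.X H) \<xi>))"
    proof (rule A.ae_cong)
      fix \<xi> assume \<xi>: "\<xi> \<in> elts A.X"
      have "elts \<eta> \<subseteq> elts \<xi>" if "\<eta> \<in> elts \<xi>" for \<eta>
        using Ord_trans[OF Ord_elt[OF UnifD(2)[OF i A] \<xi>] that] by blast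
      then have "(elts Y \<inter> elts \<xi>) \<inter> elts \<eta> = elts Y \<inter> elts \<eta>" if "\<eta> \<in> elts \<xi>" for \<eta> using that by blast
      then have "{\<eta>\<in>elts \<xi>. \<eta> \<in> elts B.X \<and> vset (elts (vset (elts Y \<inter> elts \<xi>)) \<inter> elts \<eta>) \<in> elts (ap E \<eta>)} = elts Y' \<inter> elts \<xi>"
        unfolding Y'(2) by auto
      moreover have "vset (elts Y \<inter> elts \<xi>) \<in> M"
        by (rule inner_in[OF i]) (rule Y A.XM[OF \<xi>] D_intros)+
      ultimately show "vset (elts Y' \<inter> elts \<xi>) \<in> elts (ap F \<xi>) \<longleftrightarrow> vset (elts Y \<inter> elts \<xi>) \<in> elts (ap (lam A.X H) \<xi>)"
        unfolding L(2)[OF \<xi>] eH[OF A.XM[OF \<xi>]] by simp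
    qed
    finally show "A.ae (\<lambda>x. x \<in> elts Y) \<longleftrightarrow> A.ae (\<lambda>\<xi>. vset (elts Y \<inter> elts \<xi>) \<in> elts (ap (lam A.X H) \<xi>))" .
  qed (rule A.FnD[OF L(1)])
  then show False using ket_irrefl[OF i A] by blast
qed

section \<open>The seed order and the Ketonen order\<close>

lemma comparison_sym: "comparison M A B Z0 Z1 \<Longrightarrow> comparison M B A Z1 Z0"
  unfolding comparison_def by auto

text \<open>Let \<open>e\<close> be the image of \<open>A.seed\<close>. The witness represents the
  family of those subsets of \<open>B.seed\<close> whose image under the second embedding contains
  \<open>e\<close>. As \<open>e\<close> is an element of the image of \<open>B.seed\<close>,
  intersecting a set with \<open>B.seed\<close> does not change whether its image contains
  \<open>e\<close>.\<close>

lemma comparison_less_ket: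
  assumes i: "inner M" and cc: "cc_ultrafilter M A" "cc_ultrafilter M B" and c: "comparison M A B Z0 Z1"
    and less: "ult_emb (Ult M A) Z0 (ult_id M A) \<in> elts (ult_emb (Ult M B) Z1 (ult_id M B))"
  shows "ket M A B"
proof -
  interpret A: ultrapower M A using i cc by (simp add: ultrapower_def)
  interpret B: ultrapower M B using i cc by (simp add: ultrapower_def)
  interpret AZ: ultrapower "Ult M A" Z0 using A.inner_ultrapower_Ult c by (simp add: comparison_def)
  interpret BZ: ultrapower "Ult M B" Z1 using B.inner_ultrapower_Ult c by (simp add: comparison_def)
  define e where "e = AZ.j A.seed"
  have "e \<in> Ult (Ult M A) Z0" unfolding e_def by (rule AZ.j_in[OF A.seed_in])
  then have e: "e \<in> Ult (Ult M B) Z1" using c by (simp add: comparison_def)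
  obtain E0 where E0: "E0 \<in> Ult M B" "elts E0 = {x\<in>Ult M B. elts x \<subseteq> elts B.seed \<and> e \<in> elts (BZ.j x)}"
    using BZ.derived(1)[OF e B.seed_in] by (elim bexE)
  obtain E where E: "E \<in> B.Fn" "E0 = B.cl E" using E0(1) by (auto simp: B.Ult_iff)
  show ?thesis unfolding ket_def
  proof (intro bexI[of _ E] ballI)
    fix Y assume Y: "Y \<in> M"
    have DF: "DF {M} M (\<lambda>N e. vset (elts Y \<inter> elts (e 0)))" by (rule Y D_intros)+
    note l = B.lam_Fn[OF DF]
    have x: "vset (elts (B.j Y) \<inter> elts B.seed) = B.cl (lam B.X (\<lambda>\<eta>. vset (elts Y \<inter> elts \<eta>)))"
    proof -
      have "vset (elts (B.j Y) \<inter> elts B.seed) =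
        B.cl (lam B.X (\<lambda>x. vset (elts (ap (B.const Y) x) \<inter> elts (ap (lam B.X (\<lambda>x. x)) x))))"
        unfolding B.j_cl B.seed_cl
        by (rule B.transfer_F2(1)[where F = "\<lambda>M c d. vset (elts c \<inter> elts d)", OF _ B.const_Fn[OF Y] B.id_Fn]) (rule D_intros)+
      also have "lam B.X (\<lambda>x. vset (elts (ap (B.const Y) x) \<inter> elts (ap (lam B.X (\<lambda>x. x)) x))) = lam B.X (\<lambda>\<eta>. vset (elts Y \<inter> elts \<eta>))"
        by (rule lam_cong) (simp add: B.ap_const[OF Y] B.ap_id)
      finally show ?thesis .
    qed
    have xU: "vset (elts (B.j Y) \<inter> elts B.seed) \<in> Ult M B" unfolding x by (rule B.cl_Ult[OF l(1)])
    have "A.ae (\<lambda>x. x \<in> elts Y) \<longleftrightarrow> A.seed \<in> elts (A.j Y)" by (rule A.seed_mem_j[OF Y, symmetric])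
    also have "\<dots> \<longleftrightarrow> e \<in> elts (AZ.j (A.j Y))" unfolding e_def by (rule AZ.j_mem[OF A.seed_in A.j_in[OF Y], symmetric])
    also have "\<dots> \<longleftrightarrow> e \<in> elts (BZ.j (B.j Y))" using c Y by (simp add: comparison_def)
    also have "\<dots> \<longleftrightarrow> e \<in> elts (BZ.j (vset (elts (B.j Y) \<inter> elts B.seed)))"
      unfolding BZ.j_Int[OF B.j_in[OF Y] B.seed_in, symmetric] using less by (simp add: e_def)
    also have "\<dots> \<longleftrightarrow> vset (elts (B.j Y) \<inter> elts B.seed) \<in> elts E0" unfolding E0(2) using xU by simp
    also have "\<dots> \<longleftrightarrow> B.ae (\<lambda>\<eta>. ap (lam B.X (\<lambda>\<eta>. vset (elts Y \<inter> elts \<eta>))) \<eta> \<in> elts (ap E \<eta>))"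
      unfolding x E(2) by (rule B.cl_mem[OF l(1) E(1)])
    also have "\<dots> \<longleftrightarrow> B.ae (\<lambda>\<eta>. vset (elts Y \<inter> elts \<eta>) \<in> elts (ap E \<eta>))"
      by (rule B.ae_cong) (simp add: l(2))
    finally show "A.ae (\<lambda>x. x \<in> elts Y) \<longleftrightarrow> B.ae (\<lambda>\<eta>. vset (elts Y \<inter> elts \<eta>) \<in> elts (ap E \<eta>))" .
  qed (rule B.FnD[OF E(1)])
qed

text \<open>The common image of the seeds shows that \<open>A\<close> and \<open>B\<close> measure
  the sets of \<open>M\<close> alike. Their spaces agree because for a uniform ultrafilter no
  ordinal below the space has measure one.\<close>

lemma comparison_eq:
  assumes i: "inner M" and U: "A \<in> Unif M" "B \<in> Unif M" and c: "comparison M A B Z0 Z1"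
    and eq: "ult_emb (Ult M A) Z0 (ult_id M A) = ult_emb (Ult M B) Z1 (ult_id M B)"
  shows "A = B"
proof -
  interpret A: ultrapower M A by (rule UnifD(1)[OF i U(1)])
  interpret B: ultrapower M B by (rule UnifD(1)[OF i U(2)])
  interpret AZ: ultrapower "Ult M A" Z0 using A.inner_ultrapower_Ult c by (simp add: comparison_def)
  interpret BZ: ultrapower "Ult M B" Z1 using B.inner_ultrapower_Ult c by (simp add: comparison_def)
  have ae: "A.ae (\<lambda>x. x \<in> elts Y) \<longleftrightarrow> B.ae (\<lambda>x. x \<in> elts Y)" if Y: "Y \<in> M" for Y
  proof -
    have "A.ae (\<lambda>x. x \<in> elts Y) \<longleftrightarrow> AZ.j A.seed \<in> elts (AZ.j (A.j Y))"
      unfolding AZ.j_mem[OF A.seed_in A.j_in[OF Y]] by (rule A.seed_mem_j[OF Y, symmetric])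
    also have "\<dots> \<longleftrightarrow> BZ.j B.seed \<in> elts (BZ.j (B.j Y))" using c Y eq by (simp add: comparison_def)
    also have "\<dots> \<longleftrightarrow> B.ae (\<lambda>x. x \<in> elts Y)"
      unfolding BZ.j_mem[OF B.seed_in B.j_in[OF Y]] by (rule B.seed_mem_j[OF Y])
    finally show ?thesis .
  qed
  have nb: "\<not> ae_in A (\<lambda>x. x \<in> elts \<beta>)" if A: "A \<in> Unif M" and \<beta>: "\<beta> \<in> elts (space A)" for A \<beta>
  proof -
    interpret ultrapower M A by (rule UnifD(1)[OF i A])
    have "ae (\<lambda>x. x \<notin> elts \<beta>)" unfolding ae_def using UnifD(3)[OF i A \<beta>]
      by (intro bexI[of _ "vset (elts X - elts \<beta>)"]) auto
    then show ?thesis using ae_ex[of "\<lambda>x. x \<notin> elts \<beta> \<and> x \<in> elts \<beta>"] unfolding ae_conj by blast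
  qed
  have aeA: "A.ae (\<lambda>x. x \<in> elts A.X)" and aeB: "B.ae (\<lambda>x. x \<in> elts B.X)" by (auto intro: A.ae_all B.ae_all)
  have sp: "A.X = B.X"
    using Ord_linear[OF UnifD(2)[OF i U(1)] UnifD(2)[OF i U(2)]] nb[OF U(1)] nb[OF U(2)] 
      ae[OF A.X_in] ae[OF B.X_in] aeA aeB by blast
  have "Y \<in> elts A \<longleftrightarrow> Y \<in> elts B" for Y
  proof (cases "Y \<in> M \<and> elts Y \<subseteq> elts A.X")
    case True
    then have 1: "elts Y = {x\<in>elts A.X. x \<in> elts Y}" by blast
    show ?thesis
      using ae A.ae_set[OF 1] B.ae_set[of Y "\<lambda>x. x \<in> elts Y"] 1 True sp by simp
  next
    case False
    have "Y \<in> M \<and> elts Y \<subseteq> elts A.X" if "Y \<in> elts A" using that A.Z_sub[OF that] innerD[OF i A.Z_in that] by simp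
    moreover have "Y \<in> M \<and> elts Y \<subseteq> elts A.X" if "Y \<in> elts B" using that B.Z_sub[OF that] innerD[OF i B.Z_in that] sp by simp
    ultimately show ?thesis using False by blast
  qed
  then have "elts A = elts B" by blast
  then show ?thesis by (simp add: elts_eq_iff)
qed

lemma Unif_cc: "A \<in> Unif M \<Longrightarrow> cc_ultrafilter M A"
  unfolding Unif_def by simp

text \<open>Between distinct ultrafilters the seed order implies the strict Ketonen relation, which
  is asymmetric.\<close>

lemma seed_le_antisym:
  assumes i: "inner M" and U: "A \<in> Unif M" "B \<in> Unif M" and le: "seed_le M A B" "seed_le M B A"
  shows "A = B"
proof (rule ccontr)
  assume ne: "A \<noteq> B"
  have "ket M A B" if U: "A \<in> Unif M" "B \<in> Unif M" and le: "seed_le M A B" and ne: "A \<noteq> B" for A B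
    using le comparison_eq[OF i U] comparison_less_ket[OF i Unif_cc[OF U(1)] Unif_cc[OF U(2)]] ne unfolding seed_le_def by blast
  then show False using ket_asym[OF i U] U le ne by blast
qed

lemma seed_Ord:
  assumes i: "inner M" and A: "A \<in> Unif M" and Z: "cc_ultrafilter (Ult M A) Z"
  shows "Ord (ult_emb (Ult M A) Z (ult_id M A))"
proof -
  interpret ultrapower M A by (rule UnifD(1)[OF i A])
  interpret Z: ultrapower "Ult M A" Z by (rule inner_ultrapower_Ult[OF Z])
  have "Ord seed \<longleftrightarrow> ae (\<lambda>x. Ord (ap (lam X (\<lambda>x. x)) x))"
    unfolding seed_cl by (rule transfer1[where P = "\<lambda>M x. Ord x", OF _ id_Fn]) (rule D_intros)+
  moreover have "ae (\<lambda>x. Ord (ap (lam X (\<lambda>x. x)) x))"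
    by (rule ae_all) (simp add: ap_id Ord_elt[OF UnifD(2)[OF i A]])
  ultimately show ?thesis using Z.j_Ord[OF seed_in] by simp
qed

text \<open>The images of the seeds in a common model are comparable ordinals. Excluding a Ketonen
  predecessor thus becomes an inequality in the seed order.\<close>

lemma seed_le_or_ket:
  assumes i: "inner M" and UA: "ultrapower_axiom M" and U: "A \<in> Unif M" "B \<in> Unif M"
  shows "seed_le M A B \<or> ket M B A"
proof -
  obtain Z0 Z1 where c: "comparison M A B Z0 Z1"
    using UA Unif_cc[OF U(1)] Unif_cc[OF U(2)] unfolding ultrapower_axiom_def by blast
  have "Ord (ult_emb (Ult M A) Z0 (ult_id M A))" "Ord (ult_emb (Ult M B) Z1 (ult_id M B))"
    using seed_Ord[OF i] U c by (auto simp: comparison_def)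
  from Ord_linear[OF this] show ?thesis
    using c comparison_less_ket[OF i Unif_cc[OF U(2)] Unif_cc[OF U(1)] comparison_sym[OF c]] unfolding seed_le_def by blast
qed

section \<open>Limits and translations\<close>

lemma small_Int_elts[simp]: "small A \<Longrightarrow> small (A \<inter> elts y)"
  unfolding small_def[of A] using small_Int by blast

lemma small_UNIV: "D {UNIV} UNIV (\<lambda>N e. P (e 0)) \<Longrightarrow> elts (vset {x\<in>elts a. P x}) = {x\<in>elts a. P x}"
  using small_sepU by (rule elts_vset)

text \<open>The bound is the supremum of the ordinals among the values of a representative. The
  values are ordinals only almost everywhere, so the others are discarded.\<close>

lemma ordinal_bound:
  assumes U: "ultrapower UNIV U" and d: "d \<in> Ult UNIV U" "Ord d"
  shows "\<exists>\<delta>. Ord \<delta> \<and> elts d \<subseteq> elts (ult_emb UNIV U \<delta>)"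
proof -
  interpret ultrapower UNIV U by (rule U)
  obtain f where f: "f \<in> Fn" "d = cl f" using d(1) by (auto simp: Ult_iff)
  have "\<exists>z\<in>UNIV. elts z = ap f ` elts X" by (rule image_inner[OF inner_UNIV UNIV_I]) (rule D_intros)+
  then obtain B where B: "elts B = ap f ` elts X" by blast
  have "\<exists>z\<in>UNIV. elts z = {y\<in>elts B. Ord y}" by (rule sep[OF inner_UNIV UNIV_I]) (rule D_intros)+
  then obtain S where S: "elts S = {y\<in>elts B. Ord y}" by blast
  have "Ord (Uni S)" unfolding Ord_def
  proof (intro conjI ballI)
    show "transitive (Uni S)" unfolding transitive_def
    proof (intro ballI subsetI)
      fix y z assume y: "y \<in> elts (Uni S)" and z: "z \<in> elts y"
      then obtain a where a: "a \<in> elts S" "y \<in> elts a" by auto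
      then have "Ord a" using S by simp
      then show "z \<in> elts (Uni S)" using Ord_trans a z by auto
    qed
    show "transitive y" if "y \<in> elts (Uni S)" for y using that S Ord_elt unfolding Ord_def by auto
  qed
  moreover have "elts (cl f) \<subseteq> elts (j (Uni S))"
  proof -
    have "Ord (cl f) \<longleftrightarrow> ae (\<lambda>x. Ord (ap f x))"
      by (rule transfer1[where P = "\<lambda>M x. Ord x", OF _ f(1)]) (rule D_intros)+
    then have "ae (\<lambda>x. Ord (ap f x))" using d f by simp
    then have "ae (\<lambda>x. elts (ap f x) \<subseteq> elts (ap (const (Uni S)) x))"
      by (rule ae_mono) (use S B ap_const[OF UNIV_I] in auto)
    moreover have "elts (cl f) \<subseteq> elts (cl (const (Uni S))) \<longleftrightarrow> ae (\<lambda>x. elts (ap f x) \<subseteq> elts (ap (const (Uni S)) x))"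
      by (rule transfer2[where P = "\<lambda>M x y. elts x \<subseteq> elts y", OF _ f(1) const_Fn[OF UNIV_I]]) (rule D_intros)+
    ultimately show ?thesis unfolding j_cl by simp
  qed
  ultimately show ?thesis using f by blast
qed

lemma limit_indexI:
  assumes "Ord \<delta>" "elts d \<subseteq> elts (ult_emb UNIV U \<delta>)" "\<And>\<gamma>. \<gamma> \<in> elts \<delta> \<Longrightarrow> \<not> elts d \<subseteq> elts (ult_emb UNIV U \<gamma>)"
  shows "limit_index U d = \<delta>"
  unfolding limit_index_def
proof (rule the_equality)
  fix x assume x: "Ord x \<and> elts d \<subseteq> elts (ult_emb UNIV U x) \<and> (\<forall>\<gamma>\<in>elts x. \<not> elts d \<subseteq> elts (ult_emb UNIV U \<gamma>))"
  then show "x = \<delta>" using Ord_linear[of x \<delta>] assms by blast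
qed (use assms in blast)

lemma limit_index:
  assumes U: "ultrapower UNIV U" and d: "d \<in> Ult UNIV U" "Ord d"
  shows "Ord (limit_index U d)" "elts d \<subseteq> elts (ult_emb UNIV U (limit_index U d))"
proof -
  interpret ultrapower UNIV U by (rule U)
  obtain \<delta>0 where "Ord \<delta>0" "elts d \<subseteq> elts (j \<delta>0)" using ordinal_bound[OF U d] by blast
  from Ord_least[of \<delta>0 "\<lambda>\<delta>. elts d \<subseteq> elts (j \<delta>)", OF this]
  obtain \<delta> where "Ord \<delta>" "elts d \<subseteq> elts (j \<delta>)" "\<forall>\<gamma>\<in>elts \<delta>. \<not> elts d \<subseteq> elts (j \<gamma>)"
    using D_subset[OF DF_const[OF UNIV_I] DF_j] by blast
  moreover from this have "limit_index U d = \<delta>" by (intro limit_indexI) auto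
  ultimately show "Ord (limit_index U d)" "elts d \<subseteq> elts (ult_emb UNIV U (limit_index U d))" by auto
qed

lemma elts_ult_limit:
  assumes U: "ultrapower UNIV U" and W': "W' \<in> Unif (Ult UNIV U)"
  shows "elts (ult_limit U W') =
    {Y. elts Y \<subseteq> elts (limit_index U (space W')) \<and> ae_in W' (\<lambda>x. x \<in> elts (ult_emb UNIV U Y))}"
proof -
  interpret ultrapower UNIV U by (rule U)
  interpret W': ultrapower "Ult UNIV U" W' by (rule UnifD(1)[OF inner_Ult W'])
  let ?\<delta> = "limit_index U (space W')"
  obtain P where P: "elts P = {Y. elts Y \<subseteq> elts ?\<delta>}" using powerset[of ?\<delta>] by blast
  have "small {Y\<in>elts P. vset (elts (j Y) \<inter> elts (space W')) \<in> elts W'}"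
    by (rule small_sepU) (rule DF1[OF DF_j] D_intros)+
  moreover have "{Y\<in>elts P. vset (elts (j Y) \<inter> elts (space W')) \<in> elts W'} =
    {Y. elts Y \<subseteq> elts ?\<delta> \<and> vset (elts (j Y) \<inter> elts (space W')) \<in> elts W'}" unfolding P by blast
  ultimately have "elts (ult_limit U W') = {Y. elts Y \<subseteq> elts ?\<delta> \<and> vset (elts (j Y) \<inter> elts (space W')) \<in> elts W'}"
    unfolding ult_limit_def by simp
  then show ?thesis using W'.ae_mem_Int[OF j_in[OF UNIV_I]] by simp
qed

text \<open>The index ordinal belongs to the limit and includes all its members, so it is the space
  of \<open>W\<close>. In the last clause \<open>Y\<close> is arbitrary and is cut down to that
  space before the embedding is applied.\<close>

lemma ult_limit_space:
  assumes U: "ultrapower UNIV U" and W': "W' \<in> Unif (Ult UNIV U)" and W: "ultrapower UNIV W" and l: "ult_limit U W' = W"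
  shows "limit_index U (space W') = space W" "elts (space W') \<subseteq> elts (ult_emb UNIV U (space W))"
    "ae_in W (\<lambda>x. x \<in> elts Y) \<longleftrightarrow> ae_in W' (\<lambda>x. x \<in> elts (ult_emb UNIV U (vset (elts Y \<inter> elts (space W)))))"
proof -
  interpret ultrapower UNIV U by (rule U)
  interpret W': ultrapower "Ult UNIV U" W' by (rule UnifD(1)[OF inner_Ult W'])
  interpret W: ultrapower UNIV W by (rule W)
  let ?\<delta> = "limit_index U (space W')"
  note li = limit_index[OF U W'.X_in UnifD(2)[OF inner_Ult W']]
  note e = elts_ult_limit[OF U W', unfolded l]
  have "?\<delta> \<in> elts W" unfolding e using li(2) by (auto intro: W'.ae_all)
  then have "elts ?\<delta> \<subseteq> elts (space W)" by (rule W.Z_sub)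
  moreover have "elts (space W) \<subseteq> elts ?\<delta>" using W.X_mem unfolding e by blast
  ultimately show \<delta>: "?\<delta> = space W" using elts_eq_iff by blast
  then show "elts (space W') \<subseteq> elts (j (space W))" using li(2) by simp
  show "ae_in W (\<lambda>x. x \<in> elts Y) \<longleftrightarrow> ae_in W' (\<lambda>x. x \<in> elts (j (vset (elts Y \<inter> elts (space W)))))"
    unfolding W.ae_mem_Int[OF UNIV_I] e \<delta> by simp
qed

text \<open>The embedding \<open>[f]\<^sub>W \<mapsto> [j\<^sub>U(f)]\<^bsub>W'\<^esub>\<close> of \<open>M\<^sub>W\<close> into the \<open>M\<^sub>U\<close>-ultrapower by \<open>W'\<close> is amenable to \<open>M\<^sub>W\<close> below \<open>[id]\<^sub>W\<close>.\<close>

definition amenable :: "'v::zfc \<Rightarrow> 'v \<Rightarrow> 'v \<Rightarrow> bool" where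
  "amenable U W W' \<longleftrightarrow> (\<forall>E\<in>Ult UNIV U. \<exists>D\<in>Ult UNIV W. \<forall>f.
    function_on (space W) f \<and> (\<forall>\<eta>\<in>elts (space W). elts (ap f \<eta>) \<subseteq> elts \<eta>) \<longrightarrow>
    (ult_class UNIV W f \<in> elts D \<longleftrightarrow> ae_in W' (\<lambda>\<eta>. ap (ult_emb UNIV U f) \<eta> \<in> elts (ap E \<eta>))))"

lemma Unif_UNIV: "W \<in> Unif UNIV \<Longrightarrow> ultrapower UNIV W"
  by (rule UnifD(1)[OF inner_UNIV])

text \<open>For the function f(\<eta>) = Y \<inter> \<eta> on the space of \<open>W\<close>,
  j_U(f)(\<eta>) is j_U(Y) \<inter> \<eta>. A witness \<open>E\<close> for the Ketonen relation in
  M_U decides j_U(Y) through these values, and amenability replaces \<open>E\<close> by a set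
  \<open>D\<close> of M_W that decides the same through [f]_W. A representative of \<open>D\<close>
  would then put \<open>W\<close> below itself.\<close>

lemma amenable_not_ket:
  assumes U: "U \<in> Unif UNIV" and W: "W \<in> Unif UNIV" and W': "W' \<in> Unif (Ult UNIV U)" "ult_limit U W' = W"
    and am: "amenable U W W'" and W'': "W'' \<in> Unif (Ult UNIV U)" "ult_limit U W'' = W"
  shows "\<not> ket (Ult UNIV U) W'' W'"
proof
  interpret U: ultrapower UNIV U by (rule Unif_UNIV[OF U])
  interpret W: ultrapower UNIV W by (rule Unif_UNIV[OF W])
  interpret W': ultrapower "Ult UNIV U" W' by (rule UnifD(1)[OF U.inner_Ult W'(1)])
  note l' = ult_limit_space[OF U.ultrapower_axioms W'(1) W.ultrapower_axioms W'(2)]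
  note l'' = ult_limit_space[OF U.ultrapower_axioms W''(1) W.ultrapower_axioms W''(2)]
  assume "ket (Ult UNIV U) W'' W'"
  then obtain E where E: "E \<in> Ult UNIV U"
    "\<And>Y. Y \<in> Ult UNIV U \<Longrightarrow> ae_in W'' (\<lambda>x. x \<in> elts Y) \<longleftrightarrow> W'.ae (\<lambda>\<eta>. vset (elts Y \<inter> elts \<eta>) \<in> elts (ap E \<eta>))"
    unfolding ket_def by blast
  obtain D where D: "D \<in> Ult UNIV W" "\<And>f. function_on W.X f \<Longrightarrow> (\<forall>\<eta>\<in>elts W.X. elts (ap f \<eta>) \<subseteq> elts \<eta>) \<Longrightarrow>
    W.cl f \<in> elts D \<longleftrightarrow> W'.ae (\<lambda>\<eta>. ap (U.j f) \<eta> \<in> elts (ap E \<eta>))"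
    using am E(1) unfolding amenable_def by blast
  obtain G where G: "G \<in> W.Fn" "D = W.cl G" using D(1) by (auto simp: W.Ult_iff)
  have "ket UNIV W W" unfolding ket_def
  proof (intro bexI[of _ G] ballI UNIV_I)
    fix Y :: 'a
    let ?Y = "vset (elts Y \<inter> elts W.X)"
    let ?f = "lam W.X (\<lambda>\<eta>. vset (elts ?Y \<inter> elts \<eta>))"
    have DF: "DF {UNIV} UNIV (\<lambda>N e. vset (elts ?Y \<inter> elts (e 0)))" by (rule D_intros)+
    note f = W.lam_Fn[OF DF]
    \<comment> \<open>\<open>?f\<close> is controlled only on \<open>W.X\<close>, so
      \<open>\<eta>\<close> is represented by a function with values in \<open>W.X\<close> almost
      everywhere.\<close>
    have jf: "ap (U.j ?f) \<eta> = vset (elts (U.j ?Y) \<inter> elts \<eta>)" if \<eta>: "\<eta> \<in> elts (U.j W.X)" for \<eta>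
    proof -
      obtain g where g: "g \<in> U.Fn" "\<eta> = U.cl g" "U.ae (\<lambda>x. ap g x \<in> elts W.X)"
        using \<eta> U.cl_mem_j[OF _ UNIV_I] U.Ult_transitive[OF U.j_in[OF UNIV_I] \<eta>] by (auto simp: U.Ult_iff)
      have "ap (U.j ?f) \<eta> = U.cl (lam U.X (\<lambda>z. ap ?f (ap g z)))" unfolding g by (rule U.ap_j_cl[OF UNIV_I g(1)])
      also have "\<dots> = U.cl (lam U.X (\<lambda>z. vset (elts (ap (U.const ?Y) z) \<inter> elts (ap g z))))"
      proof (rule U.cl_eqI)
        have d1: "DF {UNIV} UNIV (\<lambda>N e. ap ?f (ap g (e 0)))" by (rule D_intros)+
        have d2: "DF {UNIV} UNIV (\<lambda>N e. vset (elts (ap (U.const ?Y) (e 0)) \<inter> elts (ap g (e 0))))"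
          by (rule D_intros)+
        show "lam U.X (\<lambda>z. ap ?f (ap g z)) \<in> U.Fn" by (rule U.lam_Fn[OF d1])
        show "lam U.X (\<lambda>z. vset (elts (ap (U.const ?Y) z) \<inter> elts (ap g z))) \<in> U.Fn" by (rule U.lam_Fn[OF d2])
        show "U.ae (\<lambda>x. ap (lam U.X (\<lambda>z. ap ?f (ap g z))) x = ap (lam U.X (\<lambda>z. vset (elts (ap (U.const ?Y) z) \<inter> elts (ap g z)))) x)"
          by (rule U.ae_mono[OF g(3)]) (simp only: U.lam_Fn(2)[OF d1] U.lam_Fn(2)[OF d2] f(2) U.ap_const[OF UNIV_I])
      qed
      also have "\<dots> = vset (elts (U.j ?Y) \<inter> elts \<eta>)" unfolding g U.j_cl
        by (rule U.transfer_F2(1)[where F = "\<lambda>M c d. vset (elts c \<inter> elts d)", OF _ U.const_Fn[OF UNIV_I] g(1), symmetric]) (rule D_intros)+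
      finally show ?thesis .
    qed
    have "W.ae (\<lambda>x. x \<in> elts Y) \<longleftrightarrow> ae_in W'' (\<lambda>x. x \<in> elts (U.j ?Y))" by (rule l''(3))
    also have "\<dots> \<longleftrightarrow> W'.ae (\<lambda>\<eta>. vset (elts (U.j ?Y) \<inter> elts \<eta>) \<in> elts (ap E \<eta>))" by (rule E(2)[OF U.j_in[OF UNIV_I]])
    also have "\<dots> \<longleftrightarrow> W'.ae (\<lambda>\<eta>. ap (U.j ?f) \<eta> \<in> elts (ap E \<eta>))" by (rule W'.ae_cong) (use jf l'(2) in auto)
    also have "\<dots> \<longleftrightarrow> W.cl ?f \<in> elts D" by (rule D(2)[symmetric]) (use W.FnD(2)[OF f(1)] f(2) in auto)
    also have "\<dots> \<longleftrightarrow> W.ae (\<lambda>\<eta>. ap ?f \<eta> \<in> elts (ap G \<eta>))" unfolding G(2) by (rule W.cl_mem[OF f(1) G(1)])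
    also have "\<dots> \<longleftrightarrow> W.ae (\<lambda>\<eta>. vset (elts Y \<inter> elts \<eta>) \<in> elts (ap G \<eta>))"
    proof (rule W.ae_cong)
      fix \<eta> assume \<eta>: "\<eta> \<in> elts W.X"
      then have "elts \<eta> \<subseteq> elts W.X" using Ord_trans[OF UnifD(2)[OF inner_UNIV W]] by blast
      then have "elts ?Y \<inter> elts \<eta> = elts Y \<inter> elts \<eta>" by auto
      then show "ap ?f \<eta> \<in> elts (ap G \<eta>) \<longleftrightarrow> vset (elts Y \<inter> elts \<eta>) \<in> elts (ap G \<eta>)" by (simp only: f(2)[OF \<eta>])
    qed
    finally show "W.ae (\<lambda>x. x \<in> elts Y) \<longleftrightarrow> W.ae (\<lambda>\<eta>. vset (elts Y \<inter> elts \<eta>) \<in> elts (ap G \<eta>))" .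
  qed
  then show False using ket_irrefl[OF inner_UNIV W] by blast
qed

text \<open>No ultrafilter with the same limit is Ketonen below one with the amenability property,
  so by the dichotomy the latter is the least in the seed order; antisymmetry identifies it with the
  definite description.\<close>

lemma t_trans_eq:
  assumes UA: "ultrapower_axiom (UNIV :: 'v::zfc set)" and U: "U \<in> Unif UNIV" and W: "W \<in> Unif UNIV"
    and W': "W' \<in> Unif (Ult UNIV U)" "ult_limit U W' = (W :: 'v)" and am: "amenable U W W'"
  shows "t_trans U W = W'"
    "W'' \<in> Unif (Ult UNIV U) \<Longrightarrow> ult_limit U W'' = W \<Longrightarrow> seed_le (Ult UNIV U) W' W''"
proof -
  interpret U: ultrapower UNIV U by (rule Unif_UNIV[OF U])
  have UA': "ultrapower_axiom (Ult UNIV U)" using UA by (simp add: U.ultrapower_axiom_Ult)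
  have min: "seed_le (Ult UNIV U) W' W''" if "W'' \<in> Unif (Ult UNIV U)" "ult_limit U W'' = W" for W''
    using seed_le_or_ket[OF U.inner_Ult UA' W'(1) that(1)] amenable_not_ket[OF U W W' am that] by blast
  then show "W'' \<in> Unif (Ult UNIV U) \<Longrightarrow> ult_limit U W'' = W \<Longrightarrow> seed_le (Ult UNIV U) W' W''" .
  show "t_trans U W = W'" unfolding t_trans_def
  proof (rule the_equality)
    show "W' \<in> Unif (Ult UNIV U) \<and> ult_limit U W' = W \<and>
      (\<forall>W''\<in>Unif (Ult UNIV U). ult_limit U W'' = W \<longrightarrow> seed_le (Ult UNIV U) W' W'')" using W' min by blast
    fix V assume V: "V \<in> Unif (Ult UNIV U) \<and> ult_limit U V = W \<and>
      (\<forall>W''\<in>Unif (Ult UNIV U). ult_limit U W'' = W \<longrightarrow> seed_le (Ult UNIV U) V W'')"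
    then show "V = W'" using seed_le_antisym[OF U.inner_Ult, of V W'] W' min by blast
  qed
qed

text \<open>\<open>W'\<close> is the ultrafilter derived from \<open>i\<^sub>0\<close> using \<open>i\<^sub>1([id]\<^sub>W)\<close>, where \<open>(i\<^sub>0, i\<^sub>1)\<close> is the comparison.\<close>

lemma translation_of_comparison:
  assumes U: "U \<in> Unif UNIV" and W: "W \<in> Unif UNIV" and c: "comparison UNIV U W Z0 Z1"
  shows "\<exists>W'\<in>Unif (Ult UNIV U). ult_limit U W' = W \<and> amenable U W W' \<and>
    (\<forall>Y\<in>Ult UNIV U. ae_in W' (\<lambda>x. x \<in> elts Y) \<longleftrightarrow>
      ult_emb (Ult UNIV W) Z1 (ult_id UNIV W) \<in> elts (ult_emb (Ult UNIV U) Z0 Y))"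
proof -
  interpret U: ultrapower UNIV U by (rule Unif_UNIV[OF U])
  interpret W: ultrapower UNIV W by (rule Unif_UNIV[OF W])
  interpret i0: ultrapower "Ult UNIV U" Z0 using U.inner_ultrapower_Ult c by (simp add: comparison_def)
  interpret i1: ultrapower "Ult UNIV W" Z1 using W.inner_ultrapower_Ult c by (simp add: comparison_def)
  have N: "Ult (Ult UNIV U) Z0 = Ult (Ult UNIV W) Z1" and comm: "i0.j (U.j x) = i1.j (W.j x)" for x
    using c by (auto simp: comparison_def)
  define e where "e = i1.j W.seed"
  have e1: "e \<in> Ult (Ult UNIV W) Z1" unfolding e_def by (rule i1.j_in[OF W.seed_in])
  then have "e \<in> Ult (Ult UNIV U) Z0" using N by simp
  then obtain g where g: "g \<in> i0.Fn" "e = i0.cl g" unfolding i0.Ult_iff by blast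
  have seedW: "W.seed \<in> elts (W.j W.X)" unfolding W.seed_mem_j[OF UNIV_I] by (rule W.ae_all)
  have mem: "e \<in> elts (i0.j Y) \<longleftrightarrow> i0.ae (\<lambda>z. ap g z \<in> elts Y)" if "Y \<in> Ult UNIV U" for Y
    unfolding g by (rule i0.cl_mem_j[OF g(1) that])
  have jWX: "e \<in> elts (i0.j (U.j Y)) \<longleftrightarrow> W.seed \<in> elts (W.j Y)" for Y
    unfolding comm e_def by (rule i1.j_mem[OF W.seed_in W.j_in[OF UNIV_I]])
  \<comment> \<open>\<open>d\<close>, the space of the future \<open>W'\<close>, is the least
    ordinal whose image under \<open>i0.j\<close> contains \<open>e\<close>; leastness will give
    uniformity. Unfolded in terms of \<open>Z0\<close> and \<open>g\<close>, the condition is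
    definable over the universe, as \<open>Ord_least\<close> demands.\<close>
  let ?P = "\<lambda>\<gamma>. \<exists>S\<in>elts Z0. \<forall>z\<in>elts S. ap g z \<in> elts \<gamma>"
  have P: "?P \<gamma> \<longleftrightarrow> e \<in> elts (i0.j \<gamma>)" if "\<gamma> \<in> Ult UNIV U" for \<gamma>
    using mem[OF that] by (simp add: i0.ae_def)
  have OX: "Ord (U.j W.X)" using UnifD(2)[OF inner_UNIV W] U.j_Ord by simp
  have PX: "?P (U.j W.X)" using P[OF U.j_in[OF UNIV_I]] jWX seedW by simp
  have DP: "D {UNIV} UNIV (\<lambda>N e. ?P (e 0))" by (rule D_intros)+
  have "\<exists>d. Ord d \<and> ?P d \<and> (\<forall>c\<in>elts d. \<not> ?P c)" by (rule Ord_least[of "U.j W.X" ?P, OF OX PX DP])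
  then obtain d where d: "Ord d" "?P d" "\<forall>c\<in>elts d. \<not> ?P c" by (elim exE conjE)
  have dX: "elts d \<subseteq> elts (U.j W.X)" 
  proof -
    have "U.j W.X \<notin> elts d" using d(3) PX by blast
    then show ?thesis using Ord_linear[OF d(1) OX] Ord_trans[OF OX] by blast
  qed
  have dU: "d \<in> Ult UNIV U"
    using dX Ord_subset_iff[OF d(1) OX] U.j_in[OF UNIV_I, of W.X] U.Ult_transitive[of "U.j W.X" d] by auto
  have ed: "e \<in> elts (i0.j d)" using P[OF dU] d(2) by simp
  have gd: "i0.ae (\<lambda>z. ap g z \<in> elts d)" using mem[OF dU] ed by simp
  obtain W' where W': "W' \<in> Ult UNIV U" "elts W' = {Y\<in>Ult UNIV U. elts Y \<subseteq> elts d \<and> e \<in> elts (i0.j Y)}"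
  proof -
    have "e \<in> Ult (Ult UNIV U) Z0" using e1 N by simp
    from that i0.derived(1)[OF this dU] show ?thesis by blast
  qed
  have W'2: "elts W' = {Y\<in>Ult UNIV U. elts Y \<subseteq> elts d \<and> i0.ae (\<lambda>z. ap g z \<in> elts Y)}"
    unfolding W'(2) using mem by auto
  note pf = i0.pushforward[OF U.inner_Ult subset_refl g(1) dU gd W'(1) W'2]
  have ae: "ae_in W' (\<lambda>x. x \<in> elts Y) \<longleftrightarrow> e \<in> elts (i0.j Y)" if "Y \<in> Ult UNIV U" for Y
    using pf(3)[OF that] mem[OF that] by simp
  have un: "W' \<in> Unif (Ult UNIV U)" unfolding Unif_def
  proof (intro CollectI conjI pf(1) ballI)
    show "Ord (space W')" using d pf by simp
    fix \<beta> assume "\<beta> \<in> elts (space W')"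
    then have \<beta>: "\<beta> \<in> elts d" using pf by simp
    have \<beta>U: "\<beta> \<in> Ult UNIV U" by (rule U.Ult_transitive[OF dU \<beta>])
    have "D {Ult UNIV U} (Ult UNIV U) (\<lambda>N e. ap g (e 0) \<in> elts \<beta>)"
      by (rule i0.FnD(1)[OF g(1)] \<beta>U D_intros)+
    from i0.ae_not[OF this] have "i0.ae (\<lambda>z. ap g z \<notin> elts \<beta>)" using d(3) \<beta> by (simp add: i0.ae_def)
    then have "i0.ae (\<lambda>z. ap g z \<in> elts (vset (elts d - elts \<beta>)))" using gd by (simp add: i0.ae_conj)
    moreover have "vset (elts d - elts \<beta>) \<in> Ult UNIV U"
      by (rule inner_in[OF U.inner_Ult]) (rule dU \<beta>U D_intros)+
    ultimately show "vset (elts (space W') - elts \<beta>) \<in> elts W'" unfolding pf(2) W'2 by simp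
  qed
  have li: "limit_index U (space W') = W.X" unfolding pf(2)
  proof (rule limit_indexI)
    show "Ord W.X" by (rule UnifD(2)[OF inner_UNIV W])
    show "elts d \<subseteq> elts (U.j W.X)" by (rule dX)
    fix \<gamma> assume \<gamma>: "\<gamma> \<in> elts W.X"
    show "\<not> elts d \<subseteq> elts (U.j \<gamma>)"
    proof
      assume "elts d \<subseteq> elts (U.j \<gamma>)"
      then have "elts (i0.j d) \<subseteq> elts (i0.j (U.j \<gamma>))" using i0.j_subset[OF dU U.j_in[OF UNIV_I]] by simp
      then have "W.seed \<in> elts (W.j \<gamma>)" using ed jWX by blast
      then have "W.ae (\<lambda>x. x \<in> elts \<gamma>)" using W.seed_mem_j[OF UNIV_I] by simp
      moreover have "W.ae (\<lambda>x. x \<notin> elts \<gamma>)" unfolding W.ae_def using UnifD(3)[OF inner_UNIV W \<gamma>]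
        by (intro bexI[of _ "vset (elts W.X - elts \<gamma>)"]) auto
      ultimately have "W.ae (\<lambda>x. x \<in> elts \<gamma> \<and> x \<notin> elts \<gamma>)" unfolding W.ae_conj by blast
      then show False using W.ae_ex by blast
    qed
  qed
  have "Y \<in> elts (ult_limit U W') \<longleftrightarrow> Y \<in> elts W" for Y
  proof -
    have "Y \<in> elts (ult_limit U W') \<longleftrightarrow> elts Y \<subseteq> elts W.X \<and> W.ae (\<lambda>x. x \<in> elts Y)"
      unfolding elts_ult_limit[OF U.ultrapower_axioms un] li
      using ae[OF U.j_in[OF UNIV_I]] jWX W.seed_mem_j[OF UNIV_I] by simp
    also have "\<dots> \<longleftrightarrow> Y \<in> elts W"
      using W.ae_set[of Y "\<lambda>x. x \<in> elts Y", OF _ UNIV_I] W.Z_sub[of Y] by blast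
    finally show ?thesis .
  qed
  then have lim: "ult_limit U W' = W" using elts_eq_iff by blast
  have "amenable U W W'" unfolding amenable_def
  proof (intro ballI)
    fix E assume E: "E \<in> Ult UNIV U"
    \<comment> \<open>\<open>e'\<close> is computed in an ultrapower of M_U, but it lies in the
      common target of the comparison. Its pullback along \<open>i1.j\<close> to the subsets of the
      seed of \<open>W\<close> is therefore a set of M_W, which is the required
      \<open>D\<close>.\<close>
    define e' where "e' = ap (i0.j E) e"
    have e'c: "e' = i0.cl (lam i0.X (\<lambda>z. ap E (ap g z)))" unfolding e'_def g by (rule i0.ap_j_cl[OF E g(1)])
    have dE: "DF {Ult UNIV U} (Ult UNIV U) (\<lambda>N e. ap E (ap g (e 0)))" by (rule E i0.FnD(1)[OF g(1)] D_intros)+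
    have "e' \<in> Ult (Ult UNIV W) Z1" unfolding e'c N[symmetric] by (rule i0.cl_Ult[OF i0.lam_Fn(1)[OF dE]])
    then obtain D where D: "D \<in> Ult UNIV W" "elts D = {x\<in>Ult UNIV W. elts x \<subseteq> elts W.seed \<and> i1.j x \<in> elts e'}"
      using i1.derived(2)[OF _ W.seed_in] by blast
    show "\<exists>D\<in>Ult UNIV W. \<forall>f. function_on W.X f \<and> (\<forall>\<eta>\<in>elts W.X. elts (ap f \<eta>) \<subseteq> elts \<eta>) \<longrightarrow>
      (W.cl f \<in> elts D \<longleftrightarrow> ae_in W' (\<lambda>\<eta>. ap (U.j f) \<eta> \<in> elts (ap E \<eta>)))"
    proof (intro bexI[OF _ D(1)] allI impI, elim conjE)
      fix f assume fo: "function_on W.X f" and fs: "\<forall>\<eta>\<in>elts W.X. elts (ap f \<eta>) \<subseteq> elts \<eta>"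
      then have f: "f \<in> W.Fn" by (simp add: W.Fn_def)
      have sub: "elts (W.cl f) \<subseteq> elts W.seed"
      proof -
        have "elts (W.cl f) \<subseteq> elts W.seed \<longleftrightarrow> W.ae (\<lambda>x. elts (ap f x) \<subseteq> elts (ap (lam W.X (\<lambda>x. x)) x))"
          unfolding W.seed_cl by (rule W.transfer2[where P = "\<lambda>M x y. elts x \<subseteq> elts y", OF _ f W.id_Fn]) (rule D_intros)+
        moreover have "W.ae (\<lambda>x. elts (ap f x) \<subseteq> elts (ap (lam W.X (\<lambda>x. x)) x))"
          by (rule W.ae_all) (use fs W.ap_id in auto)
        ultimately show ?thesis by blast
      qed
      have jc: "i1.j (W.cl f) = ap (i0.j (U.j f)) e"
        unfolding W.cl_rep[OF f] comm e_def by (rule i1.j_ap[OF W.j_in[OF UNIV_I] W.seed_in, symmetric])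
      have jf: "U.j f \<in> Ult UNIV U" by (rule U.j_in[OF UNIV_I])
      have df: "DF {Ult UNIV U} (Ult UNIV U) (\<lambda>N e. ap (U.j f) (ap g (e 0)))" by (rule jf i0.FnD(1)[OF g(1)] D_intros)+
      have "\<exists>z\<in>Ult UNIV U. elts z = {\<eta>\<in>elts d. ap (U.j f) \<eta> \<in> elts (ap E \<eta>)}"
        by (rule sep[OF U.inner_Ult dU]) (rule E jf D_intros)+
      then obtain Y where Y: "Y \<in> Ult UNIV U" "elts Y = {\<eta>\<in>elts d. ap (U.j f) \<eta> \<in> elts (ap E \<eta>)}" by (elim bexE)
      interpret W': ultrapower "Ult UNIV U" W' by (rule UnifD(1)[OF U.inner_Ult un])
      have "ae_in W' (\<lambda>\<eta>. ap (U.j f) \<eta> \<in> elts (ap E \<eta>)) \<longleftrightarrow> W'.ae (\<lambda>\<eta>. \<eta> \<in> elts Y)"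
        by (rule W'.ae_cong) (simp add: Y pf)
      also have "\<dots> \<longleftrightarrow> i0.ae (\<lambda>z. ap g z \<in> elts Y)" by (rule pf(3)[OF Y(1)])
      also have "\<dots> \<longleftrightarrow> i0.ae (\<lambda>z. ap (U.j f) (ap g z) \<in> elts (ap E (ap g z)))"
        unfolding Y(2) mem_Collect_eq i0.ae_conj using gd by simp
      also have "\<dots> \<longleftrightarrow> i0.ae (\<lambda>z. ap (lam i0.X (\<lambda>z. ap (U.j f) (ap g z))) z \<in> elts (ap (lam i0.X (\<lambda>z. ap E (ap g z))) z))"
        by (rule i0.ae_cong) (simp add: i0.lam_Fn(2)[OF df] i0.lam_Fn(2)[OF dE])
      also have "\<dots> \<longleftrightarrow> i1.j (W.cl f) \<in> elts e'"
        unfolding jc e'c g(2) i0.ap_j_cl[OF jf g(1)] by (rule i0.cl_mem[OF i0.lam_Fn(1)[OF df] i0.lam_Fn(1)[OF dE], symmetric])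
      also have "\<dots> \<longleftrightarrow> W.cl f \<in> elts D" unfolding D(2) using sub W.cl_Ult[OF f] by simp
      finally show "W.cl f \<in> elts D \<longleftrightarrow> ae_in W' (\<lambda>\<eta>. ap (U.j f) \<eta> \<in> elts (ap E \<eta>))" by simp
    qed
  qed
  then show ?thesis using un lim ae unfolding e_def by blast
qed

lemma (in ultrapower) transfer3:
  assumes "D UNIV {} (\<lambda>M e. P M (e 0) (etl e 0) (etl (etl e) 0))" "f \<in> Fn" "g \<in> Fn" "h \<in> Fn"
  shows "P (Ult M Z) (cl f) (cl g) (cl h) \<longleftrightarrow> ae (\<lambda>x. P M (ap f x) (ap g x) (ap h x))"
  using transfer[OF assms(1), of "\<lambda>i. if i = 0 then f else if i = 1 then g else h"] assms(2-) by (simp add: etl_def)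

lemma lam_eqI: "function_on x J \<Longrightarrow> (\<And>y. y \<in> elts x \<Longrightarrow> app J y = F y) \<Longrightarrow> lam x F = J"
proof -
  assume J: "function_on x J" "\<And>y. y \<in> elts x \<Longrightarrow> app J y = F y"
  have "elts J = {opair y (F y) | y. y \<in> elts x}" using function_on_mem[OF J(1)] J(2) by auto
  then show ?thesis unfolding lam_def by (intro vset_eqI) simp
qed

section \<open>The translation s_W(U) and the internal relation\<close>

locale uniform_pair =
  fixes U W :: "'v::zfc"
  assumes U_Unif: "U \<in> Unif UNIV" and W_Unif: "W \<in> Unif UNIV"
begin

sublocale U: ultrapower UNIV U by (rule Unif_UNIV[OF U_Unif])
sublocale W: ultrapower UNIV W by (rule Unif_UNIV[OF W_Unif])

abbreviation "lam_U \<equiv> space U"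
abbreviation "lam_star \<equiv> sup_image W lam_U"
abbreviation "s \<equiv> s_trans W U"

lemma Ord_lam_U: "Ord lam_U" by (rule UnifD(2)[OF inner_UNIV U_Unif])

lemma elts_lam_star: "elts lam_star = (\<Union>\<xi>\<in>elts lam_U. insert (W.j \<xi>) (elts (W.j \<xi>)))"
proof -
  have *: "\<exists>z\<in>UNIV. elts z = (\<lambda>\<xi>. vset (insert (W.j \<xi>) (elts (W.j \<xi>)))) ` elts lam_U"
    by (rule image_inner[OF inner_UNIV UNIV_I]) (rule DF_insert W.DF_j)+
  then obtain z where z: "elts z = (\<lambda>\<xi>. vset (insert (W.j \<xi>) (elts (W.j \<xi>)))) ` elts lam_U" by blast
  have "elts (Uni z) = (\<Union>\<xi>\<in>elts lam_U. insert (W.j \<xi>) (elts (W.j \<xi>)))" unfolding elts_Uni z by simp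
  then show ?thesis unfolding sup_image_def by (metis elts_vset smallI)
qed

text \<open>The supremum is strict, so the image of a largest element of the space of
  \<open>U\<close> is included as well.\<close>

lemma j_lam_star: "W.j \<xi> \<in> elts lam_star \<longleftrightarrow> \<xi> \<in> elts lam_U"
proof
  assume "W.j \<xi> \<in> elts lam_star"
  then obtain \<zeta> where "\<zeta> \<in> elts lam_U" "W.j \<xi> = W.j \<zeta> \<or> W.j \<xi> \<in> elts (W.j \<zeta>)" unfolding elts_lam_star by blast
  then show "\<xi> \<in> elts lam_U" using W.j_mem[of \<xi> \<zeta>] W.j_inj[of \<xi> \<zeta>] Ord_trans[OF Ord_lam_U] by auto
qed (auto simp: elts_lam_star)

lemma Ord_lam_star: "Ord lam_star"
proof -
  have o: "Ord (W.j \<xi>)" if "\<xi> \<in> elts lam_U" for \<xi> using W.j_Ord[of \<xi>] Ord_elt[OF Ord_lam_U that] by simp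
  have "Ord y" if "y \<in> elts lam_star" for y using that o Ord_elt unfolding elts_lam_star by blast
  moreover have "transitive lam_star" unfolding transitive_def
  proof (intro ballI subsetI)
    fix y z assume "y \<in> elts lam_star" "z \<in> elts y"
    then obtain \<xi> where "\<xi> \<in> elts lam_U" "y = W.j \<xi> \<or> y \<in> elts (W.j \<xi>)" unfolding elts_lam_star by blast
    then show "z \<in> elts lam_star" using o Ord_trans[OF o] \<open>z \<in> elts y\<close> unfolding elts_lam_star by blast
  qed
  ultimately show ?thesis unfolding Ord_def by blast
qed

lemma lam_star_sub: "elts lam_star \<subseteq> elts (W.j lam_U)"
proof -
  have o: "Ord (W.j lam_U)" using W.j_Ord[of lam_U] Ord_lam_U by simp
  have "W.j \<xi> \<in> elts (W.j lam_U)" if "\<xi> \<in> elts lam_U" for \<xi> using W.j_mem[of \<xi> lam_U] that by simp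
  then show ?thesis unfolding elts_lam_star using Ord_trans[OF o] by blast
qed

lemma lam_star_in: "lam_star \<in> Ult UNIV W"
proof -
  have o: "Ord (W.j lam_U)" using W.j_Ord[of lam_U] Ord_lam_U by simp
  show ?thesis using lam_star_sub Ord_subset_iff[OF Ord_lam_star o] W.j_in[OF UNIV_I, of lam_U]
      W.Ult_transitive[of "W.j lam_U" lam_star] by auto
qed

lemma D_j_mem: "D {UNIV} UNIV (\<lambda>N e. W.j (e 0) \<in> elts Y)"
  by (rule W.DF_j D_intros)+

lemma elts_s: "elts s = {Y\<in>Ult UNIV W. elts Y \<subseteq> elts lam_star \<and> U.ae (\<lambda>\<xi>. W.j \<xi> \<in> elts Y)}"
proof -
  have ae: "vset {\<xi>. W.j \<xi> \<in> elts Y} \<in> elts U \<longleftrightarrow> U.ae (\<lambda>\<xi>. W.j \<xi> \<in> elts Y)" if Y: "elts Y \<subseteq> elts lam_star" for Y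
  proof -
    have "{\<xi>. W.j \<xi> \<in> elts Y} = {\<xi>\<in>elts lam_U. W.j \<xi> \<in> elts Y}" using Y j_lam_star by blast
    moreover have "elts (vset {\<xi>\<in>elts lam_U. W.j \<xi> \<in> elts Y}) = {\<xi>\<in>elts lam_U. W.j \<xi> \<in> elts Y}"
      by (rule small_UNIV[OF D_j_mem])
    from U.ae_set[OF this UNIV_I] have "U.ae (\<lambda>\<xi>. W.j \<xi> \<in> elts Y) \<longleftrightarrow> vset {\<xi>\<in>elts lam_U. W.j \<xi> \<in> elts Y} \<in> elts U" .
    ultimately show ?thesis by simp
  qed
  obtain P where P: "P \<in> Ult UNIV W" "elts P = {y\<in>Ult UNIV W. elts y \<subseteq> elts lam_star}"
    using inner_Pow[OF W.inner_Ult lam_star_in] by blast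
  have "small {Y\<in>elts P. \<exists>S\<in>elts U. \<forall>\<xi>\<in>elts S. W.j \<xi> \<in> elts Y}"
    by (rule small_sepU) (rule DF1[OF W.DF_j] D_intros)+
  moreover have "{Y\<in>elts P. \<exists>S\<in>elts U. \<forall>\<xi>\<in>elts S. W.j \<xi> \<in> elts Y} =
    {Y\<in>Ult UNIV W. elts Y \<subseteq> elts lam_star \<and> U.ae (\<lambda>\<xi>. W.j \<xi> \<in> elts Y)}"
    unfolding P U.ae_def by blast
  moreover have "{Y\<in>Ult UNIV W. elts Y \<subseteq> elts lam_star \<and> U.ae (\<lambda>\<xi>. W.j \<xi> \<in> elts Y)} =
    {Y\<in>Ult UNIV W. elts Y \<subseteq> elts lam_star \<and> vset {\<xi>. W.j \<xi> \<in> elts Y} \<in> elts U}"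
    using ae by blast
  ultimately show ?thesis unfolding s_trans_def by simp
qed

lemma j_lam_U_fn: "lam lam_U W.j \<in> U.Fn" "\<xi> \<in> elts lam_U \<Longrightarrow> ap (lam lam_U W.j) \<xi> = W.j \<xi>"
  by (rule U.lam_Fn[OF W.DF_j]; assumption)+

text \<open>With \<open>\<sigma>\<close> the class of \<open>W.j\<close> restricted to the space of
  \<open>U\<close>, s_W(U) is the family derived from \<open>U.j\<close> by \<open>\<sigma>\<close>.
  Internality brings both \<open>\<sigma>\<close> and the restriction of \<open>U.j\<close> to a
  power set into M_W.\<close>

lemma internal_s_in:
  assumes "internal U W"
  shows "s \<in> Ult UNIV W"
proof -
  have int: "\<exists>J\<in>Ult UNIV W. function_on x J \<and> (\<forall>y\<in>elts x. app J y = U.j y)" if "x \<in> Ult UNIV W" for x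
  proof (intro bexI[of _ "lam x U.j"] conjI ballI)
    show "lam x U.j \<in> Ult UNIV W" using assms that unfolding internal_def by blast
    show "function_on x (lam x U.j)" by (rule lam_inner(2)[OF inner_UNIV UNIV_I U.DF_j])
    show "app (lam x U.j) y = U.j y" if "y \<in> elts x" for y by (rule lam_inner(3)[OF inner_UNIV UNIV_I U.DF_j that])
  qed
  have ap_in: "app J y \<in> Ult UNIV W" if "J \<in> Ult UNIV W" "function_on x J" "y \<in> elts x" for J x y
    by (rule app_in[OF W.inner_Ult that])
  define \<sigma> where "\<sigma> = U.cl (lam lam_U W.j)"
  have \<sigma>: "\<sigma> \<in> elts (U.j Y) \<longleftrightarrow> U.ae (\<lambda>\<xi>. W.j \<xi> \<in> elts Y)" for Y
    unfolding \<sigma>_def U.cl_mem_j[OF j_lam_U_fn(1) UNIV_I] by (rule U.ae_cong) (simp add: j_lam_U_fn)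
  \<comment> \<open>Internality speaks of restrictions to sets. The singleton extracts the value at
    \<open>lam_star\<close>, and transitivity of M_W then captures its element
    \<open>\<sigma>\<close>.\<close>
  have "vset {lam_star} \<in> Ult UNIV W"
    by (rule inner_in[OF W.inner_Ult]) (rule lam_star_in D_intros)+
  from int[OF this] obtain J where "J \<in> Ult UNIV W" "function_on (vset {lam_star}) J" "app J lam_star = U.j lam_star" by auto
  then have "U.j lam_star \<in> Ult UNIV W" using ap_in[of J "vset {lam_star}" lam_star] by simp
  moreover have "\<sigma> \<in> elts (U.j lam_star)" unfolding \<sigma> by (rule U.ae_all) (simp add: j_lam_star)
  ultimately have \<sigma>W: "\<sigma> \<in> Ult UNIV W" by (rule W.Ult_transitive)
  obtain P where P: "P \<in> Ult UNIV W" "elts P = {y\<in>Ult UNIV W. elts y \<subseteq> elts lam_star}"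
    using inner_Pow[OF W.inner_Ult lam_star_in] by blast
  obtain J where J: "J \<in> Ult UNIV W" "function_on P J" "\<forall>y\<in>elts P. app J y = U.j y" using int[OF P(1)] by blast
  have "\<exists>z\<in>Ult UNIV W. elts z = {Y\<in>elts P. \<sigma> \<in> elts (ap J Y)}"
    by (rule sep[OF W.inner_Ult P(1)]) (rule \<sigma>W J D_intros)+
  moreover have "{Y\<in>elts P. \<sigma> \<in> elts (ap J Y)} = elts s"
    unfolding elts_s P using J(3) ap_app[OF J(2)] P \<sigma> by auto
  ultimately show ?thesis using elts_eq_iff by metis
qed

text \<open>Replace \<open>k(\<xi>) = [F\<^sub>\<xi>]\<^sub>W\<close> by \<open>h(\<eta>) = j\<^sub>W(F)\<^sub>\<eta>([id]\<^sub>W)\<close>.\<close>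

lemma factor:
  assumes k: "\<And>\<xi>. \<xi> \<in> elts lam_U \<Longrightarrow> ap k \<xi> \<in> Ult UNIV W"
  shows "\<exists>h\<in>Ult UNIV W. function_on lam_star h \<and> (\<forall>\<xi>\<in>elts lam_U. ap h (W.j \<xi>) = ap k \<xi>)"
proof -
  have "D {UNIV} UNIV (\<lambda>N e. function_on W.X (e 0) \<and> ap k (etl e 0) = uclass UNIV W (e 0))"
    by (rule DF1[OF W.DF_cl] D_intros)+
  moreover have "\<exists>f\<in>UNIV. function_on W.X f \<and> ap k \<xi> = uclass UNIV W f" if \<xi>: "\<xi> \<in> elts lam_U" for \<xi>
  proof -
    obtain f where "f \<in> W.Fn" "ap k \<xi> = W.cl f" using k[OF \<xi>] unfolding W.Ult_iff by blast
    then show ?thesis using W.uclass_cl W.FnD(2) by (intro bexI[of _ f]) auto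
  qed
  ultimately obtain F where F: "function_on lam_U F" "\<forall>\<xi>\<in>elts lam_U. function_on W.X (app F \<xi>) \<and> ap k \<xi> = uclass UNIV W (app F \<xi>)"
    using uniformization[OF inner_UNIV UNIV_I, of "\<lambda>\<xi> f. function_on W.X f \<and> ap k \<xi> = uclass UNIV W f" lam_U] by blast
  have DF: "DF {Ult UNIV W} (Ult UNIV W) (\<lambda>N e. ap (ap (W.j F) (e 0)) W.seed)"
    by (rule W.j_in[OF UNIV_I] W.seed_in D_intros)+
  note h = lam_inner[OF W.inner_Ult lam_star_in DF]
  have "ap (lam lam_star (\<lambda>\<eta>. ap (ap (W.j F) \<eta>) W.seed)) (W.j \<xi>) = ap k \<xi>" if \<xi>: "\<xi> \<in> elts lam_U" for \<xi>
  proof -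
    have fF: "app F \<xi> \<in> W.Fn" using F(2) \<xi> by (simp add: W.Fn_def)
    have "ap (lam lam_star (\<lambda>\<eta>. ap (ap (W.j F) \<eta>) W.seed)) (W.j \<xi>) = ap (ap (W.j F) (W.j \<xi>)) W.seed"
      using ap_app[OF h(2)] h(3) \<xi> by (simp add: j_lam_star)
    also have "\<dots> = ap (W.j (app F \<xi>)) W.seed" using W.j_ap[of F \<xi>] ap_app[OF F(1) \<xi>] by simp
    also have "\<dots> = ap k \<xi>" using W.cl_rep[OF fF] W.uclass_cl[OF fF] F(2) \<xi> by simp
    finally show ?thesis .
  qed
  then show ?thesis using h(1,2) by blast
qed

section \<open>Consequences of s_W(U) being an element of M_W\<close>

context
  assumes s_in: "s \<in> Ult UNIV W"
begin

lemma s_pushforward: "cc_ultrafilter (Ult UNIV W) s" "space s = lam_star"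
  "Y \<in> Ult UNIV W \<Longrightarrow> ae_in s (\<lambda>x. x \<in> elts Y) \<longleftrightarrow> U.ae (\<lambda>\<xi>. W.j \<xi> \<in> elts Y)"
proof -
  have 1: "U.ae (\<lambda>z. ap (lam lam_U W.j) z \<in> elts Y) \<longleftrightarrow> U.ae (\<lambda>\<xi>. W.j \<xi> \<in> elts Y)" for Y
    by (rule U.ae_cong) (simp add: j_lam_U_fn)
  have 2: "U.ae (\<lambda>z. ap (lam lam_U W.j) z \<in> elts lam_star)"
    unfolding 1 by (rule U.ae_all) (simp add: j_lam_star)
  have 3: "elts s = {Y\<in>Ult UNIV W. elts Y \<subseteq> elts lam_star \<and> U.ae (\<lambda>z. ap (lam lam_U W.j) z \<in> elts Y)}"
    unfolding elts_s 1 ..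
  note pf = U.pushforward[OF W.inner_Ult subset_UNIV j_lam_U_fn(1) lam_star_in 2 s_in 3]
  show "cc_ultrafilter (Ult UNIV W) s" "space s = lam_star" by (rule pf)+
  show "ae_in s (\<lambda>x. x \<in> elts Y) \<longleftrightarrow> U.ae (\<lambda>\<xi>. W.j \<xi> \<in> elts Y)" if "Y \<in> Ult UNIV W"
    using pf(3)[OF that] 1 by simp
qed

lemma s_ultrapower: "ultrapower (Ult UNIV W) s"
  by (rule W.inner_ultrapower_Ult[OF s_pushforward(1)])

lemma s_ae:
  assumes "D {Ult UNIV W} (Ult UNIV W) (\<lambda>N e. P (e 0))"
  shows "ae_in s P \<longleftrightarrow> U.ae (\<lambda>\<xi>. P (W.j \<xi>))"
proof -
  interpret s: ultrapower "Ult UNIV W" s by (rule s_ultrapower)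
  obtain Y where Y: "Y \<in> Ult UNIV W" "elts Y = {x\<in>elts lam_star. P x}" using sep[OF W.inner_Ult lam_star_in assms] by blast
  have "ae_in s P \<longleftrightarrow> s.ae (\<lambda>x. x \<in> elts Y)" by (rule s.ae_cong) (simp add: Y s_pushforward)
  also have "\<dots> \<longleftrightarrow> U.ae (\<lambda>\<xi>. W.j \<xi> \<in> elts Y)" by (rule s_pushforward(3)[OF Y(1)])
  also have "\<dots> \<longleftrightarrow> U.ae (\<lambda>\<xi>. P (W.j \<xi>))" by (rule U.ae_cong) (simp add: Y j_lam_star)
  finally show ?thesis .
qed

lemma s_Unif: "s \<in> Unif (Ult UNIV W)"
  unfolding Unif_def
proof (intro CollectI conjI ballI s_pushforward(1))
  show "Ord (space s)" using Ord_lam_star s_pushforward by simp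
  fix \<beta> assume "\<beta> \<in> elts (space s)"
  then have \<beta>: "\<beta> \<in> elts lam_star" using s_pushforward by simp
  then have \<beta>W: "\<beta> \<in> Ult UNIV W" using W.Ult_transitive lam_star_in by blast
  let ?D = "vset (elts lam_star - elts \<beta>)"
  have D: "?D \<in> Ult UNIV W"
    by (rule inner_in[OF W.inner_Ult]) (rule lam_star_in \<beta>W D_intros)+
  obtain \<zeta> where \<zeta>: "\<zeta> \<in> elts lam_U" "\<beta> = W.j \<zeta> \<or> \<beta> \<in> elts (W.j \<zeta>)" using \<beta> unfolding elts_lam_star by blast
  have O\<zeta>: "Ord (W.j \<zeta>)" using W.j_Ord[of \<zeta>] Ord_elt[OF Ord_lam_U \<zeta>(1)] by simp
  have "U.ae (\<lambda>\<xi>. \<xi> \<in> elts lam_U \<and> \<xi> \<notin> elts \<zeta>)" unfolding U.ae_def using UnifD(3)[OF inner_UNIV U_Unif \<zeta>(1)]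
    by (intro bexI[of _ "vset (elts lam_U - elts \<zeta>)"]) auto
  then have "U.ae (\<lambda>\<xi>. W.j \<xi> \<in> elts ?D)"
  proof (rule U.ae_mono)
    fix \<xi> assume \<xi>: "\<xi> \<in> elts lam_U \<and> \<xi> \<notin> elts \<zeta>"
    have "W.j \<xi> \<notin> elts \<beta>" using \<zeta>(2) Ord_trans[OF O\<zeta>] W.j_mem[of \<xi> \<zeta>] \<xi> by auto
    then show "W.j \<xi> \<in> elts ?D" using \<xi> j_lam_star by simp
  qed
  then show "vset (elts (space s) - elts \<beta>) \<in> elts s" unfolding s_pushforward(2) elts_s using D by auto
qed

lemma s_limit: "ult_limit W s = U"
proof -
  have li: "limit_index W (space s) = lam_U" unfolding s_pushforward(2)
  proof (rule limit_indexI[OF Ord_lam_U lam_star_sub])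
    fix \<gamma> assume "\<gamma> \<in> elts lam_U"
    then show "\<not> elts lam_star \<subseteq> elts (W.j \<gamma>)" using j_lam_star elts_irrefl by blast
  qed
  have "Y \<in> elts (ult_limit W s) \<longleftrightarrow> Y \<in> elts U" for Y
  proof -
    have "Y \<in> elts (ult_limit W s) \<longleftrightarrow> elts Y \<subseteq> elts lam_U \<and> U.ae (\<lambda>\<xi>. \<xi> \<in> elts Y)"
      unfolding elts_ult_limit[OF W.ultrapower_axioms s_Unif] li
      using s_pushforward(3)[OF W.j_in[OF UNIV_I]] W.j_mem by simp
    also have "\<dots> \<longleftrightarrow> Y \<in> elts U"
      using U.ae_set[of Y "\<lambda>x. x \<in> elts Y", OF _ UNIV_I] U.Z_sub[of Y] by blast
    finally show ?thesis .
  qed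
  then show ?thesis using elts_eq_iff by blast
qed

text \<open>The embedding induced by \<open>s\<close> sends [f]_U to the class of
  \<open>W.j f\<close>. By \<open>s_ae\<close> its membership in the class of \<open>E\<close> is
  decided at the points \<open>W.j \<xi>\<close>, so \<open>D\<close> is represented by the function
  taking \<xi> to the subsets x of \<xi> with \<open>W.j x\<close> in \<open>E\<close> at
  \<open>W.j \<xi>\<close>.\<close>

lemma s_amenable: "amenable W U s"
  unfolding amenable_def
proof (intro ballI)
  fix E assume E: "E \<in> Ult UNIV W"
  let ?F = "\<lambda>\<xi>. vset {x\<in>elts (vset {y\<in>UNIV. elts y \<subseteq> elts \<xi>}). W.j x \<in> elts (ap E (W.j \<xi>))}"
  have DF: "DF {UNIV} UNIV (\<lambda>N e. ?F (e 0))"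
    by (rule DF1[OF W.DF_j] D_intros)+
  have eF: "elts (?F \<xi>) = {x. elts x \<subseteq> elts \<xi> \<and> W.j x \<in> elts (ap E (W.j \<xi>))}" for \<xi>
  proof -
    have "elts (vset {y\<in>UNIV. elts y \<subseteq> elts \<xi>}) = {y. elts y \<subseteq> elts \<xi>}"
      using elts_vset[OF bex_small[OF inner_Pow[OF inner_UNIV UNIV_I]]] by simp
    moreover have "elts (?F \<xi>) = {x\<in>elts (vset {y\<in>UNIV. elts y \<subseteq> elts \<xi>}). W.j x \<in> elts (ap E (W.j \<xi>))}"
      by (rule small_UNIV) (rule DF1[OF W.DF_j] D_intros)+
    ultimately show ?thesis by auto
  qed
  note F = U.lam_Fn[OF DF]
  show "\<exists>D\<in>Ult UNIV U. \<forall>f. function_on lam_U f \<and> (\<forall>\<eta>\<in>elts lam_U. elts (ap f \<eta>) \<subseteq> elts \<eta>) \<longrightarrow>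
      (U.cl f \<in> elts D \<longleftrightarrow> ae_in s (\<lambda>\<eta>. ap (W.j f) \<eta> \<in> elts (ap E \<eta>)))"
  proof (intro bexI[OF _ U.cl_Ult[OF F(1)]] allI impI, elim conjE)
    fix f assume fo: "function_on lam_U f" and fs: "\<forall>\<eta>\<in>elts lam_U. elts (ap f \<eta>) \<subseteq> elts \<eta>"
    then have f: "f \<in> U.Fn" by (simp add: U.Fn_def)
    have "U.cl f \<in> elts (U.cl (lam lam_U ?F)) \<longleftrightarrow> U.ae (\<lambda>\<xi>. ap f \<xi> \<in> elts (ap (lam lam_U ?F) \<xi>))"
      by (rule U.cl_mem[OF f F(1)])
    also have "\<dots> \<longleftrightarrow> U.ae (\<lambda>\<xi>. ap (W.j f) (W.j \<xi>) \<in> elts (ap E (W.j \<xi>)))"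
    proof (rule U.ae_cong)
      fix \<xi> assume \<xi>: "\<xi> \<in> elts lam_U"
      show "ap f \<xi> \<in> elts (ap (lam lam_U ?F) \<xi>) \<longleftrightarrow> ap (W.j f) (W.j \<xi>) \<in> elts (ap E (W.j \<xi>))"
        unfolding F(2)[OF \<xi>] eF W.j_ap[OF UNIV_I UNIV_I] using fs \<xi> by simp
    qed
    also have "\<dots> \<longleftrightarrow> ae_in s (\<lambda>\<eta>. ap (W.j f) \<eta> \<in> elts (ap E \<eta>))"
      by (rule s_ae[symmetric]) (rule W.j_in[OF UNIV_I] E D_intros)+
    finally show "U.cl f \<in> elts (U.cl (lam lam_U ?F)) \<longleftrightarrow> ae_in s (\<lambda>\<eta>. ap (W.j f) \<eta> \<in> elts (ap E \<eta>))" .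
  qed
qed

text \<open>A function on \<open>lam_star\<close> in M_W is matched with a function on the space of
  \<open>U\<close> when its composition with \<open>W.j\<close> equals the latter almost everywhere.
  Composition gives one direction of a bisimulation and \<open>factor\<close> the other, so the
  ultrapower by \<open>s\<close> in M_W and the one by \<open>U\<close> in the universe assign the
  same value to constant functions.\<close>

lemma s_emb:
  assumes x: "x \<in> Ult UNIV W"
  shows "ult_emb (Ult UNIV W) s x = U.j x"
proof -
  interpret s: ultrapower "Ult UNIV W" s by (rule s_ultrapower)
  note sX = s_pushforward(2)
  obtain A where A: "A \<in> Ult UNIV W" "transitive A" "x \<in> elts A" using transitive_superset[OF W.inner_Ult x] by blast
  obtain t1 where t1: "s.coll A t1" using s.coll_ex[OF A(1,2)] by blast
  obtain t2 where t2: "U.coll A t2" using U.coll_ex[OF UNIV_I A(2)] by blast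
  let ?F1 = "funs (Ult UNIV W) s.X A" and ?F2 = "funs UNIV lam_U A"
  let ?S = "\<lambda>g f. U.ae (\<lambda>\<xi>. ap g (W.j \<xi>) = ap f \<xi>)"
  have c1: "s.const x \<in> elts ?F1" unfolding s.elts_funs[OF A(1)] using s.const_Fn[OF x] s.ap_const[OF x] A by simp
  have c2: "U.const x \<in> elts ?F2" unfolding U.elts_funs[OF UNIV_I] using U.const_Fn[OF UNIV_I] U.ap_const[OF UNIV_I] A by simp
  have R: "s.R h g \<longleftrightarrow> U.ae (\<lambda>\<xi>. ap h (W.j \<xi>) \<in> elts (ap g (W.j \<xi>)))" if "h \<in> s.Fn" "g \<in> s.Fn" for h g
    unfolding s.R_def by (rule s_ae) (rule s.FnD that D_intros)+
  have F1: "g \<in> s.Fn" "\<eta> \<in> elts lam_star \<Longrightarrow> ap g \<eta> \<in> elts A" if "g \<in> elts ?F1" for g \<eta>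
    using that unfolding s.elts_funs[OF A(1)] by (auto simp: sX)
  have F2: "g \<in> U.Fn" "\<xi> \<in> elts lam_U \<Longrightarrow> ap g \<xi> \<in> elts A" if "g \<in> elts ?F2" for g \<xi>
    using that unfolding U.elts_funs[OF UNIV_I] by auto
  have "app t1 (s.const x) = app t2 (U.const x)"
  proof (rule collapse_bisim[where S = ?S and ?R1.0 = s.R and ?R2.0 = U.R, OF s.collD(4)[OF t1] _ U.collD(4)[OF t2] _ _ _ _ _ c1 c2])
    show "elts (app t1 g) = {app t1 h |h. h \<in> elts ?F1 \<and> s.R h g}" if "g \<in> elts ?F1" for g by (rule s.coll_elts[OF t1 that])
    show "elts (app t2 g) = {app t2 h |h. h \<in> elts ?F2 \<and> U.R h g}" if "g \<in> elts ?F2" for g by (rule U.coll_elts[OF t2 that])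
    show "D {UNIV} UNIV (\<lambda>N e. ?S (etl e 0) (e 0))"
      unfolding U.ae_def by (rule DF1[OF W.DF_j] D_intros)+
    show "?S (s.const x) (U.const x)"
    proof (rule U.ae_all)
      fix \<xi> assume \<xi>: "\<xi> \<in> elts lam_U"
      then have "W.j \<xi> \<in> elts s.X" by (simp add: sX j_lam_star)
      then show "ap (s.const x) (W.j \<xi>) = ap (U.const x) \<xi>" using s.ap_const[OF x] U.ap_const[OF UNIV_I \<xi>] by simp
    qed
    show "\<exists>k\<in>elts ?F2. U.R k f \<and> ?S h k" if S: "?S g f" and g: "g \<in> elts ?F1" and f: "f \<in> elts ?F2" and h: "h \<in> elts ?F1" "s.R h g" for g f h
    proof -
      have DF: "DF {UNIV} UNIV (\<lambda>N e. ap h (W.j (e 0)))" by (rule W.DF_j D_intros)+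
      note k = U.lam_Fn[OF DF]
      have kF: "lam lam_U (\<lambda>\<xi>. ap h (W.j \<xi>)) \<in> elts ?F2"
        unfolding U.elts_funs[OF UNIV_I] using k F1(2)[OF h(1)] j_lam_star by auto
      have "U.ae (\<lambda>\<xi>. ap h (W.j \<xi>) \<in> elts (ap g (W.j \<xi>)) \<and> ap g (W.j \<xi>) = ap f \<xi>)"
        unfolding U.ae_conj using R[OF F1(1)[OF h(1)] F1(1)[OF g]] h(2) S by blast
      then have "U.R (lam lam_U (\<lambda>\<xi>. ap h (W.j \<xi>))) f" unfolding U.R_def by (rule U.ae_mono) (auto simp: k(2))
      moreover have "?S h (lam lam_U (\<lambda>\<xi>. ap h (W.j \<xi>)))" by (rule U.ae_all) (simp add: k(2))
      ultimately show ?thesis using kF by blast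
    qed
    show "\<exists>h\<in>elts ?F1. s.R h g \<and> ?S h k" if S: "?S g f" and g: "g \<in> elts ?F1" and f: "f \<in> elts ?F2" and k: "k \<in> elts ?F2" "U.R k f" for g f k
    proof -
      have "ap k \<xi> \<in> Ult UNIV W" if "\<xi> \<in> elts lam_U" for \<xi>
        using F2(2)[OF k(1) that] W.Ult_transitive[OF A(1)] by blast
      then obtain h0 where h0: "h0 \<in> Ult UNIV W" "\<forall>\<xi>\<in>elts lam_U. ap h0 (W.j \<xi>) = ap k \<xi>" using factor by blast
      \<comment> \<open>\<open>h0\<close> is controlled only at the points \<open>W.j \<xi>\<close>.
        Elsewhere its values may leave \<open>A\<close>, and there the default \<open>x\<close>, an
        element of \<open>A\<close>, is used.\<close>
      let ?h = "\<lambda>\<eta>. if ap h0 \<eta> \<in> elts A then ap h0 \<eta> else x"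
      have DF: "DF {Ult UNIV W} (Ult UNIV W) (\<lambda>N e. ?h (e 0))" by (rule h0 A x D_intros)+
      note h = s.lam_Fn[OF DF]
      have hk: "ap (lam s.X ?h) (W.j \<xi>) = ap k \<xi>" if "\<xi> \<in> elts lam_U" for \<xi>
        using h(2)[of "W.j \<xi>"] h0(2) F2(2)[OF k(1) that] that by (simp add: sX j_lam_star)
      have hF: "lam s.X ?h \<in> elts ?F1" unfolding s.elts_funs[OF A(1)] using h A(3) by simp
      have "U.ae (\<lambda>\<xi>. ap k \<xi> \<in> elts (ap f \<xi>) \<and> ap g (W.j \<xi>) = ap f \<xi>)"
        unfolding U.ae_conj using k(2) S unfolding U.R_def by blast
      then have "s.R (lam s.X ?h) g" unfolding R[OF h(1) F1(1)[OF g]] by (rule U.ae_mono) (auto simp: hk)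
      moreover have "?S (lam s.X ?h) k" by (rule U.ae_all) (rule hk)
      ultimately show ?thesis using hF by blast
    qed
  qed
  then show ?thesis using s.cl_coll[OF t1 c1] U.cl_coll[OF t2 c2] by (simp add: s.j_cl U.j_cl)
qed

text \<open>By \<open>s_emb\<close>, \<open>U.j\<close> agrees on M_W with an ultrapower embedding
  that M_W defines from \<open>s\<close>, and restrictions of the latter to sets belong to M_W by
  replacement there.\<close>

lemma internal_if: "internal U W"
  unfolding internal_def
proof
  fix x assume x: "x \<in> Ult UNIV W"
  interpret s: ultrapower "Ult UNIV W" s by (rule s_ultrapower)
  obtain J where J: "J \<in> Ult UNIV W" "function_on x J" "\<forall>y\<in>elts x. app J y = s.j y" using s.j_function[OF x] by blast
  have "lam x U.j = J" by (rule lam_eqI[OF J(2)]) (use J(3) s_emb W.Ult_transitive[OF x] in simp)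
  then show "lam x U.j \<in> Ult UNIV W" using J by simp
qed

text \<open>With \<open>E\<close> represented by \<open>G\<close>, the condition to be captured says
  that [f]_W is an element of [G(\<xi>)]_W for U-almost every \<xi>. \<open>factor\<close> gathers
  the classes [G(\<xi>)]_W into a function \<open>h\<close> of M_W on \<open>lam_star\<close>, and
  almost every \<xi> with respect to \<open>U\<close> becomes almost every point with respect to
  \<open>s\<close>. Hence \<open>D\<close> is definable in M_W from \<open>h\<close> and
  \<open>s\<close>.\<close>

lemma j_amenable: "amenable U W (U.j W)"
  unfolding amenable_def
proof (intro ballI)
  fix E assume "E \<in> Ult UNIV U"
  then obtain G where G: "G \<in> U.Fn" "E = U.cl G" by (auto simp: U.Ult_iff)
  interpret s: ultrapower "Ult UNIV W" s by (rule s_ultrapower)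
  have dW: "DF {UNIV} UNIV (\<lambda>N e. ap (ap G \<xi>) (e 0))" for \<xi> by (rule D_intros)+
  note Gf = W.lam_Fn[OF dW]
  let ?k = "\<lambda>\<xi>. uclass UNIV W (lam W.X (\<lambda>\<eta>. ap (ap G \<xi>) \<eta>))"
  have dk: "DF {UNIV} UNIV (\<lambda>N e. ?k (e 0))"
    by (rule DF1[OF W.DF_cl] D_intros)+
  note k = U.lam_Fn[OF dk]
  have k2: "ap (lam lam_U ?k) \<xi> = W.cl (lam W.X (\<lambda>\<eta>. ap (ap G \<xi>) \<eta>))" if "\<xi> \<in> elts lam_U" for \<xi>
    using k(2)[OF that] W.uclass_cl[OF Gf(1)] by simp
  have "ap (lam lam_U ?k) \<xi> \<in> Ult UNIV W" if "\<xi> \<in> elts lam_U" for \<xi>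
    unfolding k2[OF that] by (rule W.cl_Ult[OF Gf(1)])
  then obtain h where h: "h \<in> Ult UNIV W" "\<forall>\<xi>\<in>elts lam_U. ap h (W.j \<xi>) = ap (lam lam_U ?k) \<xi>" using factor by blast
  obtain P where P: "P \<in> Ult UNIV W" "elts P = {y\<in>Ult UNIV W. elts y \<subseteq> elts W.seed}"
    using inner_Pow[OF W.inner_Ult W.seed_in] by blast
  have "\<exists>D\<in>Ult UNIV W. elts D = {x\<in>elts P. s.ae (\<lambda>\<eta>. x \<in> elts (ap h \<eta>))}" unfolding s.ae_def
    by (rule sep[OF W.inner_Ult P(1)]) (rule h s_in D_intros)+
  then obtain D where D: "D \<in> Ult UNIV W" "elts D = {x\<in>elts P. s.ae (\<lambda>\<eta>. x \<in> elts (ap h \<eta>))}" by (elim bexE)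
  show "\<exists>D\<in>Ult UNIV W. \<forall>f. function_on W.X f \<and> (\<forall>\<eta>\<in>elts W.X. elts (ap f \<eta>) \<subseteq> elts \<eta>) \<longrightarrow>
      (W.cl f \<in> elts D \<longleftrightarrow> ae_in (U.j W) (\<lambda>\<eta>. ap (U.j f) \<eta> \<in> elts (ap E \<eta>)))"
  proof (intro bexI[OF _ D(1)] allI impI, elim conjE)
    fix f assume fo: "function_on W.X f" and fs: "\<forall>\<eta>\<in>elts W.X. elts (ap f \<eta>) \<subseteq> elts \<eta>"
    then have f: "f \<in> W.Fn" by (simp add: W.Fn_def)
    have sub: "elts (W.cl f) \<subseteq> elts W.seed"
    proof -
      have "elts (W.cl f) \<subseteq> elts W.seed \<longleftrightarrow> W.ae (\<lambda>x. elts (ap f x) \<subseteq> elts (ap (lam W.X (\<lambda>x. x)) x))"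
        unfolding W.seed_cl by (rule W.transfer2[where P = "\<lambda>M x y. elts x \<subseteq> elts y", OF _ f W.id_Fn]) (rule D_intros)+
      moreover have "W.ae (\<lambda>x. elts (ap f x) \<subseteq> elts (ap (lam W.X (\<lambda>x. x)) x))"
        by (rule W.ae_all) (use fs W.ap_id in auto)
      ultimately show ?thesis by blast
    qed
    have fW: "W.cl f \<in> Ult UNIV W" by (rule W.cl_Ult[OF f])
    interpret jW: ultrapower "Ult UNIV U" "U.j W"
      by (rule UnifD(1)[OF U.inner_Ult]) (simp add: U.j_Unif W_Unif)
    let ?P = "\<lambda>(M :: 'v set) z f E. \<exists>S\<in>elts z. \<forall>\<eta>\<in>elts S. ap f \<eta> \<in> elts (ap E \<eta>)"
    have "W.cl f \<in> elts D \<longleftrightarrow> s.ae (\<lambda>\<eta>. W.cl f \<in> elts (ap h \<eta>))" unfolding D(2) P(2) using sub fW by simp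
    also have "\<dots> \<longleftrightarrow> U.ae (\<lambda>\<xi>. W.cl f \<in> elts (ap h (W.j \<xi>)))"
      by (rule s_ae) (rule h fW D_intros)+
    also have "\<dots> \<longleftrightarrow> U.ae (\<lambda>\<xi>. ?P UNIV (ap (U.const W) \<xi>) (ap (U.const f) \<xi>) (ap G \<xi>))"
    proof (rule U.ae_cong)
      fix \<xi> assume \<xi>: "\<xi> \<in> elts lam_U"
      have "W.cl f \<in> elts (ap h (W.j \<xi>)) \<longleftrightarrow> W.ae (\<lambda>\<eta>. ap f \<eta> \<in> elts (ap (lam W.X (\<lambda>\<eta>. ap (ap G \<xi>) \<eta>)) \<eta>))"
        using h(2) \<xi> k2[OF \<xi>] W.cl_mem[OF f Gf(1)] by simp
      also have "\<dots> \<longleftrightarrow> W.ae (\<lambda>\<eta>. ap f \<eta> \<in> elts (ap (ap G \<xi>) \<eta>))" by (rule W.ae_cong) (simp add: Gf(2))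
      finally show "W.cl f \<in> elts (ap h (W.j \<xi>)) \<longleftrightarrow> ?P UNIV (ap (U.const W) \<xi>) (ap (U.const f) \<xi>) (ap G \<xi>)"
        by (simp add: W.ae_def U.ap_const[OF UNIV_I \<xi>])
    qed
    also have "\<dots> \<longleftrightarrow> ?P (Ult UNIV U) (U.cl (U.const W)) (U.cl (U.const f)) (U.cl G)"
      by (rule U.transfer3[where P = ?P, OF _ U.const_Fn[OF UNIV_I] U.const_Fn[OF UNIV_I] G(1), symmetric])
         (rule D_intros)+
    also have "\<dots> \<longleftrightarrow> ae_in (U.j W) (\<lambda>\<eta>. ap (U.j f) \<eta> \<in> elts (ap E \<eta>))"
      by (subst jW.ae_def) (simp only: G(2) U.j_cl)
    finally show "W.cl f \<in> elts D \<longleftrightarrow> ae_in (U.j W) (\<lambda>\<eta>. ap (U.j f) \<eta> \<in> elts (ap E \<eta>))" .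
  qed
qed

end

section \<open>The image j_U(W)\<close>

lemma j_W_Unif: "U.j W \<in> Unif (Ult UNIV U)"
  by (simp add: U.j_Unif W_Unif)

lemma j_W_limit: "ult_limit U (U.j W) = W"
proof -
  interpret jW: ultrapower "Ult UNIV U" "U.j W" by (rule UnifD(1)[OF U.inner_Ult j_W_Unif])
  have sp: "space (U.j W) = U.j W.X" by (rule U.j_space[OF UNIV_I])
  have li: "limit_index U (space (U.j W)) = W.X" unfolding sp
  proof (rule limit_indexI[OF UnifD(2)[OF inner_UNIV W_Unif] subset_refl])
    fix \<gamma> assume "\<gamma> \<in> elts W.X"
    then show "\<not> elts (U.j W.X) \<subseteq> elts (U.j \<gamma>)" using U.j_subset[of W.X \<gamma>] elts_irrefl by blast
  qed
  have "Y \<in> elts (ult_limit U (U.j W)) \<longleftrightarrow> Y \<in> elts W" for Y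
  proof -
    have "jW.ae (\<lambda>x. x \<in> elts (U.j Y)) \<longleftrightarrow> vset (elts Y \<inter> elts W.X) \<in> elts W"
      unfolding jW.ae_mem_Int[OF U.j_in[OF UNIV_I]] sp U.j_Int[OF UNIV_I UNIV_I] by (rule U.j_mem[OF UNIV_I UNIV_I])
    moreover have "vset (elts Y \<inter> elts W.X) = Y" if "elts Y \<subseteq> elts W.X"
      using that by (simp add: Int_absorb2)
    ultimately show ?thesis
      unfolding elts_ult_limit[OF U.ultrapower_axioms j_W_Unif] li using W.Z_sub[of Y] by auto
  qed
  then show ?thesis using elts_eq_iff by blast
qed

text \<open>If \<open>j\<^sub>U(W)\<close> is derived from \<open>i\<^sub>0\<close> using \<open>i\<^sub>1([id]\<^sub>W)\<close>, then \<open>s\<^sub>W(U)\<close> is derived from \<open>i\<^sub>1\<close> using \<open>i\<^sub>0([id]\<^sub>U)\<close>.\<close>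

lemma s_in_of_comparison:
  assumes c: "comparison UNIV U W Z0 Z1"
    and derived: "\<And>Y. Y \<in> Ult UNIV U \<Longrightarrow> ae_in (U.j W) (\<lambda>x. x \<in> elts Y) \<longleftrightarrow>
      ult_emb (Ult UNIV W) Z1 W.seed \<in> elts (ult_emb (Ult UNIV U) Z0 Y)"
  shows "s \<in> Ult UNIV W"
proof -
  interpret i0: ultrapower "Ult UNIV U" Z0 using U.inner_ultrapower_Ult c by (simp add: comparison_def)
  interpret i1: ultrapower "Ult UNIV W" Z1 using W.inner_ultrapower_Ult c by (simp add: comparison_def)
  interpret jW: ultrapower "Ult UNIV U" "U.j W" by (rule UnifD(1)[OF U.inner_Ult j_W_Unif])
  have N: "Ult (Ult UNIV U) Z0 = Ult (Ult UNIV W) Z1" and comm: "i0.j (U.j x) = i1.j (W.j x)" for x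
    using c by (auto simp: comparison_def)
  define e where "e = i1.j W.seed"
  have "e \<in> Ult (Ult UNIV U) Z0" unfolding e_def N by (rule i1.j_in[OF W.seed_in])
  then obtain g where g: "g \<in> i0.Fn" "e = i0.cl g" unfolding i0.Ult_iff by blast
  have "W.seed \<in> elts (W.j W.X)" unfolding W.seed_mem_j[OF UNIV_I] by (rule W.ae_all)
  then have "e \<in> elts (i0.j (U.j W.X))" unfolding comm e_def by (simp add: i1.j_mem[OF W.seed_in W.j_in[OF UNIV_I]])
  then have gX: "i0.ae (\<lambda>z. ap g z \<in> elts (U.j W.X))" unfolding g by (simp add: i0.cl_mem_j[OF g(1) U.j_in[OF UNIV_I]])
  \<comment> \<open>Los's theorem exchanges the two measures. With Y = [f]_W, the left side says
    that for U-almost every \<xi>, W-almost every \<eta> satisfies \<xi> \<in> f(\<eta>). In M_U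
    this becomes \<open>U.seed\<close> being in j_U(f)(\<eta>) for j_U(W)-almost every \<eta>, which
    by \<open>derived\<close> is decided at \<open>e\<close>; and i_0(j_U(f)) at \<open>e\<close> is
    the image of \<open>Y\<close> under the other embedding.\<close>
  have main: "U.ae (\<lambda>\<xi>. W.j \<xi> \<in> elts Y) \<longleftrightarrow> i0.j U.seed \<in> elts (i1.j Y)" if Y: "Y \<in> Ult UNIV W" for Y
  proof -
    obtain f where f: "f \<in> W.Fn" "Y = W.cl f" using Y unfolding W.Ult_iff by blast
    let ?P = "\<lambda>(M :: 'v set) z f a. \<exists>S\<in>elts z. \<forall>\<eta>\<in>elts S. a \<in> elts (ap f \<eta>)"
    have jf: "U.j f \<in> Ult UNIV U" by (rule U.j_in[OF UNIV_I])
    have "U.ae (\<lambda>\<xi>. W.j \<xi> \<in> elts Y) \<longleftrightarrow> U.ae (\<lambda>\<xi>. ?P UNIV (ap (U.const W) \<xi>) (ap (U.const f) \<xi>) (ap (lam lam_U (\<lambda>x. x)) \<xi>))"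
    proof (rule U.ae_cong)
      fix \<xi> assume \<xi>: "\<xi> \<in> elts lam_U"
      have "W.j \<xi> \<in> elts Y \<longleftrightarrow> W.ae (\<lambda>\<eta>. ap (W.const \<xi>) \<eta> \<in> elts (ap f \<eta>))"
        unfolding W.j_cl f by (rule W.cl_mem[OF W.const_Fn[OF UNIV_I] f(1)])
      also have "\<dots> \<longleftrightarrow> W.ae (\<lambda>\<eta>. \<xi> \<in> elts (ap f \<eta>))" by (rule W.ae_cong) (simp add: W.ap_const[OF UNIV_I])
      finally show "W.j \<xi> \<in> elts Y \<longleftrightarrow> ?P UNIV (ap (U.const W) \<xi>) (ap (U.const f) \<xi>) (ap (lam lam_U (\<lambda>x. x)) \<xi>)"
        by (simp add: W.ae_def U.ap_const[OF UNIV_I \<xi>] U.ap_id[OF \<xi>])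
    qed
    also have "\<dots> \<longleftrightarrow> ?P (Ult UNIV U) (U.cl (U.const W)) (U.cl (U.const f)) (U.cl (lam lam_U (\<lambda>x. x)))"
      by (rule U.transfer3[where P = ?P, OF _ U.const_Fn[OF UNIV_I] U.const_Fn[OF UNIV_I] U.id_Fn, symmetric])
         (rule D_intros)+
    also have "\<dots> \<longleftrightarrow> jW.ae (\<lambda>\<eta>. U.seed \<in> elts (ap (U.j f) \<eta>))" by (subst jW.ae_def) (simp only: U.j_cl U.seed_cl)
    also have "\<dots> \<longleftrightarrow> i0.ae (\<lambda>z. U.seed \<in> elts (ap (U.j f) (ap g z)))"
    proof -
      have "\<exists>z\<in>Ult UNIV U. elts z = {\<eta>\<in>elts (U.j W.X). U.seed \<in> elts (ap (U.j f) \<eta>)}"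
        by (rule sep[OF U.inner_Ult U.j_in[OF UNIV_I]]) (rule U.seed_in jf D_intros)+
      then obtain Q where Q: "Q \<in> Ult UNIV U" "elts Q = {\<eta>\<in>elts (U.j W.X). U.seed \<in> elts (ap (U.j f) \<eta>)}" by (elim bexE)
      have "jW.ae (\<lambda>\<eta>. U.seed \<in> elts (ap (U.j f) \<eta>)) \<longleftrightarrow> jW.ae (\<lambda>x. x \<in> elts Q)"
        by (rule jW.ae_cong) (simp add: Q U.j_space[OF UNIV_I])
      also have "\<dots> \<longleftrightarrow> e \<in> elts (i0.j Q)" unfolding e_def by (rule derived[OF Q(1)])
      also have "\<dots> \<longleftrightarrow> i0.ae (\<lambda>z. ap g z \<in> elts Q)" unfolding g by (rule i0.cl_mem_j[OF g(1) Q(1)])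
      also have "\<dots> \<longleftrightarrow> i0.ae (\<lambda>z. U.seed \<in> elts (ap (U.j f) (ap g z)))"
        unfolding Q(2) mem_Collect_eq i0.ae_conj using gX by simp
      finally show ?thesis .
    qed
    also have "\<dots> \<longleftrightarrow> i0.j U.seed \<in> elts (ap (i0.j (U.j f)) e)"
    proof -
      have df: "DF {Ult UNIV U} (Ult UNIV U) (\<lambda>N e. ap (U.j f) (ap g (e 0)))" by (rule jf i0.FnD(1)[OF g(1)] D_intros)+
      have "i0.j U.seed \<in> elts (ap (i0.j (U.j f)) e) \<longleftrightarrow>
        i0.ae (\<lambda>z. ap (i0.const U.seed) z \<in> elts (ap (lam i0.X (\<lambda>z. ap (U.j f) (ap g z))) z))"
        unfolding g(2) i0.ap_j_cl[OF jf g(1)] i0.j_cl[of U.seed]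
        by (rule i0.cl_mem[OF i0.const_Fn[OF U.seed_in] i0.lam_Fn(1)[OF df]])
      also have "\<dots> \<longleftrightarrow> i0.ae (\<lambda>z. U.seed \<in> elts (ap (U.j f) (ap g z)))"
        by (rule i0.ae_cong) (simp add: i0.ap_const[OF U.seed_in] i0.lam_Fn(2)[OF df])
      finally show ?thesis by simp
    qed
    also have "ap (i0.j (U.j f)) e = i1.j Y"
      unfolding f(2) W.cl_rep[OF f(1)] comm e_def by (rule i1.j_ap[OF W.j_in[OF UNIV_I] W.seed_in])
    finally show ?thesis .
  qed
  have "i0.j U.seed \<in> Ult (Ult UNIV W) Z1" unfolding N[symmetric] by (rule i0.j_in[OF U.seed_in])
  from i1.derived(1)[OF this lam_star_in] obtain E where E: "E \<in> Ult UNIV W"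
    "elts E = {x\<in>Ult UNIV W. elts x \<subseteq> elts lam_star \<and> i0.j U.seed \<in> elts (i1.j x)}" by (elim bexE)
  have "elts s = elts E" unfolding elts_s E(2) using main by blast
  then show ?thesis using E(1) elts_eq_iff by metis
qed

lemma internal_iff_s_in: "internal U W \<longleftrightarrow> s \<in> Ult UNIV W"
  using internal_s_in internal_if by blast

end

section \<open>The equivalence\<close>

lemma comparison_ex:
  "ultrapower_axiom (UNIV :: 'v::zfc set) \<Longrightarrow> U \<in> Unif UNIV \<Longrightarrow> W \<in> Unif UNIV \<Longrightarrow> \<exists>Z0 Z1. comparison UNIV U (W :: 'v) Z0 Z1"
  unfolding ultrapower_axiom_def using Unif_cc by blast

theorem mainTheorem6:
  fixes U W :: "'v::zfc"
  assumes "ultrapower_axiom (UNIV :: 'v set)"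
    and "U \<in> Unif UNIV" and "W \<in> Unif UNIV"
  shows "(internal U W \<longleftrightarrow> t_trans W U = s_trans W U) \<and>
    (t_trans W U = s_trans W U \<longleftrightarrow> t_trans U W = ult_emb UNIV U W) \<and>
    (t_trans U W = ult_emb UNIV U W \<longleftrightarrow>
      seed_le (Ult UNIV U) (ult_emb UNIV U W) (t_trans U W))"
proof -
  note UA = assms(1) and U = assms(2) and W = assms(3)
  interpret uniform_pair U W using U W by (simp add: uniform_pair_def)
  \<comment> \<open>One comparison yields both translations: as it stands it gives
    \<open>W'\<close>, and with its two sides exchanged it gives \<open>U'\<close>.\<close>
  obtain Z0 Z1 where c: "comparison UNIV U W Z0 Z1" using comparison_ex[OF UA U W] by blast
  obtain W' where W': "W' \<in> Unif (Ult UNIV U)" "ult_limit U W' = W" "amenable U W W'"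
    "\<forall>Y\<in>Ult UNIV U. ae_in W' (\<lambda>x. x \<in> elts Y) \<longleftrightarrow> ult_emb (Ult UNIV W) Z1 W.seed \<in> elts (ult_emb (Ult UNIV U) Z0 Y)"
    using translation_of_comparison[OF U W c] by blast
  obtain U' where U': "U' \<in> Unif (Ult UNIV W)" "ult_limit W U' = U" "amenable W U U'"
    using translation_of_comparison[OF W U comparison_sym[OF c]] by blast
  note tW = t_trans_eq[OF UA U W W'(1-3)]
  note tU = t_trans_eq[OF UA W U U'(1-3)]
  have 2: "t_trans W U = s \<longleftrightarrow> s \<in> Ult UNIV W"
  proof
    assume "t_trans W U = s"
    then show "s \<in> Ult UNIV W" using tU(1) ultrapower.Z_in[OF UnifD(1)[OF W.inner_Ult U'(1)]] by simp
  next
    assume s: "s \<in> Ult UNIV W"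
    show "t_trans W U = s" by (rule t_trans_eq(1)[OF UA W U s_Unif[OF s] s_limit[OF s] s_amenable[OF s]])
  qed
  have 3: "t_trans U W = U.j W \<longleftrightarrow> s \<in> Ult UNIV W"
  proof
    assume "t_trans U W = U.j W"
    \<comment> \<open>Since the translation is the ultrafilter derived from the comparison, the
      assumption says that \<open>U.j W\<close> itself is derived in this way.\<close>
    then have "W' = U.j W" using tW(1) by simp
    then show "s \<in> Ult UNIV W" using s_in_of_comparison[OF c] W'(4) by blast
  next
    assume s: "s \<in> Ult UNIV W"
    show "t_trans U W = U.j W" by (rule t_trans_eq(1)[OF UA U W j_W_Unif j_W_limit j_amenable[OF s]])
  qed
  have 4: "t_trans U W = U.j W \<longleftrightarrow> seed_le (Ult UNIV U) (U.j W) (t_trans U W)"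
    unfolding tW(1)
  proof
    assume "W' = U.j W"
    then show "seed_le (Ult UNIV U) (U.j W) W'" using tW(2)[OF W'(1,2)] by simp
  next
    assume "seed_le (Ult UNIV U) (U.j W) W'"
    \<comment> \<open>\<open>U.j W\<close> also has limit \<open>W\<close> and so competes in the
      minimization that defines the translation; this gives the inequality opposite to the assumed
      one.\<close>
    then show "W' = U.j W" using seed_le_antisym[OF U.inner_Ult W'(1) j_W_Unif tW(2)[OF j_W_Unif j_W_limit]] by blast
  qed
  show ?thesis using internal_iff_s_in 2 3 4 by blast
qed

end
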